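(* Let $F\in\mathcal{S}^{\sharp}$, let $Z_F$ be its generalised Hardy $Z$-function, and assume that the Riemann Hypothesis for $F$ holds. Then for every integer $k\ge 0$ there exists $T=T(k)>0$ (also allowed to depend on $F$) such that $Z_F^{(k+1)}(t)$ has exactly one zero between any two consecutive zeros of $Z_F^{(k)}(t)$ with $t\ge T$; that is, whenever $T\le \gamma<\gamma'$ are consecutive real zeros of $Z_F^{(k)}$, the function $Z_F^{(k+1)}$ has exactly one zero in the open interval $(\gamma,\gamma')$.
   Context: Write $s=\sigma+it$. The extended Selberg class $\mathcal{S}^{\sharp}$ is the set of functions $F$ such that: (S1) $F(s)=\sum_{n\ge1}a_F(n)n^{-s}$, absolutely convergent for $\sigma>1$, with $a_F(1)=1$; (S2) there is an integer $m\ge0$ such that $(s-1)^mF(s)$ extends to an entire function of finite order; the smallest such $m$ is denoted $m_F$; (S3) there exist an integer $r\ge0$, real numbers $Q>0$, $\lambda_j>0$, complex numbers $\mu_j$ with $\Re\mu_j\ge0$ $(1\le j\le r)$ and $\omega\in\mathbb{C}$ with $|\omega|=1$ such that, with the gamma factor $\gamma(s)=Q^s\prod_{j=1}^r\Gamma(\lambda_js+\mu_j)$, the function $\xi_F(s)=s^{m_F}(s-1)^{m_F}\gamma(s)F(s)$ satisfies $\xi_F(s)=\omega\overline{\xi_F(1-\overline{s})}$. No Euler product is assumed. Put $H(s)=\omega\overline{\gamma(1-\overline{s})}/\gamma(s)$, so that $F(s)=H(s)\overline{F(1-\overline{s})}$ and $|H(1/2+it)|=1$ for real $t$. Let $\theta_F:\mathbb{R}\to\mathbb{R}$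 be a smooth function with $H(1/2+it)=e^{-2i\theta_F(t)}$, and define $Z_F(t)=e^{i\theta_F(t)}F(1/2+it)$ for $t\in\mathbb{R}$; this is a real-valued function. The Riemann Hypothesis (RH) for $F$: every non-trivial zero of $F$, i.e. every zero of $\xi_F$, lies on the line $\Re s=1/2$. *)

theory Defs
  imports "HOL-Complex_Analysis.Complex_Analysis"
begin

text \<open>
  Members of the extended Selberg class are represented by functions of type complex to complex
  that carry the meromorphic continuation of the Dirichlet series. The only possible pole is
  \<open>s = 1\<close>; the value \<open>F 1\<close> plays no role in any of the notions below.
\<close>

definition has_dirichlet_series :: "(complex \<Rightarrow> complex) \<Rightarrow> bool" where
  "has_dirichlet_series F \<longleftrightarrow>
     (\<exists>a :: nat \<Rightarrow> complex. a 1 = 1 \<and>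
        (\<forall>s. Re s > 1 \<longrightarrow>
           summable (\<lambda>n. norm (a (Suc n) * of_nat (Suc n) powr (- s))) \<and>
           (\<lambda>n. a (Suc n) * of_nat (Suc n) powr (- s)) sums F s))"

definition entire_of_finite_order :: "(complex \<Rightarrow> complex) \<Rightarrow> bool" where
  "entire_of_finite_order G \<longleftrightarrow>
     G holomorphic_on UNIV \<and>
     (\<exists>\<rho>::real. \<forall>\<^sub>F s in at_infinity. norm (G s) \<le> exp (norm s powr \<rho>))"

definition extends_with_order :: "nat \<Rightarrow> (complex \<Rightarrow> complex) \<Rightarrow> bool" where
  "extends_with_order m F \<longleftrightarrow>
     (\<exists>G. entire_of_finite_order G \<and> (\<forall>s. s \<noteq> 1 \<longrightarrow> G s = (s - 1) ^ m * F s))"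

definition polar_order :: "(complex \<Rightarrow> complex) \<Rightarrow> nat" where
  "polar_order F = (LEAST m. extends_with_order m F)"

definition gamma_factor ::
  "real \<Rightarrow> nat \<Rightarrow> (nat \<Rightarrow> real) \<Rightarrow> (nat \<Rightarrow> complex) \<Rightarrow> complex \<Rightarrow> complex" where
  "gamma_factor Q r \<Lambda> \<mu> s =
     of_real Q powr s * (\<Prod>j=1..r. Gamma (of_real (\<Lambda> j) * s + \<mu> j))"

text \<open>
  \<open>Gamma\<close> is 0 at its poles, so the product formula alone gives wrong values at the points where
  a pole is cancelled by a zero of another factor. \<open>remove_sings\<close> turns it into the intended
  meromorphic function (an entire one, as soon as the functional equation holds).
\<close>
definition completed ::
  "(complex \<Rightarrow> complex) \<Rightarrow> real \<Rightarrow> nat \<Rightarrow> (nat \<Rightarrow> real) \<Rightarrow> (nat \<Rightarrow> complex) \<Rightarrow> complex \<Rightarrow> complex" where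
  "completed F Q r \<Lambda> \<mu> =
     remove_sings (\<lambda>s. s ^ polar_order F * (s - 1) ^ polar_order F * gamma_factor Q r \<Lambda> \<mu> s * F s)"

definition has_functional_equation ::
  "(complex \<Rightarrow> complex) \<Rightarrow> real \<Rightarrow> nat \<Rightarrow> (nat \<Rightarrow> real) \<Rightarrow> (nat \<Rightarrow> complex) \<Rightarrow> complex \<Rightarrow> bool" where
  "has_functional_equation F Q r \<Lambda> \<mu> \<omega> \<longleftrightarrow>
     Q > 0 \<and> (\<forall>j\<in>{1..r}. \<Lambda> j > 0 \<and> Re (\<mu> j) \<ge> 0) \<and> norm \<omega> = 1 \<and>
     (\<forall>s. completed F Q r \<Lambda> \<mu> s = \<omega> * cnj (completed F Q r \<Lambda> \<mu> (1 - cnj s)))"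

definition extended_selberg_class :: "(complex \<Rightarrow> complex) set" where
  "extended_selberg_class =
     {F. has_dirichlet_series F \<and> (\<exists>m. extends_with_order m F) \<and>
         (\<exists>Q r \<Lambda> \<mu> \<omega>. has_functional_equation F Q r \<Lambda> \<mu> \<omega>)}"

definition functional_equation_factor ::
  "real \<Rightarrow> nat \<Rightarrow> (nat \<Rightarrow> real) \<Rightarrow> (nat \<Rightarrow> complex) \<Rightarrow> complex \<Rightarrow> complex \<Rightarrow> complex" where
  "functional_equation_factor Q r \<Lambda> \<mu> \<omega> s =
     \<omega> * cnj (gamma_factor Q r \<Lambda> \<mu> (1 - cnj s)) / gamma_factor Q r \<Lambda> \<mu> s"

definition smooth_real :: "(real \<Rightarrow> real) \<Rightarrow> bool" where
  "smooth_real f \<longleftrightarrow> (\<forall>n. (deriv ^^ n) f differentiable_on UNIV)"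

definition is_theta_function ::
  "real \<Rightarrow> nat \<Rightarrow> (nat \<Rightarrow> real) \<Rightarrow> (nat \<Rightarrow> complex) \<Rightarrow> complex \<Rightarrow> (real \<Rightarrow> real) \<Rightarrow> bool" where
  "is_theta_function Q r \<Lambda> \<mu> \<omega> \<theta> \<longleftrightarrow>
     smooth_real \<theta> \<and>
     (\<forall>t. functional_equation_factor Q r \<Lambda> \<mu> \<omega> (Complex (1/2) t) =
          exp (- 2 * \<i> * of_real (\<theta> t)))"

text \<open>
  The number under \<open>Re\<close> is real, see \<open>of_real_hardy_Z\<close> below; \<open>Re\<close> only makes the type real.
\<close>
definition hardy_Z :: "(complex \<Rightarrow> complex) \<Rightarrow> (real \<Rightarrow> real) \<Rightarrow> real \<Rightarrow> real" where
  "hardy_Z F \<theta> t = Re (exp (\<i> * of_real (\<theta> t)) * F (Complex (1/2) t))"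

definition riemann_hypothesis ::
  "(complex \<Rightarrow> complex) \<Rightarrow> real \<Rightarrow> nat \<Rightarrow> (nat \<Rightarrow> real) \<Rightarrow> (nat \<Rightarrow> complex) \<Rightarrow> bool" where
  "riemann_hypothesis F Q r \<Lambda> \<mu> \<longleftrightarrow> (\<forall>s. completed F Q r \<Lambda> \<mu> s = 0 \<longrightarrow> Re s = 1/2)"

definition consecutive_zeros :: "(real \<Rightarrow> real) \<Rightarrow> real \<Rightarrow> real \<Rightarrow> bool" where
  "consecutive_zeros f x y \<longleftrightarrow> x < y \<and> f x = 0 \<and> f y = 0 \<and> (\<forall>t. x < t \<and> t < y \<longrightarrow> f t \<noteq> 0)"

lemma completed_critical_line:
  assumes "has_functional_equation F Q r \<Lambda> \<mu> \<omega>" "\<exists>m. extends_with_order m F" "Re s = 1/2"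
  shows "completed F Q r \<Lambda> \<mu> s =
     s ^ polar_order F * (s - 1) ^ polar_order F * gamma_factor Q r \<Lambda> \<mu> s * F s"
proof -
  obtain m G where G: "G holomorphic_on UNIV" and eq: "\<And>s. s \<noteq> 1 \<Longrightarrow> G s = (s - 1) ^ m * F s"
    using assms(2) unfolding extends_with_order_def entire_of_finite_order_def by blast
  have s1: "s \<noteq> 1"
    using assms(3) by auto
  have "(\<lambda>z. G z / (z - 1) ^ m) holomorphic_on (- {1})"
    using holomorphic_on_subset[OF G] by (intro holomorphic_intros) auto
  then have "F holomorphic_on (- {1})"
    by (rule holomorphic_transform) (simp add: eq)
  then have [analytic_intros]: "F analytic_on {s}"
    using s1 by (meson ComplI analytic_at open_Compl closed_singleton singletonD)
  have np: "of_real (\<Lambda> j) * s + \<mu> j \<notin> \<int>\<^sub>\<le>\<^sub>0" if "j \<in> {1..r}" for j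
  proof -
    have "Re (of_real (\<Lambda> j) * s + \<mu> j) > 0"
      using assms(1,3) that unfolding has_functional_equation_def
      by (auto intro!: add_pos_nonneg)
    then show ?thesis
      using complex_nonpos_Reals_iff nonpos_Ints_subset_nonpos_Reals by force
  qed
  have [analytic_intros]: "gamma_factor Q r \<Lambda> \<mu> analytic_on {s}"
    unfolding gamma_factor_def using assms(1) np
    by (auto intro!: analytic_intros simp: has_functional_equation_def complex_nonpos_Reals_iff)
  have "(\<lambda>s. s ^ polar_order F * (s - 1) ^ polar_order F * gamma_factor Q r \<Lambda> \<mu> s * F s)
          analytic_on {s}"
    by (intro analytic_intros)
  then show ?thesis
    unfolding completed_def by simp
qed

lemma of_real_hardy_Z:
  assumes "F \<in> extended_selberg_class" "has_functional_equation F Q r \<Lambda> \<mu> \<omega>"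
    and "is_theta_function Q r \<Lambda> \<mu> \<omega> \<theta>"
  shows "of_real (hardy_Z F \<theta> t) = exp (\<i> * of_real (\<theta> t)) * F (Complex (1/2) t)"
proof -
  define s where "s = Complex (1/2) t"
  define p where "p = s ^ polar_order F * (s - 1) ^ polar_order F"
  define g where "g = gamma_factor Q r \<Lambda> \<mu> s"
  have s: "1 - cnj s = s" "Re s = 1/2" "s \<noteq> 0" "s \<noteq> 1"
    by (auto simp: s_def complex_eq_iff)
  have "s * (s - 1) = - (s * cnj s)"
    by (simp add: s_def complex_eq_iff)
  then have p: "cnj p = p" "p \<noteq> 0"
    using s by (simp_all add: p_def mult.commute flip: power_mult_distrib)
  have "completed F Q r \<Lambda> \<mu> s = p * g * F s"
    using completed_critical_line[OF assms(2) _ s(2)] assms(1)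
    by (simp add: p_def g_def extended_selberg_class_def)
  moreover have "completed F Q r \<Lambda> \<mu> s = \<omega> * cnj (completed F Q r \<Lambda> \<mu> s)"
    using assms(2) s(1) unfolding has_functional_equation_def by metis
  ultimately have "p * (g * F s) = p * (\<omega> * cnj g * cnj (F s))"
    using p(1) by (simp add: mult_ac)
  then have fe: "g * F s = \<omega> * cnj g * cnj (F s)"
    using p(2) by simp
  have H: "\<omega> * cnj g / g = exp (- 2 * \<i> * of_real (\<theta> t))"
    using assms(3) s(1)
    unfolding is_theta_function_def functional_equation_factor_def g_def s_def by metis
  then have "g \<noteq> 0"
    by auto
  then have "F s = exp (- 2 * \<i> * of_real (\<theta> t)) * cnj (F s)"
    using fe unfolding H[symmetric] by (simp add: field_simps)
  then have "exp (\<i> * of_real (\<theta> t)) * F s =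
      (exp (\<i> * of_real (\<theta> t)) * exp (- 2 * \<i> * of_real (\<theta> t))) * cnj (F s)"
    by (metis mult.assoc)
  also have "\<dots> = cnj (exp (\<i> * of_real (\<theta> t)) * F s)"
    by (simp add: exp_cnj flip: exp_add)
  finally show ?thesis
    unfolding hardy_Z_def s_def[symmetric] by (metis Reals_cnj_iff of_real_Re)
qed

end

theory Submission
  imports Defs
begin

text \<open>
  In the variable \<open>z\<close> with \<open>s = 1/2 + \<i> * z\<close>, the function \<open>Z\<close> extends holomorphically to a right half
  plane as \<open>f z = exp (\<i> * \<Theta> z) * F s\<close>; let \<open>f\<^sub>k\<close> be its derivatives and \<open>M\<^sub>k = f\<^sub>k\<^sub>+\<^sub>1 / f\<^sub>k\<close>. The claim
  follows once \<open>M\<^sub>k\<close> is strictly decreasing on the real axis far out, between its poles, and this holds as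
  soon as \<open>Im (M\<^sub>k z) \<le> - \<epsilon> * Im z\<close> for \<open>0 < Im z \<le> C\<close> and large \<open>Re z\<close>. That inequality also shows that
  \<open>f\<^sub>k\<^sub>+\<^sub>1 = M\<^sub>k * f\<^sub>k\<close> has no non-real zeros there, so that an induction on \<open>k\<close> starting from RH is possible.

  High up in the strip, where \<open>F\<close> is close to 1, one has \<open>M\<^sub>k = - \<i> * cnj (\<Theta>' (cnj z)) + small\<close>, hence
  \<open>Im M\<^sub>k\<close> is negative, since \<open>Re \<Theta>'\<close> is bounded below by a positive constant. On the real axis \<open>f\<^sub>k\<close> is real,
  so \<open>f\<^sub>k (z - \<i> * \<eta>) / f\<^sub>k (z + \<i> * \<eta>)\<close> is unimodular there. As \<open>f\<^sub>k\<close> has only real zeros,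
  this quotient is holomorphic above the axis, a Phragmen-Lindeloef argument in the half strip bounds it, and
  \<open>\<eta> \<rightarrow> 0\<close> gives the inequality.

  The lower bound on \<open>Re \<Theta>'\<close> fails only if there are no gamma factors and \<open>Q \<le> 1\<close>; then \<open>F\<close> is
  constant, and so is \<open>Z\<close>.
\<close>

subsection \<open>Growth and logarithmic derivatives\<close>

text \<open>No maximum principle applies to \<open>M\<^sub>k\<close> itself: it has poles at the
  real zeros, whose spacing is unknown. The shifted quotient avoids this: on the real axis its
  modulus is 1 wherever the zeros lie, and the logarithm of its modulus, divided by
  \<open>\<eta>\<close>, tends to 2 Im \<open>M\<^sub>k\<close>. Only a half strip is under control,
  so no global factorisation of \<open>f\<^sub>k\<close> is at hand and the left edge enters as an
  error. All bounds must be linear in Im z near the axis: Im \<open>M\<^sub>k\<close> vanishes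
  there, and the slope of this decay is what finally bounds the real derivative of
  \<open>M\<^sub>k\<close>. Phragmen-Lindeloef also asks for an a priori bound of the quotient,
  hence for a lower bound of |\<open>f\<^sub>k\<close>| off the axis; Harnack's inequality carries
  one down from the edge where the logarithmic derivative is known. The Dirichlet series governs
  only Im z far below 0; reality of \<open>f\<^sub>k\<close> on the axis, which encodes the
  functional equation, reflects this to the upper edge. With gamma factors present it suffices that
  the second derivative of \<open>\<Theta>\<close> is bounded in strips and that the real part of
  the first tends to infinity on the axis; elementary series estimates give both.\<close>

lemma phragmen_lindelof_half_strip:
  fixes h :: "complex \<Rightarrow> complex" and T C B :: real and g :: "real \<Rightarrow> real"
  assumes "C > 0" "B > 0"
    and hol: "h holomorphic_on U" and SU: "{z. T \<le> Re z \<and> 0 \<le> Im z \<and> Im z \<le> C} \<subseteq> U"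
    and bottom: "\<And>x. T \<le> x \<Longrightarrow> norm (h (Complex x 0)) \<le> B"
    and top: "\<And>x. T \<le> x \<Longrightarrow> norm (h (Complex x C)) \<le> B"
    and left: "\<And>y. 0 \<le> y \<Longrightarrow> y \<le> C \<Longrightarrow> norm (h (Complex T y)) \<le> B"
    and growth: "\<And>z. T \<le> Re z \<Longrightarrow> 0 \<le> Im z \<Longrightarrow> Im z \<le> C \<Longrightarrow> norm (h z) \<le> exp (g (Re z))"
    and g: "((\<lambda>x. g x / exp (x / C)) \<longlongrightarrow> 0) at_top"
    and z: "T \<le> Re z" "0 \<le> Im z" "Im z \<le> C"
  shows "norm (h z) \<le> B"
proof -
  \<comment> \<open>On the strip the exponent has imaginary part in [-1/2, 1/2], so Re
    \<open>E\<close> is at least cos(1/2) exp(Re w / C) up to the edges. Dividing by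
    \<open>C\<close> instead of \<open>C\<close> / pi gives up the sharp growth exponent, which is
    harmless for growth exp(polynomial), and buys this uniform positive constant.\<close>
  define E where "E = (\<lambda>w. exp ((w - \<i> * of_real (C/2)) / of_real C))"
  define c :: real where "c = cos (1/2)"
  have c: "c > 0"
    unfolding c_def using pi_gt3 by (intro cos_gt_zero_pi) auto
  have ReE: "Re (E w) = exp (Re w / C) * cos ((Im w - C/2) / C)" for w
    unfolding E_def by (simp add: Re_exp)
  have ReE_ge: "Re (E w) \<ge> exp (Re w / C) * c" if "0 \<le> Im w" "Im w \<le> C" for w
  proof -
    have "\<bar>(Im w - C/2) / C\<bar> \<le> 1/2"
      using that \<open>C > 0\<close> by (auto simp: abs_le_iff field_simps)
    then have "cos \<bar>(Im w - C/2) / C\<bar> \<ge> cos (1/2)"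
      using pi_gt3 by (intro cos_monotone_0_pi_le) auto
    then show ?thesis
      unfolding ReE c_def cos_abs_real by simp
  qed
  have main: "norm (h z) * exp (- \<epsilon> * Re (E z)) \<le> B" if "\<epsilon> > 0" for \<epsilon>
  proof -
    define k where "k = (\<lambda>w. h w * exp (- of_real \<epsilon> * E w))"
    have normk: "norm (k w) = norm (h w) * exp (- \<epsilon> * Re (E w))" for w
      by (simp add: k_def norm_mult)
    have small: "norm (k w) \<le> norm (h w)" if "0 \<le> Im w" "Im w \<le> C" for w
    proof -
      have "Re (E w) \<ge> 0"
        using ReE_ge[OF that] c by (smt (verit) exp_ge_zero mult_nonneg_nonneg)
      then have "exp (- \<epsilon> * Re (E w)) \<le> 1"
        using \<open>\<epsilon> > 0\<close> by auto
      then show ?thesis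
        unfolding normk by (simp add: mult_left_le)
    qed
    have "\<forall>\<^sub>F x in at_top. \<bar>g x / exp (x / C)\<bar> < \<epsilon> * c / 2"
      using tendstoD[OF g, of "\<epsilon> * c / 2"] \<open>\<epsilon> > 0\<close> c by simp
    moreover have "filterlim (\<lambda>x. \<epsilon> * c / 2 * exp (x / C)) at_top at_top"
      using \<open>\<epsilon> > 0\<close> c \<open>C > 0\<close> by real_asymp
    then have "\<forall>\<^sub>F x in at_top. \<epsilon> * c / 2 * exp (x / C) \<ge> - ln B"
      by (rule filterlim_at_top[THEN iffD1, rule_format])
    ultimately have "\<forall>\<^sub>F x in at_top. exp (g x) * exp (- \<epsilon> * (exp (x / C) * c)) \<le> B"
    proof eventually_elim
      case (elim x)
      have "g x \<le> \<epsilon> * c / 2 * exp (x / C)"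
        using elim(1) by (simp add: abs_less_iff field_simps)
      then have "g x + (- \<epsilon> * (exp (x / C) * c)) \<le> ln B"
        using elim(2) by (simp add: algebra_simps)
      then show ?case
        unfolding exp_add[symmetric] by (metis \<open>B > 0\<close> exp_le_cancel_iff exp_ln)
    qed
    \<comment> \<open>The right edge depends on \<open>\<epsilon>\<close> and is placed beyond
      \<open>z\<close>, so that the rectangle contains \<open>z\<close>.\<close>
    then obtain X where X: "X \<ge> Re z" "exp (g X) * exp (- \<epsilon> * (exp (X / C) * c)) \<le> B"
      by (metis (mono_tags, lifting) eventually_at_top_linorder linorder_linear order_trans)
    define R where "R = cbox (Complex T 0) (Complex X C)"
    have RS: "R \<subseteq> {z. T \<le> Re z \<and> 0 \<le> Im z \<and> Im z \<le> C}"
      by (auto simp: R_def in_cbox_complex_iff)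
    have hk: "k holomorphic_on R"
      unfolding k_def E_def using RS SU hol \<open>C > 0\<close>
      by (intro holomorphic_intros holomorphic_on_subset[OF hol]) auto
    have "norm (k z) \<le> B"
    proof (rule maximum_modulus_frontier[where f = k and S = R])
      show "k holomorphic_on interior R"
        using hk holomorphic_on_subset interior_subset by blast
      show "continuous_on (closure R) k"
        using hk unfolding R_def by (simp add: holomorphic_on_imp_continuous_on)
      show "bounded R"
        by (simp add: R_def)
      show "z \<in> R"
        using z X by (auto simp: R_def in_cbox_complex_iff)
      fix w assume "w \<in> frontier R"
      then have w: "T \<le> Re w" "Re w \<le> X" "0 \<le> Im w" "Im w \<le> C"
        and *: "Re w = T \<or> Re w = X \<or> Im w = 0 \<or> Im w = C"
        by (auto simp: R_def frontier_cbox in_cbox_complex_iff in_box_complex_iff)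
      have eq: "w = Complex (Re w) (Im w)" by simp
      show "norm (k w) \<le> B"
      proof (cases "Re w = X")
        case True
        have "norm (k w) \<le> exp (g X) * exp (- \<epsilon> * (exp (X / C) * c))"
          unfolding normk using growth[of w] w True ReE_ge[of w] \<open>\<epsilon> > 0\<close>
          by (intro mult_mono) auto
        then show ?thesis
          using X by simp
      next
        case False
        then have "norm (h w) \<le> B"
          using * left[of "Im w"] bottom[of "Re w"] top[of "Re w"] w eq by metis
        then show ?thesis
          using small[of w] w by simp
      qed
    qed
    then show ?thesis
      by (simp add: normk)
  qed
  have "((\<lambda>\<epsilon>. norm (h z) * exp (- \<epsilon> * Re (E z))) \<longlongrightarrow> norm (h z) * exp (- 0 * Re (E z))) (at_right 0)"
    by (intro tendsto_intros)
  moreover have "\<forall>\<^sub>F \<epsilon> in at_right 0. norm (h z) * exp (- \<epsilon> * Re (E z)) \<le> B"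
    using main by (simp add: eventually_at_right_less eventually_at_filter)
  ultimately have "norm (h z) * exp (- 0 * Re (E z)) \<le> B"
    by (intro tendsto_upperbound) (auto simp: trivial_limit_at_right_real)
  then show ?thesis by simp
qed

text \<open>Borel-Caratheodory for a logarithm of \<open>f\<close>: apply the Schwarz lemma after a Cayley transform.\<close>
lemma norm_logderiv_le:
  fixes f :: "complex \<Rightarrow> complex"
  assumes "r > 0" and hol: "f holomorphic_on ball z r"
    and nz: "\<And>w. w \<in> ball z r \<Longrightarrow> f w \<noteq> 0"
    and bd: "\<And>w. w \<in> ball z r \<Longrightarrow> norm (f w) \<le> exp A"
  shows "norm (deriv f z / f z) \<le> 2 * (A + 1 - ln (norm (f z))) / r"
proof -
  obtain g where hg: "g holomorphic_on ball z r" and g: "\<And>w. w \<in> ball z r \<Longrightarrow> f w = exp (g w)"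
    using contractible_imp_holomorphic_log[OF hol convex_imp_contractible[OF convex_ball] nz]
    by metis
  \<comment> \<open>The summand 1 keeps Re \<open>p\<close> >= 1 even where |f| reaches exp A, so
    the denominator of the Cayley transform \<open>q\<close> never vanishes.\<close>
  define p where "p = (\<lambda>w. of_real (A + 1) - g w)"
  have hp: "p holomorphic_on ball z r"
    unfolding p_def by (intro holomorphic_intros hg)
  have Rep: "Re (p w) \<ge> 1" if "w \<in> ball z r" for w
    using bd[OF that] g[OF that] by (simp add: p_def)
  define q where "q = (\<lambda>u. (p (z + of_real r * u) - p z) / (p (z + of_real r * u) + cnj (p z)))"
  have zb: "z \<in> ball z r" using \<open>r > 0\<close> by simp
  have inb: "z + of_real r * u \<in> ball z r" if "norm u < 1" for u
    using that \<open>r > 0\<close> by (simp add: dist_norm norm_mult)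
  have den: "p w + cnj (p z) \<noteq> 0" if "w \<in> ball z r" for w
    using Rep[OF that] Rep[OF zb] by (auto simp: complex_eq_iff)
  have hcomp: "(\<lambda>u. p (z + of_real r * u)) holomorphic_on ball 0 1"
    by (rule holomorphic_on_compose_gen[OF _ hp, unfolded o_def])
       (use inb in \<open>auto intro!: holomorphic_intros\<close>)
  have hq: "q holomorphic_on ball 0 1"
    unfolding q_def using inb den hcomp by (intro holomorphic_intros hcomp) auto
  have q1: "norm (q u) < 1" if "norm u < 1" for u
  proof -
    define a b where "a = p (z + of_real r * u)" and "b = p z"
    have ab: "Re a \<ge> 1" "Re b \<ge> 1"
      using Rep[OF inb[OF that]] Rep[OF zb] by (simp_all add: a_def b_def)
    have "(norm (a + cnj b))\<^sup>2 - (norm (a - b))\<^sup>2 = 4 * Re a * Re b"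
      unfolding cmod_power2 by (simp add: power2_eq_square algebra_simps)
    moreover have "4 * Re a * Re b > 0"
      using ab by simp
    ultimately have "(norm (a - b))\<^sup>2 < (norm (a + cnj b))\<^sup>2"
      by linarith
    then have "norm (a - b) < norm (a + cnj b)"
      using power2_less_imp_less norm_ge_zero by blast
    then show ?thesis
      unfolding q_def a_def[symmetric] b_def[symmetric]
      by (simp add: norm_divide divide_less_eq_1)
  qed
  have dq: "norm (deriv q 0) \<le> 1"
    by (rule Schwarz_Lemma(2)[OF hq, of 0]) (use q1 in \<open>auto simp: q_def\<close>)
  have dg: "(g has_field_derivative deriv g z) (at z)"
    using hg zb by (meson holomorphic_derivI open_ball)
  have "((\<lambda>u. p (z + of_real r * u)) has_field_derivative - (deriv g z * of_real r)) (at 0)"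
  proof -
    have "((\<lambda>u. z + of_real r * u) has_field_derivative of_real r) (at 0)"
      by (auto intro!: derivative_eq_intros)
    from DERIV_chain2[OF _ this, of g "deriv g z"] dg
    have "((\<lambda>u. g (z + of_real r * u)) has_field_derivative deriv g z * of_real r) (at 0)"
      by simp
    then show ?thesis
      unfolding p_def by (auto intro!: derivative_eq_intros)
  qed
  then have "((\<lambda>u. p (z + of_real r * u) - p z) has_field_derivative - (deriv g z * of_real r)) (at 0)"
    and "((\<lambda>u. p (z + of_real r * u) + cnj (p z)) has_field_derivative - (deriv g z * of_real r)) (at 0)"
    by (auto intro!: derivative_eq_intros)
  from DERIV_divide[OF this]
  have "(q has_field_derivative - (deriv g z * of_real r) / (p z + cnj (p z))) (at 0)"
    using den[OF zb] by (simp add: q_def)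
  then have "deriv q 0 = - (deriv g z * of_real r) / of_real (2 * Re (p z))"
    using DERIV_imp_deriv complex_add_cnj by metis
  then have "norm (deriv g z) * r / (2 * Re (p z)) \<le> 1"
    using dq \<open>r > 0\<close> Rep[OF zb] by (simp add: norm_divide norm_mult)
  then have bound: "norm (deriv g z) \<le> 2 * Re (p z) / r"
    using \<open>r > 0\<close> Rep[OF zb] by (simp add: field_simps)
  have "(f has_field_derivative exp (g z) * deriv g z) (at z)"
  proof (rule has_field_derivative_transform_within_open[OF _ open_ball zb])
    show "((\<lambda>w. exp (g w)) has_field_derivative exp (g z) * deriv g z) (at z)"
      using dg by (auto intro!: derivative_eq_intros)
  qed (simp add: g)
  then have "deriv f z / f z = deriv g z"
    using g[OF zb] by (simp add: DERIV_imp_deriv)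
  moreover have "Re (p z) = A + 1 - ln (norm (f z))"
    using g[OF zb] by (simp add: p_def)
  ultimately show ?thesis
    using bound by simp
qed

section \<open>Reflection in the real axis and derivatives of ln |f| along lines\<close>

lemma of_real_ray_islimpt: "complex_of_real (T + 1) islimpt of_real ` {T<..}"
  unfolding islimpt_approachable
proof (intro allI impI)
  fix e :: real assume "e > 0"
  then show "\<exists>x'\<in>of_real ` {T<..}. x' \<noteq> complex_of_real (T + 1) \<and> dist x' (of_real (T + 1)) < e"
    by (intro bexI[of _ "of_real (T + 1 + e/2)"])
      (auto simp: dist_norm simp del: of_real_add simp flip: of_real_diff)
qed

text \<open>Schwarz reflection by the identity theorem: \<open>f\<close> and its conjugate by
  \<open>cnj\<close> are holomorphic and agree on a real ray.\<close>

lemma cnj_symmetric: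
  assumes hol: "f holomorphic_on {z. Re z > T}"
    and real: "\<And>x. x > T \<Longrightarrow> f (of_real x) \<in> \<real>" and z: "Re z > T"
  shows "f (cnj z) = cnj (f z)"
proof -
  let ?S = "{z. Re z > T}"
  have S: "open ?S" "connected ?S"
    by (auto simp: open_halfspace_Re_gt convex_halfspace_Re_gt intro: convex_connected)
  have "(cnj \<circ> f \<circ> cnj) holomorphic_on ?S"
  proof (rule holomorphic_on_compose_cnj_cnj)
    have "cnj ` ?S = ?S"
      by (auto simp: image_iff) (metis complex_cnj_cnj complex_cnj(1) complex_surj cnj.simps(1))
    then show "f holomorphic_on cnj ` ?S" using hol by simp
  qed (rule S)
  then have h: "(\<lambda>z. cnj (f (cnj z)) - f z) holomorphic_on ?S"
    by (intro holomorphic_intros hol) (simp add: o_def)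
  have "cnj (f (cnj z)) - f z = 0"
  proof (rule analytic_continuation[OF h S _ _ of_real_ray_islimpt])
    fix w :: complex assume "w \<in> of_real ` {T<..}"
    then show "cnj (f (cnj w)) - f w = 0"
      using real by (auto simp: Reals_cnj_iff)
  qed (use z in auto)
  then show ?thesis
    by (metis complex_cnj_cnj eq_iff_diff_eq_0)
qed

lemma has_real_derivative_ln_norm:
  assumes "(F has_vector_derivative D) (at t)" "F t \<noteq> 0"
  shows "((\<lambda>t. ln (norm (F t))) has_real_derivative Re (D / F t)) (at t)"
proof -
  define u v where "u = (\<lambda>t. Re (F t))" and "v = (\<lambda>t. Im (F t))"
  have re: "(u has_real_derivative Re D) (at t)" and im: "(v has_real_derivative Im D) (at t)"
    using assms(1) by (auto simp: u_def v_def has_vector_derivative_complex_iff)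
  have pos: "(u t)\<^sup>2 + (v t)\<^sup>2 > 0"
    using assms(2) unfolding u_def v_def by (metis cmod_power2 norm_eq_zero zero_less_power2)
  have eq: "ln (norm (F t)) = ln ((u t)\<^sup>2 + (v t)\<^sup>2) / 2" for t
    unfolding cmod_def u_def v_def by (simp add: ln_sqrt)
  have "((\<lambda>t. ln ((u t)\<^sup>2 + (v t)\<^sup>2) / 2) has_real_derivative
          (u t * Re D + v t * Im D) / ((u t)\<^sup>2 + (v t)\<^sup>2)) (at t)"
  proof (rule DERIV_cong)
    show "((\<lambda>t. ln ((u t)\<^sup>2 + (v t)\<^sup>2) / 2) has_real_derivative
       (1 / ((u t)\<^sup>2 + (v t)\<^sup>2) * (2 * (Re D * u t) + 2 * (Im D * v t))) / 2) (at t)"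
      using pos by (intro DERIV_cdivide DERIV_ln_divide[THEN DERIV_chain2] DERIV_add)
        (auto intro!: derivative_eq_intros re im)
  qed (use pos in \<open>simp add: divide_simps; simp add: algebra_simps\<close>)
  then show ?thesis
    unfolding eq Re_divide by (simp add: mult.commute add_divide_distrib u_def v_def)
qed

text \<open>A vertical step multiplies the logarithmic derivative by i, and Re (i M) = - Im M. This
  translates bounds on Im (f'/f) into monotonicity of |f| on vertical segments, and back.\<close>

lemma ln_norm_vertical:
  assumes "f holomorphic_on S" "open S" "Complex x w \<in> S" "f (Complex x w) \<noteq> 0"
  shows "((\<lambda>w. ln (norm (f (Complex x w)))) has_real_derivative
           - Im (deriv f (Complex x w) / f (Complex x w))) (at w)"
proof -
  have d: "(f has_field_derivative deriv f (Complex x w)) (at (Complex x w))"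
    using assms holomorphic_derivI by blast
  have "(Complex x has_vector_derivative \<i>) (at w)"
    unfolding Complex_eq by (auto intro!: derivative_eq_intros)
  from field_vector_diff_chain_at[OF this d]
  have "((\<lambda>w. f (Complex x w)) has_vector_derivative \<i> * deriv f (Complex x w)) (at w)"
    by (simp add: o_def)
  from has_real_derivative_ln_norm[OF this assms(4)] show ?thesis
    unfolding times_divide_eq_right[symmetric] Re_i_times .
qed

lemma ln_norm_horizontal:
  assumes "f holomorphic_on S" "open S" "Complex x y \<in> S" "f (Complex x y) \<noteq> 0"
  shows "((\<lambda>x. ln (norm (f (Complex x y)))) has_real_derivative
           Re (deriv f (Complex x y) / f (Complex x y))) (at x)"
proof -
  have d: "(f has_field_derivative deriv f (Complex x y)) (at (Complex x y))"
    using assms holomorphic_derivI by blast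
  have "((\<lambda>x. Complex x y) has_vector_derivative 1) (at x)"
    unfolding Complex_eq by (auto intro!: derivative_eq_intros)
  from field_vector_diff_chain_at[OF this d]
  have "((\<lambda>x. f (Complex x y)) has_vector_derivative deriv f (Complex x y)) (at x)"
    by (simp add: o_def)
  from has_real_derivative_ln_norm[OF this assms(4)] show ?thesis
    by simp
qed

text \<open>Verifies the growth hypothesis of \<open>phragmen_lindelof_half_strip\<close> for
  polynomial exponents.\<close>

lemma power_over_exp_tendsto_0:
  assumes "C > 0"
  shows "((\<lambda>x. K * (x + 1) ^ N / exp (x / C)) \<longlongrightarrow> (0::real)) at_top"
proof -
  have "filterlim (\<lambda>x. (x + 1) / C) at_top at_top"
    using assms by real_asymp
  from filterlim_compose[OF tendsto_power_div_exp_0 this]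
  have "((\<lambda>x. K * C ^ N * exp (1 / C) * (((x + 1) / C) ^ N / exp ((x + 1) / C))) \<longlongrightarrow>
          K * C ^ N * exp (1 / C) * 0) at_top"
    by (intro tendsto_intros)
  moreover have "K * C ^ N * exp (1 / C) * (((x + 1) / C) ^ N / exp ((x + 1) / C))
      = K * (x + 1) ^ N / exp (x / C)" for x
  proof -
    have "C ^ N * ((x + 1) / C) ^ N = (x + 1) ^ N"
      using assms by (simp flip: power_mult_distrib)
    then show ?thesis
      by (simp add: add_divide_distrib[of x 1 C] exp_add mult_ac)
  qed
  ultimately show ?thesis by simp
qed

text \<open>Harnack's inequality for the positive harmonic function \<open>A + 1 - ln (norm f)\<close>, in
  integrated form along a vertical segment.\<close>
lemma ln_norm_lower_bound_vertical:
  assumes hol: "f holomorphic_on S" "open S" and "r > 0" "a \<le> b"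
    and sub: "\<And>w. a \<le> w \<Longrightarrow> w \<le> b \<Longrightarrow> ball (Complex x w) r \<subseteq> S"
    and nz: "\<And>w z. a \<le> w \<Longrightarrow> w \<le> b \<Longrightarrow> z \<in> ball (Complex x w) r \<Longrightarrow> f z \<noteq> 0"
    and bd: "\<And>w z. a \<le> w \<Longrightarrow> w \<le> b \<Longrightarrow> z \<in> ball (Complex x w) r \<Longrightarrow> norm (f z) \<le> exp A"
  shows "A + 1 - ln (norm (f (Complex x a))) \<le>
           exp (2 * (b - a) / r) * (A + 1 - ln (norm (f (Complex x b))))"
proof -
  define \<phi> where "\<phi> = (\<lambda>w. A + 1 - ln (norm (f (Complex x w))))"
  define M where "M = (\<lambda>w. deriv f (Complex x w) / f (Complex x w))"
  \<comment> \<open>Integrating factor: the inequality \<open>\<phi>\<close>' = Im \<open>M\<close>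
    >= - 2 \<open>\<phi>\<close> / r says that \<open>\<phi> w * exp (2 * w / r)\<close> does not
    decrease.\<close>
  have "\<phi> a * exp (2 * a / r) \<le> \<phi> b * exp (2 * b / r)"
  proof (rule DERIV_nonneg_imp_nondecreasing[OF \<open>a \<le> b\<close>])
    fix w assume w: "a \<le> w" "w \<le> b"
    have in_ball: "Complex x w \<in> ball (Complex x w) r"
      using \<open>r > 0\<close> by simp
    have d: "(\<phi> has_real_derivative Im (M w)) (at w)"
      unfolding \<phi>_def M_def
      using DERIV_diff[OF DERIV_const ln_norm_vertical[OF hol, of x w]] sub[OF w] nz[OF w in_ball] in_ball
      by (simp add: subset_iff)
    have "\<bar>Im (M w)\<bar> \<le> norm (M w)"
      by (rule abs_Im_le_cmod)
    also have "\<dots> \<le> 2 * \<phi> w / r"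
      unfolding M_def \<phi>_def using \<open>r > 0\<close> sub[OF w] nz[OF w] bd[OF w] hol
      by (intro norm_logderiv_le) (auto intro: holomorphic_on_subset)
    finally have "Im (M w) + 2 * \<phi> w / r \<ge> 0"
      by linarith
    then have "(Im (M w) + 2 * \<phi> w / r) * exp (2 * w / r) \<ge> 0"
      by simp
    moreover have "((\<lambda>w. \<phi> w * exp (2 * w / r)) has_real_derivative
        (Im (M w) + 2 * \<phi> w / r) * exp (2 * w / r)) (at w)"
      using \<open>r > 0\<close> by (auto intro!: derivative_eq_intros d simp: algebra_simps)
    ultimately show "\<exists>y. ((\<lambda>w. \<phi> w * exp (2 * w / r)) has_real_derivative y) (at w) \<and> 0 \<le> y"
      by blast
  qed
  then have "\<phi> a \<le> \<phi> b * exp (2 * b / r) / exp (2 * a / r)"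
    by (simp add: pos_le_divide_eq)
  also have "\<dots> = exp (2 * (b - a) / r) * \<phi> b"
    by (simp add: right_diff_distrib diff_divide_distrib exp_diff)
  finally show ?thesis
    by (simp add: \<phi>_def)
qed

text \<open>Serves to place the left edge of a half strip where its real point is not a zero of
  \<open>f\<close>; otherwise the zeros would fill a ray and \<open>f\<close> would vanish
  identically.\<close>

lemma real_zero_free_point:
  assumes hol: "f holomorphic_on {z. Re z > T}" and nz: "Re a > T" "f a \<noteq> 0"
  shows "\<exists>t>b. t > T \<and> f (of_real t) \<noteq> (0::complex)"
proof (rule ccontr)
  assume "\<not> ?thesis"
  then have zero: "f (of_real t) = 0" if "t > max b T" for t
    using that by auto
  define c where "c = max b T"
  have "f a = 0"
  proof (rule analytic_continuation[OF hol _ _ _ _ of_real_ray_islimpt[of c]])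
    show "open {z. Re z > T}" "connected {z. Re z > T}"
      by (auto simp: open_halfspace_Re_gt convex_halfspace_Re_gt intro: convex_connected)
  qed (use nz zero in \<open>auto simp: c_def\<close>)
  with nz show False by simp
qed

lemma deriv_real_on_reals:
  assumes hol: "f holomorphic_on {z. Re z > T}"
    and real: "\<And>x. x > T \<Longrightarrow> f (of_real x) \<in> \<real>" and "x > T"
  shows "((\<lambda>t. Re (f (of_real t))) has_real_derivative Re (deriv f (of_real x))) (at x)"
    and "deriv f (of_real x) \<in> \<real>"
proof -
  have "(f has_field_derivative deriv f (of_real x)) (at (of_real x))"
    using holomorphic_derivI[OF hol open_halfspace_Re_gt] \<open>x > T\<close> by simp
  moreover have "(complex_of_real has_vector_derivative 1) (at x)"
    by (auto intro!: derivative_eq_intros)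
  ultimately have "((\<lambda>t. f (of_real t)) has_vector_derivative deriv f (of_real x)) (at x)"
    using field_vector_diff_chain_at[of complex_of_real 1 x f "deriv f (of_real x)"] by (simp add: o_def)
  then have re: "((\<lambda>t. Re (f (of_real t))) has_real_derivative Re (deriv f (of_real x))) (at x)"
    and im: "((\<lambda>t. Im (f (of_real t))) has_real_derivative Im (deriv f (of_real x))) (at x)"
    by (auto simp: has_vector_derivative_complex_iff)
  show "((\<lambda>t. Re (f (of_real t))) has_real_derivative Re (deriv f (of_real x))) (at x)"
    by (rule re)
  have "((\<lambda>t. Im (f (of_real t))) has_real_derivative 0) (at x)"
  proof (rule has_field_derivative_transform_within_open[OF DERIV_const])
    show "x \<in> {T<..}" using \<open>x > T\<close> by simp
    fix t assume "t \<in> {T<..}"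
    then show "0 = Im (f (of_real t))"
      using real by (simp add: complex_is_Real_iff)
  qed simp
  then show "deriv f (of_real x) \<in> \<real>"
    using DERIV_unique[OF im] by (simp add: complex_is_Real_iff)
qed

text \<open>Near a segment free of zeros f'/f is Lipschitz, and it is real at the foot of the
  segment. A bound linear in \<open>w\<close> is essential: a constant one could not be dominated by
  a correction that vanishes on the real axis.\<close>

lemma logderiv_real_segment:
  assumes hol: "f holomorphic_on {z. Re z > T0}" and real: "\<And>x. x > T0 \<Longrightarrow> f (of_real x) \<in> \<real>"
    and "T > T0" and nz: "\<And>w. 0 \<le> w \<Longrightarrow> w \<le> b \<Longrightarrow> f (Complex T w) \<noteq> 0"
  shows "\<exists>K\<ge>0. \<forall>w. 0 \<le> w \<and> w \<le> b \<longrightarrow>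
           \<bar>Im (deriv f (Complex T w) / f (Complex T w))\<bar> \<le> K * w"
proof (cases "b \<ge> 0")
  case True
  let ?S = "{z. Re z > T0}"
  define V where "V = {z \<in> ?S. f z \<noteq> 0}"
  define M where "M = (\<lambda>z. deriv f z / f z)"
  have "V = ?S \<inter> f -` (- {0})"
    by (auto simp: V_def)
  then have "open V"
    using continuous_open_preimage[OF holomorphic_on_imp_continuous_on[OF hol] open_halfspace_Re_gt, of "- {0}"]
    by auto
  have hM: "M holomorphic_on V"
    unfolding M_def V_def using hol
    by (intro holomorphic_intros holomorphic_on_subset[OF holomorphic_deriv[OF hol open_halfspace_Re_gt]]
        holomorphic_on_subset[OF hol]) auto
  define L where "L = closed_segment (Complex T 0) (Complex T b)"
  have Leq: "z \<in> L \<longleftrightarrow> Re z = T \<and> 0 \<le> Im z \<and> Im z \<le> b" for z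
    unfolding L_def using True
    by (subst closed_segment_same_Re) (auto simp: closed_segment_eq_real_ivl)
  have LV: "L \<subseteq> V"
    using nz \<open>T > T0\<close> by (auto simp: Leq V_def) (metis complex_surj)
  have "compact (deriv M ` L)"
    unfolding L_def using LV \<open>open V\<close> hM
    by (intro compact_continuous_image) (auto simp: L_def intro: holomorphic_on_imp_continuous_on
        holomorphic_on_subset[OF holomorphic_deriv])
  then obtain K where K: "\<And>z. z \<in> L \<Longrightarrow> norm (deriv M z) \<le> K"
    by (meson compact_imp_bounded bounded_iff imageI)
  show ?thesis
  proof (intro exI[of _ "\<bar>K\<bar>"] conjI allI impI)
    fix w assume w: "0 \<le> w \<and> w \<le> b"
    have 0: "Complex T 0 \<in> L" and 1: "Complex T w \<in> L"
      using w True by (auto simp: Leq)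
    have "norm (M (Complex T w) - M (Complex T 0)) \<le> K * norm (Complex T w - Complex T 0)"
    proof (rule field_differentiable_bound[of L M "deriv M"])
      show "convex L" by (simp add: L_def)
      show "(M has_field_derivative deriv M z) (at z within L)" if "z \<in> L" for z
        using hM \<open>open V\<close> LV that holomorphic_derivI by (meson has_field_derivative_at_within subsetD)
    qed (use K 0 1 in auto)
    also have "Complex T w - Complex T 0 = \<i> * of_real w"
      by (simp add: complex_eq_iff)
    finally have le: "norm (M (Complex T w) - M (Complex T 0)) \<le> K * w"
      using w by (simp add: norm_mult)
    have T: "Complex T 0 = of_real T"
      by (simp add: complex_eq_iff)
    have "deriv f (of_real T) \<in> \<real>"
      by (rule deriv_real_on_reals[OF hol real \<open>T > T0\<close>])
    then have "Im (M (Complex T 0)) = 0"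
      unfolding M_def T using real[OF \<open>T > T0\<close>] by (metis Reals_divide complex_is_Real_iff)
    then have "\<bar>Im (M (Complex T w))\<bar> \<le> norm (M (Complex T w) - M (Complex T 0))"
      using abs_Im_le_cmod[of "M (Complex T w) - M (Complex T 0)"] by simp
    then show "\<bar>Im (deriv f (Complex T w) / f (Complex T w))\<bar> \<le> \<bar>K\<bar> * w"
      using le w unfolding M_def by (smt (verit) mult_right_mono)
  qed auto
qed (auto intro: exI[of _ 0])

subsection \<open>Functions with only real zeros in a half strip\<close>

text \<open>Applied to y / C, which runs through [0, 1] in the strip: it lets a multiple of sin (y /
  C) dominate the linear error on the left edge.\<close>

lemma sin_ge_half:
  fixes x :: real
  assumes "0 \<le> x" "x \<le> 1"
  shows "x / 2 \<le> sin x"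
proof -
  have "sin 0 - 0 / 2 \<le> sin x - x / 2"
  proof (rule DERIV_nonneg_imp_nondecreasing[OF \<open>0 \<le> x\<close>])
    fix t assume t: "0 \<le> t" "t \<le> x"
    have "cos (pi / 3) \<le> cos t"
      using t assms pi_gt3 by (intro cos_monotone_0_pi_le) auto
    then have "cos t - 1 / 2 \<ge> 0"
      by (simp add: cos_60)
    moreover have "((\<lambda>t. sin t - t / 2) has_real_derivative cos t - 1 / 2) (at t)"
      by (auto intro!: derivative_eq_intros)
    ultimately show "\<exists>y. ((\<lambda>t. sin t - t / 2) has_real_derivative y) (at t) \<and> 0 \<le> y"
      by blast
  qed
  then show ?thesis by simp
qed

text \<open>Setting of the Phragmen-Lindeloef step; \<open>f\<close> stands for one derivative in
  the sequence. The information on f'/f is required in a window on both sides of the height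
  \<open>C\<close>, because the quotient at the edge compares the heights \<open>C\<close> -
  \<open>\<eta>\<close> and \<open>C\<close> + \<open>\<eta>\<close> by integrating across
  it.\<close>

locale strip_function =
  fixes f :: "complex \<Rightarrow> complex" and T0 C \<delta> m K :: real and n :: nat
  assumes T0: "T0 \<ge> 0" and C: "C > 0" and \<delta>: "\<delta> > 0" and m: "m > 0" and K: "K \<ge> 0"
    and hol: "f holomorphic_on {z. Re z > T0}"
    and real: "\<And>x. x > T0 \<Longrightarrow> f (of_real x) \<in> \<real>"
    and growth: "\<And>z. Re z > T0 \<Longrightarrow> \<bar>Im z\<bar> < C + \<delta> \<Longrightarrow> norm (f z) \<le> exp (Re z ^ n)"
    and nz: "\<And>z. Re z > T0 \<Longrightarrow> Im z \<noteq> 0 \<Longrightarrow> \<bar>Im z\<bar> < C + \<delta> \<Longrightarrow> f z \<noteq> 0"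
    and top: "\<And>z. Re z > T0 \<Longrightarrow> \<bar>Im z - C\<bar> < \<delta> \<Longrightarrow> Im (deriv f z / f z) \<le> - m"
    and top_bound: "\<And>z. Re z > T0 \<Longrightarrow> \<bar>Im z - C\<bar> < \<delta> \<Longrightarrow> norm (deriv f z / f z) \<le> K * Re z"
begin

text \<open>Controls the denominator of the shifted quotient. Along the height
  \<open>C + \<delta>/2\<close> the linear bound on f'/f integrates to a quadratic bound for ln |f|;
  Harnack then descends to height \<open>\<eta>\<close>. The constants may blow up as
  \<open>\<eta>\<close> tends to 0, since Phragmen-Lindeloef uses them only qualitatively.\<close>

lemma lower_bound:
  assumes T: "T \<ge> T0 + 1" and "\<eta> > 0"
  shows "\<exists>K' N. \<forall>x w. T \<le> x \<and> \<eta> \<le> w \<and> w \<le> C + \<delta>/2 \<longrightarrow>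
           - ln (norm (f (Complex x w))) \<le> K' * (x + 1) ^ N"
proof -
  \<comment> \<open>The discs of radius \<open>r\<close> stay off the real axis by
    \<open>r \<le> \<eta>\<close> and below height \<open>C + \<delta>\<close> by
    \<open>r \<le> \<delta>/2\<close>, so they contain no zeros; \<open>r \<le> 1\<close> keeps them
    in Re z <= x + 1 and, as \<open>T \<ge> T0 + 1\<close>, in the half plane.\<close>
  define b r where "b = C + \<delta>/2" and "r = min (min \<eta> (\<delta>/2)) 1"
  have b: "b > 0" "b < C + \<delta>" and r: "r > 0" "r \<le> \<eta>" "r \<le> \<delta>/2" "r \<le> 1"
    using C \<delta> \<open>\<eta> > 0\<close> by (auto simp: b_def r_def)
  define K0 E where "K0 = ln (norm (f (Complex T b)))" and "E = exp (2 * b / r)"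
  have start: "ln (norm (f (Complex x b))) \<ge> K0 - K * x\<^sup>2 / 2" if "x \<ge> T" for x
  proof -
    have "ln (norm (f (Complex T b))) + K * T\<^sup>2 / 2 \<le> ln (norm (f (Complex x b))) + K * x\<^sup>2 / 2"
    proof (rule DERIV_nonneg_imp_nondecreasing[OF \<open>T \<le> x\<close>])
      fix x assume x: "T \<le> x"
      define M where "M = deriv f (Complex x b) / f (Complex x b)"
      have d: "((\<lambda>x. ln (norm (f (Complex x b)))) has_real_derivative Re M) (at x)"
        unfolding M_def using nz[of "Complex x b"] b x T
        by (intro ln_norm_horizontal[OF hol open_halfspace_Re_gt]) auto
      have "norm M \<le> K * x"
        unfolding M_def using top_bound[of "Complex x b"] x T \<delta> by (simp add: b_def)
      then have "Re M + K * x \<ge> 0"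
        using abs_Re_le_cmod[of M] by linarith
      moreover have "((\<lambda>x. ln (norm (f (Complex x b))) + K * x\<^sup>2 / 2) has_real_derivative Re M + K * x) (at x)"
      proof (rule DERIV_add[OF d])
        show "((\<lambda>x. K * x\<^sup>2 / 2) has_real_derivative K * x) (at x)"
          by (auto intro!: derivative_eq_intros)
      qed
      ultimately show "\<exists>y. ((\<lambda>x. ln (norm (f (Complex x b))) + K * x\<^sup>2 / 2) has_real_derivative y) (at x) \<and> 0 \<le> y"
        by blast
    qed
    moreover have "K * T\<^sup>2 \<ge> 0" using K by simp
    ultimately show ?thesis unfolding K0_def by linarith
  qed
  show ?thesis
  proof (intro exI[of _ "E * (2 + \<bar>K0\<bar> + K)"] exI[of _ "n + 2"] allI impI)
    fix x w assume "T \<le> x \<and> \<eta> \<le> w \<and> w \<le> C + \<delta>/2"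
    then have x: "T \<le> x" and w: "\<eta> \<le> w" "w \<le> b" by (auto simp: b_def)
    have in_strip: "Re z > T0 \<and> Re z \<le> x + 1 \<and> 0 < Im z \<and> Im z < C + \<delta>"
      if "w \<le> v" "v \<le> b" "z \<in> ball (Complex x v) r" for v z
    proof -
      have "\<bar>Re z - x\<bar> < r" "\<bar>Im z - v\<bar> < r"
        using that(3) abs_Re_le_cmod[of "z - Complex x v"] abs_Im_le_cmod[of "z - Complex x v"]
        by (auto simp: dist_norm norm_minus_commute)
      then show ?thesis
        using that r w x T b by (auto simp: b_def)
    qed
    define A where "A = (x + 1) ^ n"
    have bd: "norm (f z) \<le> exp A" if "w \<le> v" "v \<le> b" "z \<in> ball (Complex x v) r" for v z
    proof -
      have "norm (f z) \<le> exp (Re z ^ n)"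
        using in_strip[OF that] by (intro growth) auto
      also have "Re z ^ n \<le> A"
        unfolding A_def using in_strip[OF that] T0 by (intro power_mono) auto
      finally show ?thesis by simp
    qed
    have "A + 1 - ln (norm (f (Complex x w))) \<le>
            exp (2 * (b - w) / r) * (A + 1 - ln (norm (f (Complex x b))))"
      using in_strip bd nz
      by (intro ln_norm_lower_bound_vertical[OF hol open_halfspace_Re_gt r(1) w(2)]) fastforce+
    also have "\<dots> \<le> E * (A + 1 - ln (norm (f (Complex x b))))"
    proof (rule mult_right_mono)
      show "exp (2 * (b - w) / r) \<le> E"
        using w r b \<open>\<eta> > 0\<close> by (simp add: E_def divide_right_mono)
      have "norm (f (Complex x b)) \<le> exp A"
        using bd[of b "Complex x b"] w r by simp
      moreover have "f (Complex x b) \<noteq> 0"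
        using nz[of "Complex x b"] x T b by auto
      ultimately have "ln (norm (f (Complex x b))) \<le> A"
        by (metis exp_le_cancel_iff exp_ln zero_less_norm_iff)
      then show "0 \<le> A + 1 - ln (norm (f (Complex x b)))" by simp
    qed
    also have "\<dots> \<le> E * (A + 1 + \<bar>K0\<bar> + K * x\<^sup>2)"
    proof (rule mult_left_mono)
      have "K * x\<^sup>2 \<ge> 0" using K by simp
      then show "A + 1 - ln (norm (f (Complex x b))) \<le> A + 1 + \<bar>K0\<bar> + K * x\<^sup>2"
        using start[OF x] by linarith
    qed (simp add: E_def)
    also have "\<dots> \<le> E * ((2 + \<bar>K0\<bar> + K) * (x + 1) ^ (n + 2))"
    proof (rule mult_left_mono)
      have x1: "x + 1 \<ge> 1" "x \<ge> 0" using x T T0 by auto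
      have "A \<le> (x + 1) ^ (n + 2)" "1 \<le> (x + 1) ^ (n + 2)" "x\<^sup>2 \<le> (x + 1) ^ (n + 2)"
      proof -
        show "A \<le> (x + 1) ^ (n + 2)"
          unfolding A_def using x1 by (intro power_increasing) auto
        show "1 \<le> (x + 1) ^ (n + 2)"
          by (rule one_le_power[OF x1(1)])
        have "x\<^sup>2 \<le> (x + 1)\<^sup>2" using x1 by (intro power_mono) auto
        also have "\<dots> \<le> (x + 1) ^ (n + 2)" using x1 by (intro power_increasing) auto
        finally show "x\<^sup>2 \<le> (x + 1) ^ (n + 2)" .
      qed
      then have "A + 1 + \<bar>K0\<bar> * 1 + K * x\<^sup>2 \<le> (x + 1) ^ (n + 2) + (x + 1) ^ (n + 2)
          + \<bar>K0\<bar> * (x + 1) ^ (n + 2) + K * (x + 1) ^ (n + 2)"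
        using K by (intro add_mono mult_left_mono) auto
      then show "A + 1 + \<bar>K0\<bar> + K * x\<^sup>2 \<le> (2 + \<bar>K0\<bar> + K) * (x + 1) ^ (n + 2)"
        by (simp add: algebra_simps)
    qed (simp add: E_def)
    finally have "A + 1 - ln (norm (f (Complex x w))) \<le> E * ((2 + \<bar>K0\<bar> + K) * (x + 1) ^ (n + 2))" .
    moreover have "A \<ge> 0"
      using x T T0 by (simp add: A_def)
    ultimately show "- ln (norm (f (Complex x w))) \<le> E * (2 + \<bar>K0\<bar> + K) * (x + 1) ^ (n + 2)"
      by (simp add: mult.assoc)
  qed
qed

text \<open>
  Phragmen-Lindeloef for the quotient times \<open>P\<close>, whose modulus is the inverse of the claimed bound. The term
  with \<open>\<epsilon>\<close> is what the upper edge of the strip allows, the term with \<open>K'\<close> dominates the left edge and dies out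
  exponentially; both vanish on the real axis.
\<close>
lemma shifted_quotient_bound:
  fixes T K1 \<eta> :: real
  defines "\<epsilon> \<equiv> m / C" and "K' \<equiv> 4 * C * (K1 + m / C)"
  assumes T: "T \<ge> T0 + 1" and fT: "f (of_real T) \<noteq> 0" and \<eta>: "0 < \<eta>" "\<eta> < \<delta> / 2" and "K1 \<ge> 0"
    and K1: "\<And>w. 0 \<le> w \<Longrightarrow> w \<le> C + \<delta>/2 \<Longrightarrow>
      \<bar>Im (deriv f (Complex T w) / f (Complex T w))\<bar> \<le> K1 * w"
    and xy: "T \<le> x" "0 \<le> y" "y \<le> C"
  shows "norm (f (Complex x (y - \<eta>)) / f (Complex x (y + \<eta>))) \<le>
           exp (\<eta> * (- 2 * \<epsilon> * y + K' * exp (- (x - T) / C) * sin (y / C)))"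
proof -
  have \<epsilon>: "\<epsilon> > 0" and K': "K' \<ge> 0"
    using m C \<open>K1 \<ge> 0\<close> by (simp_all add: \<epsilon>_def K'_def)
  define c where "c = (\<lambda>z. - 2 * \<epsilon> * Im z + K' * exp (- (Re z - T) / C) * sin (Im z / C))"
  \<comment> \<open>Since exp (-(z - T)/C) has imaginary part - exp (-(x - T)/C) sin (y/C), the
    exponent \<open>c\<close> of the claim is harmonic, and \<open>P\<close> is the zero-free
    holomorphic function with modulus exp (- \<open>\<eta>\<close> c).\<close>
  define P where "P = (\<lambda>z. exp (- \<i> * of_real \<eta> *
     (2 * of_real \<epsilon> * z + of_real K' * exp (- (z - of_real T) / of_real C))))"
  define h where "h = (\<lambda>z. f (z - \<i> * of_real \<eta>) / f (z + \<i> * of_real \<eta>) * P z)"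
  have normP: "norm (P z) = exp (- \<eta> * c z)" for z
    unfolding P_def c_def by (simp add: Im_exp algebra_simps)
  have shift: "z - \<i> * of_real \<eta> = Complex (Re z) (Im z - \<eta>)"
    "z + \<i> * of_real \<eta> = Complex (Re z) (Im z + \<eta>)" for z
    by (simp_all add: complex_eq_iff)
  have normh: "norm (h z) = norm (f (Complex (Re z) (Im z - \<eta>))) /
      norm (f (Complex (Re z) (Im z + \<eta>))) * exp (- \<eta> * c z)" for z
    unfolding h_def shift by (simp add: norm_mult norm_divide normP)
  have up_nz: "f (Complex x (y + \<eta>)) \<noteq> 0" if "T \<le> x" "0 \<le> y" "y \<le> C" for x y
    using that nz[of "Complex x (y + \<eta>)"] T \<eta> by auto
  have quot_le: "norm (f (Complex x (y - \<eta>))) / norm (f (Complex x (y + \<eta>))) \<le> exp B"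
    if "T \<le> x" "0 \<le> y" "y \<le> C" and "f (Complex x (y - \<eta>)) \<noteq> 0"
      and "ln (norm (f (Complex x (y - \<eta>)))) \<le> ln (norm (f (Complex x (y + \<eta>)))) + B" for x y B
  proof -
    have "norm (f (Complex x (y - \<eta>))) \<le> exp (ln (norm (f (Complex x (y + \<eta>)))) + B)"
      using that by (metis exp_le_cancel_iff exp_ln zero_less_norm_iff)
    then show ?thesis
      using up_nz[OF that(1-3)] by (simp add: exp_add field_simps)
  qed
  have sin_nonneg: "sin (y / C) \<ge> 0" if "0 \<le> y" "y \<le> C" for y
  proof -
    have "0 \<le> y / C" "y / C \<le> 1"
      using that C by auto
    then show ?thesis
      by (intro order_trans[OF _ sin_ge_half]) auto
  qed
  have c_ge: "c z \<ge> - 2 * \<epsilon> * Im z" if "0 \<le> Im z" "Im z \<le> C" for z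
    unfolding c_def using sin_nonneg[OF that] K' by simp
  obtain K2 N where low: "\<And>x w. T \<le> x \<Longrightarrow> \<eta> \<le> w \<Longrightarrow> w \<le> C + \<delta>/2 \<Longrightarrow>
           - ln (norm (f (Complex x w))) \<le> K2 * (x + 1) ^ N"
    using lower_bound[OF T \<eta>(1)] by metis
  define g where "g = (\<lambda>x::real. 1 * (x + 1) ^ n + K2 * (x + 1) ^ N + 2 * \<eta> * \<epsilon> * C * (x + 1) ^ 0)"
  have "norm (h (Complex x y)) \<le> 1"
  proof (rule phragmen_lindelof_half_strip[where h = h and C = C and T = T and g = g
        and U = "{z. Re z > T0 \<and> f (z + \<i> * of_real \<eta>) \<noteq> 0}"])
    have "(\<lambda>z. f (z - \<i> * of_real \<eta>)) holomorphic_on {z. Re z > T0}"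
      "(\<lambda>z. f (z + \<i> * of_real \<eta>)) holomorphic_on {z. Re z > T0}"
      by (rule holomorphic_on_compose_gen[OF _ hol, unfolded o_def]; auto intro!: holomorphic_intros)+
    then show "h holomorphic_on {z. Re z > T0 \<and> f (z + \<i> * of_real \<eta>) \<noteq> 0}"
      unfolding h_def P_def using C
      by (intro holomorphic_intros) (auto elim: holomorphic_on_subset)
    show "{z. T \<le> Re z \<and> 0 \<le> Im z \<and> Im z \<le> C} \<subseteq> {z. Re z > T0 \<and> f (z + \<i> * of_real \<eta>) \<noteq> 0}"
      using T up_nz by (auto simp: shift)
    fix x assume x: "T \<le> x"
    have "cnj (Complex x \<eta>) = Complex x (- \<eta>)"
      by (simp add: complex_eq_iff)
    then have "f (Complex x (- \<eta>)) = cnj (f (Complex x \<eta>))"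
      using cnj_symmetric[OF hol real, of "Complex x \<eta>"] x T by simp
    then show "norm (h (Complex x 0)) \<le> 1"
      unfolding normh c_def by simp
    \<comment> \<open>Integrating \<open>top\<close> from height \<open>C\<close> -
      \<open>\<eta>\<close> to \<open>C\<close> + \<open>\<eta>\<close> yields the factor exp (- 2
      \<open>\<eta>\<close> m). On this edge \<open>c\<close> >= - 2 \<open>\<epsilon>\<close> C = -
      2 m, so \<open>\<epsilon>\<close> = m / C is exactly what the factor pays for.\<close>
    have "ln (norm (f (Complex x (C - \<eta>)))) - m * (C - \<eta>) \<le> ln (norm (f (Complex x (C + \<eta>)))) - m * (C + \<eta>)"
    proof (rule DERIV_nonneg_imp_nondecreasing[where f = "\<lambda>w. ln (norm (f (Complex x w))) - m * w"])
      fix w assume w: "C - \<eta> \<le> w" "w \<le> C + \<eta>"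
      then have w': "\<bar>w - C\<bar> < \<delta>"
        using \<eta> by linarith
      have d: "((\<lambda>w. ln (norm (f (Complex x w)))) has_real_derivative
           - Im (deriv f (Complex x w) / f (Complex x w))) (at w)"
      proof (rule ln_norm_vertical[OF hol open_halfspace_Re_gt])
        have "Im (deriv f (Complex x w) / f (Complex x w)) \<le> - m"
          using w' x T by (intro top) auto
        then show "f (Complex x w) \<noteq> 0" using m by auto
      qed (use x T in auto)
      have "- Im (deriv f (Complex x w) / f (Complex x w)) - m \<ge> 0"
        using top[of "Complex x w"] w' x T by simp
      moreover have "((\<lambda>w. ln (norm (f (Complex x w))) - m * w) has_real_derivative
           - Im (deriv f (Complex x w) / f (Complex x w)) - m) (at w)"
        by (rule DERIV_cong[OF DERIV_diff[OF d DERIV_cmult[OF DERIV_ident]]]) simp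
      ultimately show "\<exists>y. ((\<lambda>w. ln (norm (f (Complex x w))) - m * w) has_real_derivative y) (at w) \<and> 0 \<le> y"
        by blast
    qed (use \<eta> in auto)
    then have le: "ln (norm (f (Complex x (C - \<eta>)))) \<le> ln (norm (f (Complex x (C + \<eta>)))) + - 2 * \<eta> * m"
      by (simp add: algebra_simps)
    have "f (Complex x (C - \<eta>)) \<noteq> 0"
      using top[of "Complex x (C - \<eta>)"] x T \<eta> m by auto
    from quot_le[OF x _ _ this le]
    have "norm (f (Complex x (C - \<eta>))) / norm (f (Complex x (C + \<eta>))) \<le> exp (- 2 * \<eta> * m)"
      using C by simp
    then have "norm (h (Complex x C)) \<le> exp (- 2 * \<eta> * m) * exp (- \<eta> * c (Complex x C))"
      unfolding normh complex.sel by (rule mult_right_mono) simp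
    also have "\<dots> = exp (- \<eta> * (2 * m + c (Complex x C)))"
      unfolding exp_add[symmetric] by (simp add: algebra_simps)
    also have "2 * m + c (Complex x C) \<ge> 0"
      using c_ge[of "Complex x C"] C by (simp add: \<epsilon>_def)
    then have "exp (- \<eta> * (2 * m + c (Complex x C))) \<le> 1"
      using \<eta> by simp
    finally show "norm (h (Complex x C)) \<le> 1" .
  next
    fix y assume y: "0 \<le> y" "y \<le> C"
    have nzT: "f (Complex T w) \<noteq> 0" if "\<bar>w\<bar> < C + \<delta>" for w
      using nz[of "Complex T w"] T that fT by (cases "w = 0") (auto simp: complex_of_real_def)
    \<comment> \<open>For y < \<open>\<eta>\<close> the lower point lies below the axis, and
      reflection replaces its height by \<open>u\<close>. Only the square of \<open>u\<close> enters
      the integral of \<open>K1\<close> w from \<open>u\<close> to y + \<open>\<eta>\<close>, so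
      that integral is 2 \<open>\<eta>\<close> \<open>K1\<close> y in both cases.\<close>
    define u where "u = \<bar>y - \<eta>\<bar>"
    have u: "u = y - \<eta> \<or> u = - (y - \<eta>)" by (auto simp: u_def)
    have u_le: "0 \<le> u" "u \<le> y + \<eta>" "u < C + \<delta>" using y \<eta> by (auto simp: u_def)
    have "cnj (Complex T (y - \<eta>)) = Complex T (- (y - \<eta>))"
      by (simp add: complex_eq_iff)
    then have nu: "norm (f (Complex T (y - \<eta>))) = norm (f (Complex T u))"
      using cnj_symmetric[OF hol real, of "Complex T (y - \<eta>)"] T u by (metis complex_mod_cnj complex.sel(1) less_add_one order_less_le_trans)
    have "ln (norm (f (Complex T u))) + K1 * u\<^sup>2 / 2 \<le> ln (norm (f (Complex T (y + \<eta>)))) + K1 * (y + \<eta>)\<^sup>2 / 2"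
    proof (rule DERIV_nonneg_imp_nondecreasing[OF u_le(2),
          where f = "\<lambda>w. ln (norm (f (Complex T w))) + K1 * w\<^sup>2 / 2"])
      fix w assume w: "u \<le> w" "w \<le> y + \<eta>"
      have d: "((\<lambda>w. ln (norm (f (Complex T w)))) has_real_derivative
           - Im (deriv f (Complex T w) / f (Complex T w))) (at w)"
        using T nzT[of w] w u_le y \<eta> by (intro ln_norm_vertical[OF hol open_halfspace_Re_gt]) auto
      have "- Im (deriv f (Complex T w) / f (Complex T w)) + K1 * w \<ge> 0"
        using K1[of w] w u_le y \<eta> by auto
      moreover have "((\<lambda>w. ln (norm (f (Complex T w))) + K1 * w\<^sup>2 / 2) has_real_derivative
           - Im (deriv f (Complex T w) / f (Complex T w)) + K1 * w) (at w)"
      proof (rule DERIV_add[OF d])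
        show "((\<lambda>w. K1 * w\<^sup>2 / 2) has_real_derivative K1 * w) (at w)"
          by (auto intro!: derivative_eq_intros)
      qed
      ultimately show "\<exists>y. ((\<lambda>w. ln (norm (f (Complex T w))) + K1 * w\<^sup>2 / 2) has_real_derivative y) (at w) \<and> 0 \<le> y"
        by blast
    qed
    moreover have "K1 * u\<^sup>2 / 2 = K1 * (y + \<eta>)\<^sup>2 / 2 - 2 * \<eta> * K1 * y"
      by (simp add: u_def power2_eq_square field_simps)
    ultimately have le: "ln (norm (f (Complex T (y - \<eta>)))) \<le> ln (norm (f (Complex T (y + \<eta>)))) + 2 * \<eta> * K1 * y"
      unfolding nu by linarith
    have "f (Complex T (y - \<eta>)) \<noteq> 0"
      using nzT[of "y - \<eta>"] y \<eta> by auto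
    from quot_le[OF _ y this le]
    have "norm (f (Complex T (y - \<eta>))) / norm (f (Complex T (y + \<eta>))) \<le> exp (2 * \<eta> * K1 * y)"
      by simp
    then have "norm (h (Complex T y)) \<le> exp (2 * \<eta> * K1 * y) * exp (- \<eta> * c (Complex T y))"
      unfolding normh complex.sel by (rule mult_right_mono) simp
    also have "\<dots> = exp (\<eta> * (2 * K1 * y - c (Complex T y)))"
      unfolding exp_add[symmetric] by (simp add: algebra_simps)
    also have "c (Complex T y) \<ge> 2 * K1 * y"
    proof -
      have "y / C / 2 \<le> sin (y / C)"
        using y C by (intro sin_ge_half) auto
      then have "K' * (y / C / 2) \<le> K' * sin (y / C)"
        using K' by (rule mult_left_mono)
      \<comment> \<open>This identity dictates \<open>K'\<close>: with sin (y/C) >= y/(2C), the sine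
        term must cover the edge error 2 \<open>K1\<close> y and the term 2
        \<open>\<epsilon>\<close> y that \<open>c\<close> subtracts.\<close>
      moreover have "K' * (y / C / 2) = 2 * K1 * y + 2 * \<epsilon> * y"
        using C by (simp add: K'_def \<epsilon>_def field_simps)
      ultimately show ?thesis
        unfolding c_def by simp
    qed
    then have "exp (\<eta> * (2 * K1 * y - c (Complex T y))) \<le> 1"
      using \<eta> by (simp add: mult_le_0_iff)
    finally show "norm (h (Complex T y)) \<le> 1" .
  next
    fix z assume z: "T \<le> Re z" "0 \<le> Im z" "Im z \<le> C"
    define w where "w = Complex (Re z) (Im z + \<eta>)"
    have fw: "f w \<noteq> 0" unfolding w_def using up_nz z by simp
    have "norm (f (Complex (Re z) (Im z - \<eta>))) \<le> exp (Re z ^ n)"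
      using growth[of "Complex (Re z) (Im z - \<eta>)"] z T \<eta> by simp
    also have "\<dots> \<le> exp ((Re z + 1) ^ n)"
      using z T T0 by (simp add: power_mono)
    finally have 1: "norm (f (Complex (Re z) (Im z - \<eta>))) \<le> exp ((Re z + 1) ^ n)" .
    have "1 / norm (f w) = exp (- ln (norm (f w)))"
      using fw by (simp add: exp_minus inverse_eq_divide)
    also have "\<dots> \<le> exp (K2 * (Re z + 1) ^ N)"
      unfolding w_def using low[of "Re z" "Im z + \<eta>"] z \<eta> by simp
    finally have 2: "1 / norm (f w) \<le> exp (K2 * (Re z + 1) ^ N)" .
    have "\<epsilon> * Im z \<le> \<epsilon> * C" using \<epsilon> z by simp
    then have "- c z \<le> 2 * \<epsilon> * C"
      using c_ge[of z] z by simp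
    then have "\<eta> * (- c z) \<le> \<eta> * (2 * \<epsilon> * C)"
      using \<eta> by (intro mult_left_mono) auto
    then have 3: "exp (- \<eta> * c z) \<le> exp (2 * \<eta> * \<epsilon> * C)"
      by (simp add: mult_ac)
    have "norm (h z) = norm (f (Complex (Re z) (Im z - \<eta>))) * (1 / norm (f w)) * exp (- \<eta> * c z)"
      unfolding normh w_def by simp
    also have "\<dots> \<le> exp ((Re z + 1) ^ n) * exp (K2 * (Re z + 1) ^ N) * exp (2 * \<eta> * \<epsilon> * C)"
      using 1 2 3 by (intro mult_mono) auto
    also have "\<dots> = exp (g (Re z))"
      unfolding g_def by (simp add: exp_add)
    finally show "norm (h z) \<le> exp (g (Re z))" .
  next
    have "((\<lambda>x. 1 * (x + 1) ^ n / exp (x / C) + K2 * (x + 1) ^ N / exp (x / C)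
        + 2 * \<eta> * \<epsilon> * C * (x + 1) ^ 0 / exp (x / C)) \<longlongrightarrow> 0 + 0 + 0) at_top"
      by (intro tendsto_add power_over_exp_tendsto_0 C)
    then show "((\<lambda>x. g x / exp (x / C)) \<longlongrightarrow> 0) at_top"
      unfolding g_def by (simp add: add_divide_distrib)
  qed (use C xy in auto)
  then have "norm (f (Complex x (y - \<eta>)) / f (Complex x (y + \<eta>))) * exp (- \<eta> * c (Complex x y)) \<le> 1"
    unfolding normh by (simp add: norm_divide)
  then have "norm (f (Complex x (y - \<eta>)) / f (Complex x (y + \<eta>))) \<le> exp (\<eta> * c (Complex x y))"
    by (simp add: exp_minus field_simps)
  then show ?thesis
    by (simp add: c_def)
qed

end

text \<open>Taking logarithms in \<open>shifted_quotient_bound\<close>, dividing by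
  \<open>\<eta>\<close> and letting \<open>\<eta>\<close> tend to 0 turns the left-hand side into 2
  Im (f'/f), because the symmetric difference of ln |f| differentiates to that.\<close>

lemma (in strip_function) logderiv_negative:
  "\<exists>\<epsilon>>0. \<exists>T\<ge>T0. \<forall>z. Re z > T \<and> 0 < Im z \<and> Im z \<le> C \<longrightarrow>
     Im (deriv f z / f z) \<le> - \<epsilon> * Im z"
proof -
  have a: "Re (Complex (T0 + 1) (C/2)) > T0" by simp
  have "f (Complex (T0 + 1) (C/2)) \<noteq> 0"
    using C \<delta> by (intro nz) auto
  from real_zero_free_point[OF hol a this, of "T0 + 1"]
  obtain T where T: "T > T0 + 1" "f (of_real T) \<noteq> 0"
    by blast
  have nzT: "f (Complex T w) \<noteq> 0" if "0 \<le> w" "w \<le> C + \<delta>/2" for w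
    using nz[of "Complex T w"] T that \<delta> by (cases "w = 0") (auto simp: complex_of_real_def)
  have "\<exists>K\<ge>0. \<forall>w. 0 \<le> w \<and> w \<le> C + \<delta>/2 \<longrightarrow>
      \<bar>Im (deriv f (Complex T w) / f (Complex T w))\<bar> \<le> K * w"
    by (rule logderiv_real_segment[OF hol real _ nzT]) (use T in auto)
  then obtain K1 where "K1 \<ge> 0" and K1: "\<And>w. 0 \<le> w \<Longrightarrow> w \<le> C + \<delta>/2 \<Longrightarrow>
      \<bar>Im (deriv f (Complex T w) / f (Complex T w))\<bar> \<le> K1 * w"
    by blast
  define \<epsilon> K' where "\<epsilon> = m / C" and "K' = 4 * C * (K1 + m / C)"
  have \<epsilon>: "\<epsilon> > 0" and K': "K' \<ge> 0"
    using m C \<open>K1 \<ge> 0\<close> by (simp_all add: \<epsilon>_def K'_def)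
  have bound: "2 * Im (deriv f (Complex x y) / f (Complex x y)) \<le>
      - 2 * \<epsilon> * y + K' * exp (- (x - T) / C) * sin (y / C)" (is "_ \<le> ?c")
    if xy: "T \<le> x" "0 < y" "y \<le> C" for x y
  proof -
    define \<psi> where "\<psi> = (\<lambda>w. ln (norm (f (Complex x w))))"
    define M where "M = deriv f (Complex x y) / f (Complex x y)"
    define G where "G = (\<lambda>\<eta>. \<psi> (y - \<eta>) - \<psi> (y + \<eta>))"
    have nzx: "f (Complex x w) \<noteq> 0" if "0 < w" "w < C + \<delta>" for w
      using nz[of "Complex x w"] that xy T by auto
    have d\<psi>: "(\<psi> has_real_derivative - Im M) (at y)"
      unfolding \<psi>_def M_def using xy T nzx[of y] \<delta>
      by (intro ln_norm_vertical[OF hol open_halfspace_Re_gt]) auto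
    have "((\<lambda>\<eta>. \<psi> (y - \<eta>)) has_real_derivative - Im M * (- 1)) (at 0)"
      by (rule DERIV_chain2) (use d\<psi> in \<open>auto intro!: derivative_eq_intros\<close>)
    moreover have "((\<lambda>\<eta>. \<psi> (y + \<eta>)) has_real_derivative - Im M * 1) (at 0)"
      by (rule DERIV_chain2) (use d\<psi> in \<open>auto intro!: derivative_eq_intros\<close>)
    ultimately have "(G has_real_derivative 2 * Im M) (at 0)"
      unfolding G_def using DERIV_diff by fastforce
    then have "((\<lambda>h. G h / h) \<longlongrightarrow> 2 * Im M) (at 0)"
      by (simp add: DERIV_def G_def)
    then have lim: "((\<lambda>h. G h / h) \<longlongrightarrow> 2 * Im M) (at_right 0)"
      by (rule filterlim_mono) (auto simp: at_le)
    have "\<forall>\<^sub>F h in at_right 0. h \<in> {0<..<min (\<delta>/2) y}"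
      using \<delta> xy by (intro eventually_at_right_real) auto
    then have "\<forall>\<^sub>F h in at_right 0. G h / h \<le> ?c"
    proof eventually_elim
      case (elim h)
      then have h: "0 < h" "h < \<delta>/2" "h < y" by auto
      have pos: "norm (f (Complex x (y - h))) > 0" "norm (f (Complex x (y + h))) > 0"
        using nzx[of "y - h"] nzx[of "y + h"] h xy by auto
      have "norm (f (Complex x (y - h)) / f (Complex x (y + h))) \<le> exp (h * ?c)"
        using shifted_quotient_bound[OF _ T(2) h(1,2) \<open>K1 \<ge> 0\<close> K1] xy T
        by (simp add: \<epsilon>_def K'_def)
      then have "norm (f (Complex x (y - h))) \<le> exp (h * ?c) * norm (f (Complex x (y + h)))"
        using pos by (simp add: norm_divide pos_divide_le_eq)
      then have "\<psi> (y - h) \<le> ln (exp (h * ?c) * norm (f (Complex x (y + h))))"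
        unfolding \<psi>_def using pos by (subst ln_le_cancel_iff) (auto simp: mult_pos_pos)
      then have "G h \<le> h * ?c"
        using pos unfolding G_def \<psi>_def by (simp add: ln_mult)
      then show ?case
        using h by (simp add: pos_divide_le_eq mult.commute)
    qed
    then show ?thesis
      using tendsto_upperbound[OF lim] unfolding M_def by (simp add: trivial_limit_at_right_real)
  qed
  \<comment> \<open>As sin (y/C) <= y/C, the left edge contributes at most y times a factor that
    decays in x. Beyond \<open>X\<close> it uses up half of the decay rate, which leaves
    \<open>\<epsilon> / 2\<close>.\<close>
  have "((\<lambda>x. K' / C * exp (- (x - T) / C)) \<longlongrightarrow> 0) at_top"
    using C by real_asymp
  then have "\<forall>\<^sub>F x in at_top. K' / C * exp (- (x - T) / C) < \<epsilon>"
    using \<epsilon> by (rule order_tendstoD)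
  then obtain X where X: "\<And>x. x \<ge> X \<Longrightarrow> K' / C * exp (- (x - T) / C) < \<epsilon>"
    by (auto simp: eventually_at_top_linorder)
  show ?thesis
  proof (rule exI[of _ "\<epsilon> / 2"], intro exI[of _ "max X T"] conjI allI impI)
    fix z assume z: "max X T < Re z \<and> 0 < Im z \<and> Im z \<le> C"
    have "sin (Im z / C) \<le> Im z / C"
      using z C by (intro sin_x_le_x) auto
    then have "K' * exp (- (Re z - T) / C) * sin (Im z / C) \<le> K' * exp (- (Re z - T) / C) * (Im z / C)"
      using K' by (intro mult_left_mono) auto
    also have "\<dots> = K' / C * exp (- (Re z - T) / C) * Im z"
      by simp
    also have "\<dots> \<le> \<epsilon> * Im z"
      using z X[of "Re z"] by (intro mult_right_mono) auto
    finally show "Im (deriv f z / f z) \<le> - (\<epsilon> / 2) * Im z"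
      using bound[of "Re z" "Im z"] z by simp
  qed (use \<epsilon> T in auto)
qed

text \<open>\<open>D\<close> plays the role of \<open>\<Theta>'\<close> for \<open>f z = exp (\<i> * \<Theta> z) * F (1/2 + \<i> * z)\<close>.\<close>
locale strip_asymptotics =
  fixes f D :: "complex \<Rightarrow> complex" and T0 m :: real
  assumes T0: "T0 \<ge> 0" and m: "m > 0"
    and hol: "f holomorphic_on {z. Re z > T0}" and holD: "D holomorphic_on {z. Re z > T0}"
    and real: "\<And>x. x > T0 \<Longrightarrow> f (of_real x) \<in> \<real>"
    and growth: "\<And>b. \<exists>n T. \<forall>z. Re z > T \<and> \<bar>Im z\<bar> < b \<longrightarrow> norm (f z) \<le> exp (Re z ^ n)"
    and nz: "\<And>z. Re z > T0 \<Longrightarrow> Im z \<noteq> 0 \<Longrightarrow> f z \<noteq> 0"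
    and asymp: "\<And>e. e > 0 \<Longrightarrow> \<exists>c. \<forall>b. \<exists>T\<ge>T0. \<forall>z. Re z > T \<and> - b < Im z \<and> Im z < - c \<longrightarrow>
                  f z \<noteq> 0 \<and> norm (deriv f z / f z - \<i> * D z) \<le> e"
    and D_ge: "\<And>b. \<exists>T. \<forall>z. Re z > T \<and> \<bar>Im z\<bar> < b \<longrightarrow> Re (D z) \<ge> m"
    and D_le: "\<And>b. \<exists>K T. \<forall>z. Re z > T \<and> \<bar>Im z\<bar> < b \<longrightarrow> norm (D z) \<le> K * Re z"
    and D_deriv: "\<And>b e. e > 0 \<Longrightarrow> \<exists>T. \<forall>z. Re z > T \<and> \<bar>Im z\<bar> < b \<longrightarrow>
                  norm (deriv D z) \<le> e * norm (D z)"
begin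

section \<open>Induction over the derivatives\<close>

abbreviation "H \<equiv> {z. Re z > T0}"

definition fk :: "nat \<Rightarrow> complex \<Rightarrow> complex" where "fk k = (deriv ^^ k) f"

definition Mk :: "nat \<Rightarrow> complex \<Rightarrow> complex" where "Mk k z = fk (Suc k) z / fk k z"

lemma fk_Suc: "fk (Suc k) = deriv (fk k)"
  by (simp add: fk_def)

lemma openH: "open H"
  by (rule open_halfspace_Re_gt)

lemma hol_fk: "fk k holomorphic_on H"
  unfolding fk_def by (rule holomorphic_higher_deriv[OF hol openH])

lemma fk_deriv: "Re z > T0 \<Longrightarrow> (fk k has_field_derivative fk (Suc k) z) (at z)"
  unfolding fk_Suc using holomorphic_derivI[OF hol_fk openH] by simp

lemma Mk_deriv:
  assumes "Re z > T0" "fk k z \<noteq> 0"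
  shows "(Mk k has_field_derivative
           (fk (Suc (Suc k)) z * fk k z - fk (Suc k) z * fk (Suc k) z) / (fk k z * fk k z)) (at z)"
  unfolding Mk_def by (intro DERIV_divide fk_deriv assms)

lemma real_fk: "x > T0 \<Longrightarrow> fk k (of_real x) \<in> \<real>"
proof (induction k arbitrary: x)
  case 0
  then show ?case using real by (simp add: fk_def)
next
  case (Suc k)
  then show ?case
    unfolding fk_Suc using deriv_real_on_reals(2)[OF hol_fk] by blast
qed

lemma cnj_fk: "Re z > T0 \<Longrightarrow> fk k (cnj z) = cnj (fk k z)"
  by (rule cnj_symmetric[OF hol_fk real_fk])

lemma cnj_Mk: "Re z > T0 \<Longrightarrow> Mk k (cnj z) = cnj (Mk k z)"
  by (simp add: Mk_def cnj_fk)

lemma near_point: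
  assumes "norm (z - w) \<le> 1"
  shows "\<bar>Re z - Re w\<bar> \<le> 1" "\<bar>Im z - Im w\<bar> \<le> 1"
  using assms abs_Re_le_cmod[of "z - w"] abs_Im_le_cmod[of "z - w"] by auto

text \<open>Cauchy's estimate on unit discs. The shift by 1 is absorbed through Re z + 1 <= (Re
  z)^2, so the exponent doubles with each derivative but remains polynomial.\<close>

lemma growth_fk:
  "\<exists>n T. \<forall>z. Re z > T \<and> \<bar>Im z\<bar> < b \<longrightarrow> norm (fk k z) \<le> exp (Re z ^ n)"
proof (induction k arbitrary: b)
  case 0
  then show ?case using growth by (simp add: fk_def)
next
  case (Suc k)
  obtain n T where nT: "\<And>z. Re z > T \<Longrightarrow> \<bar>Im z\<bar> < b + 1 \<Longrightarrow> norm (fk k z) \<le> exp (Re z ^ n)"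
    using Suc.IH[of "b + 1"] by blast
  show ?case
  proof (intro exI[of _ "2 * n"] exI[of _ "max T T0 + 2"] allI impI)
    fix z assume z: "max T T0 + 2 < Re z \<and> \<bar>Im z\<bar> < b"
    have "norm ((deriv ^^ 1) (fk k) z) \<le> fact 1 * exp ((Re z + 1) ^ n) / 1 ^ 1"
    proof (rule Cauchy_inequality)
      have sub: "cball z 1 \<subseteq> H"
        using near_point z by (fastforce simp: dist_norm)
      show "fk k holomorphic_on ball z 1"
        using holomorphic_on_subset[OF hol_fk] sub ball_subset_cball by blast
      show "continuous_on (cball z 1) (fk k)"
        using holomorphic_on_imp_continuous_on holomorphic_on_subset[OF hol_fk] sub by blast
      fix w assume "norm (z - w) = 1"
      then have w: "\<bar>Re z - Re w\<bar> \<le> 1" "\<bar>Im z - Im w\<bar> \<le> 1"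
        using near_point by auto
      have "norm (fk k w) \<le> exp (Re w ^ n)"
        using w z by (intro nT) auto
      also have "Re w ^ n \<le> (Re z + 1) ^ n"
        using w z T0 by (intro power_mono) auto
      finally show "norm (fk k w) \<le> exp ((Re z + 1) ^ n)" by simp
    qed auto
    then have "norm (fk (Suc k) z) \<le> exp ((Re z + 1) ^ n)"
      by (simp add: fk_Suc)
    also have "(Re z + 1) ^ n \<le> ((Re z)\<^sup>2) ^ n"
    proof (rule power_mono)
      have "Re z \<ge> 2" using z T0 by auto
      then have "Re z * 2 \<le> Re z * Re z" by (intro mult_left_mono) auto
      then show "Re z + 1 \<le> (Re z)\<^sup>2"
        using \<open>Re z \<ge> 2\<close> unfolding power2_eq_square by linarith
    qed (use z T0 in auto)
    finally show "norm (fk (Suc k) z) \<le> exp (Re z ^ (2 * n))"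
      by (simp add: power_mult)
  qed
qed

text \<open>The step rests on the identity \<open>Mk (Suc k)\<close> = \<open>Mk k\<close> +
  (\<open>Mk k\<close>)'/\<open>Mk k\<close>. If \<open>Mk k\<close> - i D is small on a unit disc,
  so is its derivative at the centre by Cauchy; hence (\<open>Mk k\<close>)' is i D' up to a small
  error, and D' is small against D. The discs cost 1 in the threshold \<open>c\<close> per
  derivative. It matters that \<open>c\<close> is independent of \<open>b\<close>, because the strip
  is later chosen in terms of \<open>c\<close>.\<close>

lemma asymp_fk:
  "e > 0 \<Longrightarrow> \<exists>c. \<forall>b. \<exists>T\<ge>T0. \<forall>z. Re z > T \<and> - b < Im z \<and> Im z < - c \<longrightarrow>
     fk k z \<noteq> 0 \<and> norm (Mk k z - \<i> * D z) \<le> e"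
proof (induction k arbitrary: e)
  case 0
  then show ?case using asymp by (simp add: fk_def Mk_def)
next
  case (Suc k)
  define e1 where "e1 = min (m / 2) (min (e / 4) (e * m / 8))"
  have e1: "e1 > 0" "e1 \<le> m / 2" "e1 \<le> e / 4" "e1 \<le> e * m / 8"
    using Suc.prems m by (auto simp: e1_def)
  obtain c where c: "\<And>b. \<exists>T\<ge>T0. \<forall>z. Re z > T \<and> - b < Im z \<and> Im z < - c \<longrightarrow>
     fk k z \<noteq> 0 \<and> norm (Mk k z - \<i> * D z) \<le> e1"
    using Suc.IH[OF e1(1)] by blast
  show ?case
  proof (rule exI[of _ "c + 1"], rule allI)
    fix b
    obtain T1 where T1: "T1 \<ge> T0" "\<And>z. Re z > T1 \<Longrightarrow> - (b + 1) < Im z \<Longrightarrow> Im z < - c \<Longrightarrow>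
       fk k z \<noteq> 0 \<and> norm (Mk k z - \<i> * D z) \<le> e1"
      using c[of "b + 1"] by blast
    define B where "B = \<bar>b\<bar> + \<bar>c\<bar> + 2"
    obtain T2 where T2: "\<And>z. Re z > T2 \<Longrightarrow> \<bar>Im z\<bar> < B \<Longrightarrow> Re (D z) \<ge> m"
      using D_ge[of B] by blast
    obtain T3 where T3: "\<And>z. Re z > T3 \<Longrightarrow> \<bar>Im z\<bar> < B \<Longrightarrow> norm (deriv D z) \<le> e / 8 * norm (D z)"
      using D_deriv[of "e / 8" B] Suc.prems by auto
    show "\<exists>T\<ge>T0. \<forall>z. Re z > T \<and> - b < Im z \<and> Im z < - (c + 1) \<longrightarrow>
     fk (Suc k) z \<noteq> 0 \<and> norm (Mk (Suc k) z - \<i> * D z) \<le> e"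
    proof (intro exI[of _ "max T1 (max T2 T3) + 1"] conjI allI impI)
      fix z assume "max T1 (max T2 T3) + 1 < Re z \<and> - b < Im z \<and> Im z < - (c + 1)"
      then have z: "T1 + 1 < Re z" "T2 < Re z" "T3 < Re z" "- b < Im z" "Im z < - (c + 1)"
        by linarith+
      define E where "E = (\<lambda>z. Mk k z - \<i> * D z)"
      have near: "Re w > T0 \<and> fk k w \<noteq> 0 \<and> norm (E w) \<le> e1" if "norm (z - w) \<le> 1" for w
      proof -
        have "T1 < Re w" "- (b + 1) < Im w" "Im w < - c"
          using near_point[OF that] z by linarith+
        then show ?thesis
          using T1 unfolding E_def by auto
      qed
      have fkz: "Re z > T0" "fk k z \<noteq> 0" "norm (E z) \<le> e1"
        using near[of z] by auto
      have B: "\<bar>Im z\<bar> < B"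
        unfolding B_def using z by linarith
      then have "m \<le> norm (D z)"
        using T2[of z] z complex_Re_le_cmod[of "D z"] by simp
      have Dz: "norm (deriv D z) \<le> e / 8 * norm (D z)"
        using T3[of z] z B by simp
      have hE: "E holomorphic_on {w \<in> H. fk k w \<noteq> 0}"
        unfolding E_def Mk_def
        by (intro holomorphic_intros holomorphic_on_subset[OF hol_fk] holomorphic_on_subset[OF holD]) auto
      have "norm ((deriv ^^ 1) E z) \<le> fact 1 * e1 / 1 ^ 1"
      proof (rule Cauchy_inequality)
        have sub: "cball z 1 \<subseteq> {w \<in> H. fk k w \<noteq> 0}"
          using near by (auto simp: dist_norm)
        show "E holomorphic_on ball z 1"
          using holomorphic_on_subset[OF hE] sub ball_subset_cball by blast
        show "continuous_on (cball z 1) E"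
          using holomorphic_on_imp_continuous_on holomorphic_on_subset[OF hE] sub by blast
      qed (use near in auto)
      then have dE: "norm (deriv E z) \<le> e1" by simp
      define M' where "M' = (fk (Suc (Suc k)) z * fk k z - fk (Suc k) z * fk (Suc k) z) / (fk k z * fk k z)"
      have "(E has_field_derivative M' - \<i> * deriv D z) (at z)"
        unfolding E_def M'_def
        by (intro DERIV_diff DERIV_cmult Mk_deriv fkz holomorphic_derivI[OF holD openH]) (use fkz in simp)
      then have "deriv E z = M' - \<i> * deriv D z"
        by (rule DERIV_imp_deriv)
      then have "norm M' \<le> e1 + norm (deriv D z)"
        using dE norm_triangle_ineq[of "deriv E z" "\<i> * deriv D z"] by (simp add: norm_mult)
      then have M'_le: "norm M' \<le> e1 + e / 8 * norm (D z)"
        using Dz by simp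
      have "norm (D z) \<le> norm (Mk k z) + norm (E z)"
        using norm_triangle_ineq4[of "Mk k z" "E z"] by (simp add: E_def norm_mult)
      then have M_ge: "norm (Mk k z) \<ge> norm (D z) / 2"
        using fkz(3) e1(2) \<open>m \<le> norm (D z)\<close> by linarith
      then have Mpos: "norm (Mk k z) > 0"
        using \<open>m \<le> norm (D z)\<close> m by linarith
      then show nz': "fk (Suc k) z \<noteq> 0"
        by (auto simp: Mk_def)
      have "Mk (Suc k) z = Mk k z + M' / Mk k z"
        unfolding M'_def Mk_def using nz' fkz(2) by (simp add: field_simps)
      then have "Mk (Suc k) z - \<i> * D z = E z + M' / Mk k z"
        by (simp add: E_def)
      then have "norm (Mk (Suc k) z - \<i> * D z) \<le> norm (E z) + norm M' / norm (Mk k z)"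
        using norm_triangle_ineq[of "E z" "M' / Mk k z"] by (simp add: norm_divide)
      also have "\<dots> \<le> e / 4 + e / 2"
      proof (rule add_mono)
        show "norm (E z) \<le> e / 4" using fkz e1 by linarith
        have "e * m \<le> e * norm (D z)"
          using \<open>m \<le> norm (D z)\<close> Suc.prems by simp
        then have "norm M' \<le> e / 4 * norm (D z)"
          using M'_le e1(4) by (simp add: field_simps)
        also have "\<dots> = e / 2 * (norm (D z) / 2)"
          by simp
        also have "\<dots> \<le> e / 2 * norm (Mk k z)"
          using M_ge Suc.prems by (intro mult_left_mono) auto
        finally show "norm M' / norm (Mk k z) \<le> e / 2"
          using Mpos by (simp add: pos_divide_le_eq)
      qed
      also have "\<dots> \<le> e" using Suc.prems by simp
      finally show "norm (Mk (Suc k) z - \<i> * D z) \<le> e" .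
    qed (use T1 in auto)
  qed
qed

text \<open>Reduces to \<open>strip_function\<close>. At the mirror image of the upper edge
  \<open>Mk k\<close> is i D up to m/2, with Re D >= m; conjugation flips the sign of the imaginary
  part and gives Im (\<open>Mk k\<close>) <= - m/2 above. The height \<open>C\<close> exceeds both
  \<open>b\<close> and \<open>c\<close>, so that the window around it is mirrored into the range of
  \<open>asymp_fk\<close>.\<close>

lemma Mk_negative:
  assumes nzk: "\<And>b. \<exists>T\<ge>T0. \<forall>z. Re z > T \<and> Im z \<noteq> 0 \<and> \<bar>Im z\<bar> < b \<longrightarrow> fk k z \<noteq> 0"
  shows "\<exists>\<epsilon>>0. \<exists>T\<ge>T0. \<forall>z. Re z > T \<and> 0 < Im z \<and> Im z \<le> b \<longrightarrow> Im (Mk k z) \<le> - \<epsilon> * Im z"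
proof -
  obtain c where c: "\<And>b. \<exists>T\<ge>T0. \<forall>z. Re z > T \<and> - b < Im z \<and> Im z < - c \<longrightarrow>
     fk k z \<noteq> 0 \<and> norm (Mk k z - \<i> * D z) \<le> m / 2"
    using asymp_fk[of "m / 2" k] m by auto
  define C where "C = max (max c b) 0 + 2"
  obtain T1 where T1: "T1 \<ge> T0" "\<And>z. Re z > T1 \<Longrightarrow> - (C + 2) < Im z \<Longrightarrow> Im z < - c \<Longrightarrow>
     norm (Mk k z - \<i> * D z) \<le> m / 2"
    using c[of "C + 2"] by blast
  obtain T2 where T2: "\<And>z. Re z > T2 \<Longrightarrow> \<bar>Im z\<bar> < C + 2 \<Longrightarrow> Re (D z) \<ge> m"
    using D_ge[of "C + 2"] by blast
  obtain K T3 where T3: "\<And>z. Re z > T3 \<Longrightarrow> \<bar>Im z\<bar> < C + 2 \<Longrightarrow> norm (D z) \<le> K * Re z"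
    using D_le[of "C + 2"] by blast
  obtain n T4 where T4: "\<And>z. Re z > T4 \<Longrightarrow> \<bar>Im z\<bar> < C + 2 \<Longrightarrow> norm (fk k z) \<le> exp (Re z ^ n)"
    using growth_fk[of "C + 2" k] by blast
  obtain T5 where T5: "\<And>z. Re z > T5 \<Longrightarrow> Im z \<noteq> 0 \<Longrightarrow> \<bar>Im z\<bar> < C + 2 \<Longrightarrow> fk k z \<noteq> 0"
    using nzk[of "C + 2"] by blast
  define T where "T = max T0 (max T1 (max T2 (max T3 (max T4 (max T5 1)))))"
  have T: "T \<ge> T0" "T \<ge> T1" "T \<ge> T2" "T \<ge> T3" "T \<ge> T4" "T \<ge> T5" "T \<ge> 1"
    unfolding T_def by (simp_all add: le_max_iff_disj)
  have lower: "Im (Mk k z) \<le> - (m / 2) \<and> norm (Mk k z) \<le> (\<bar>K\<bar> + m) * Re z"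
    if z: "Re z > T" "\<bar>Im z - C\<bar> < 1" for z
  proof -
    have Imz: "C - 1 < Im z" "Im z < C + 1" using z by auto
    define E where "E = Mk k (cnj z) - \<i> * D (cnj z)"
    have E: "norm E \<le> m / 2"
      unfolding E_def using Imz z T by (intro T1(2)) (auto simp: C_def)
    have D1: "Re (D (cnj z)) \<ge> m" and D2: "norm (D (cnj z)) \<le> K * Re z"
      using T2[of "cnj z"] T3[of "cnj z"] Imz z T by (auto simp: C_def)
    have M: "Mk k (cnj z) = E + \<i> * D (cnj z)" by (simp add: E_def)
    have M': "Mk k z = cnj (Mk k (cnj z))"
      using cnj_Mk[of z k] z T by simp
    have "Im (Mk k z) = - Im E - Re (D (cnj z))"
      unfolding M' M by simp
    then have 1: "Im (Mk k z) \<le> - (m / 2)"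
      using D1 E abs_Im_le_cmod[of E] by linarith
    have "norm (Mk k z) \<le> norm E + norm (D (cnj z))"
      unfolding M' M complex_mod_cnj using norm_triangle_ineq[of E "\<i> * D (cnj z)"]
      by (simp add: norm_mult)
    also have "\<dots> \<le> m * Re z + \<bar>K\<bar> * Re z"
    proof (rule add_mono)
      have "m * 1 \<le> m * Re z" using m z T by (intro mult_left_mono) auto
      then show "norm E \<le> m * Re z" using E m by linarith
      have "K * Re z \<le> \<bar>K\<bar> * Re z" using z T by (intro mult_right_mono) auto
      then show "norm (D (cnj z)) \<le> \<bar>K\<bar> * Re z" using D2 by linarith
    qed
    finally show ?thesis using 1 by (simp add: algebra_simps)
  qed
  interpret S: strip_function "fk k" T C 1 "m / 2" "\<bar>K\<bar> + m" n
  proof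
    show "fk k holomorphic_on {z. Re z > T}"
      using T by (intro holomorphic_on_subset[OF hol_fk]) auto
    show "fk k (of_real x) \<in> \<real>" if "x > T" for x
      using real_fk T that by simp
    show "norm (fk k z) \<le> exp (Re z ^ n)" if "Re z > T" "\<bar>Im z\<bar> < C + 1" for z
      using T4[of z] T that by simp
    show "fk k z \<noteq> 0" if "Re z > T" "Im z \<noteq> 0" "\<bar>Im z\<bar> < C + 1" for z
      using T5[of z] T that by simp
    show "Im (deriv (fk k) z / fk k z) \<le> - (m / 2)"
      "norm (deriv (fk k) z / fk k z) \<le> (\<bar>K\<bar> + m) * Re z"
      if "Re z > T" "\<bar>Im z - C\<bar> < 1" for z
      using lower[OF that] by (simp_all add: Mk_def fk_Suc)
  qed (use T m in \<open>simp_all add: C_def\<close>)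
  show ?thesis
  proof -
    obtain \<epsilon> T' where *: "\<epsilon> > 0" "T' \<ge> T"
      "\<And>z. Re z > T' \<Longrightarrow> 0 < Im z \<Longrightarrow> Im z \<le> C \<Longrightarrow> Im (Mk k z) \<le> - \<epsilon> * Im z"
      using S.logderiv_negative unfolding Mk_def fk_Suc by blast
    have "b \<le> C" by (auto simp: C_def)
    then have "\<forall>z. Re z > T' \<and> 0 < Im z \<and> Im z \<le> b \<longrightarrow> Im (Mk k z) \<le> - \<epsilon> * Im z"
      using * by auto
    then show ?thesis
      using *(1,2) T(1) by (meson order_trans)
  qed
qed

text \<open>The assumption \<open>nz\<close>, which carries RH, is passed on to the derivatives: the
  strict sign of Im (\<open>Mk k\<close>) excludes zeros of \<open>fk (Suc k)\<close> above the
  axis, and reflection excludes them below. \<open>T\<close> may grow with \<open>k\<close> and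
  \<open>b\<close>.\<close>

lemma fk_nonzero:
  "\<exists>T\<ge>T0. \<forall>z. Re z > T \<and> Im z \<noteq> 0 \<and> \<bar>Im z\<bar> < b \<longrightarrow> fk k z \<noteq> 0"
proof (induction k arbitrary: b)
  case 0
  then show ?case using nz by (auto simp: fk_def intro!: exI[of _ T0])
next
  case (Suc k)
  obtain \<epsilon> T where "\<epsilon> > 0" "T \<ge> T0"
    and neg: "\<And>z. Re z > T \<Longrightarrow> 0 < Im z \<Longrightarrow> Im z \<le> b \<Longrightarrow> Im (Mk k z) \<le> - \<epsilon> * Im z"
    using Mk_negative[OF Suc.IH] by blast
  have up: "fk (Suc k) z \<noteq> 0" if "Re z > T" "0 < Im z" "Im z < b" for z
  proof -
    have "\<epsilon> * Im z > 0" using that \<open>\<epsilon> > 0\<close> by simp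
    then have "Im (Mk k z) < 0" using neg[of z] that by linarith
    then show ?thesis by (auto simp: Mk_def)
  qed
  show ?case
  proof (intro exI[of _ T] conjI allI impI)
    fix z assume z: "Re z > T \<and> Im z \<noteq> 0 \<and> \<bar>Im z\<bar> < b"
    show "fk (Suc k) z \<noteq> 0"
    proof (cases "Im z > 0")
      case False
      then have "fk (Suc k) (cnj z) \<noteq> 0"
        using z by (intro up) auto
      then show ?thesis
        using cnj_fk[of z] z \<open>T \<ge> T0\<close> by auto
    qed (use z up in auto)
  qed (rule \<open>T \<ge> T0\<close>)
qed

text \<open>By Cauchy-Riemann the derivative along the axis is the vertical derivative of Im
  (\<open>Mk k\<close>). That function vanishes on the axis and is at most -
  \<open>\<epsilon>\<close> Im z above it.\<close>

lemma Mk_real_deriv_negative: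
  "\<exists>T\<ge>T0. \<forall>x>T. fk k (of_real x) \<noteq> 0 \<longrightarrow>
     (\<exists>d<0. ((\<lambda>t. Re (Mk k (of_real t))) has_real_derivative d) (at x))"
proof -
  have "\<exists>\<epsilon>>0. \<exists>T\<ge>T0. \<forall>z. Re z > T \<and> 0 < Im z \<and> Im z \<le> 1 \<longrightarrow>
      Im (Mk k z) \<le> - \<epsilon> * Im z"
    by (rule Mk_negative[OF fk_nonzero])
  then obtain \<epsilon> T where "\<epsilon> > 0" "T \<ge> T0"
    and neg: "\<And>z. Re z > T \<Longrightarrow> 0 < Im z \<Longrightarrow> Im z \<le> 1 \<Longrightarrow> Im (Mk k z) \<le> - \<epsilon> * Im z"
    by blast
  have "\<exists>d<0. ((\<lambda>t. Re (Mk k (of_real t))) has_real_derivative d) (at x)"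
    if x: "x > T" "fk k (of_real x) \<noteq> 0" for x
  proof -
    obtain M' where M': "(Mk k has_field_derivative M') (at (of_real x))"
      using Mk_deriv[of "of_real x" k] x \<open>T \<ge> T0\<close> by auto
    have "(complex_of_real has_vector_derivative 1) (at x)"
      by (auto intro!: derivative_eq_intros)
    from field_vector_diff_chain_at[OF this M']
    have re: "((\<lambda>t. Re (Mk k (of_real t))) has_real_derivative Re M') (at x)"
      by (auto simp: has_vector_derivative_complex_iff o_def)
    have eq: "Complex x 0 = of_real x"
      by (simp add: complex_eq_iff)
    have "(Complex x has_vector_derivative \<i>) (at 0)"
      unfolding Complex_eq by (auto intro!: derivative_eq_intros)
    from field_vector_diff_chain_at[OF this M'[folded eq]]
    have im: "((\<lambda>w. Im (Mk k (Complex x w))) has_real_derivative Re M') (at 0)"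
      by (auto simp: has_vector_derivative_complex_iff o_def)
    have "Mk k (of_real x) \<in> \<real>"
      unfolding Mk_def using x \<open>T \<ge> T0\<close> by (intro Reals_divide real_fk) auto
    then have "Im (Mk k (Complex x 0)) = 0"
      unfolding eq by (simp add: complex_is_Real_iff)
    with im have "((\<lambda>h. Im (Mk k (Complex x h)) / h) \<longlongrightarrow> Re M') (at 0)"
      by (simp add: DERIV_def)
    then have lim: "((\<lambda>h. Im (Mk k (Complex x h)) / h) \<longlongrightarrow> Re M') (at_right 0)"
      by (rule filterlim_mono) (auto simp: at_le)
    have "\<forall>\<^sub>F h in at_right 0. h \<in> {0<..<1::real}"
      by (intro eventually_at_right_real) auto
    then have "\<forall>\<^sub>F h in at_right 0. Im (Mk k (Complex x h)) / h \<le> - \<epsilon>"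
    proof eventually_elim
      case (elim h)
      then show ?case
        using neg[of "Complex x h"] x by (simp add: pos_divide_le_eq)
    qed
    then have "Re M' \<le> - \<epsilon>"
      using tendsto_upperbound[OF lim] by (simp add: trivial_limit_at_right_real)
    then show ?thesis
      using re \<open>\<epsilon> > 0\<close> by (intro exI[of _ "Re M'"]) auto
  qed
  then show ?thesis
    using \<open>T \<ge> T0\<close> by blast
qed

theorem unique_zero_of_derivative:
  "\<exists>T>T0. \<forall>\<gamma> \<gamma>'. T \<le> \<gamma> \<and> \<gamma> < \<gamma>' \<and> Re (fk k (of_real \<gamma>)) = 0 \<and> Re (fk k (of_real \<gamma>')) = 0 \<and>
      (\<forall>t. \<gamma> < t \<and> t < \<gamma>' \<longrightarrow> Re (fk k (of_real t)) \<noteq> 0) \<longrightarrow>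
      (\<exists>!t. \<gamma> < t \<and> t < \<gamma>' \<and> Re (fk (Suc k) (of_real t)) = 0)"
proof -
  obtain T where "T \<ge> T0" and T: "\<And>x. x > T \<Longrightarrow> fk k (of_real x) \<noteq> 0 \<Longrightarrow>
      \<exists>d<0. ((\<lambda>t. Re (Mk k (of_real t))) has_real_derivative d) (at x)"
    using Mk_real_deriv_negative[of k] by blast
  show ?thesis
  proof (intro exI[of _ "T + 1"] conjI allI impI)
    fix \<gamma> \<gamma>' assume a: "T + 1 \<le> \<gamma> \<and> \<gamma> < \<gamma>' \<and> Re (fk k (of_real \<gamma>)) = 0 \<and> Re (fk k (of_real \<gamma>')) = 0 \<and>
      (\<forall>t. \<gamma> < t \<and> t < \<gamma>' \<longrightarrow> Re (fk k (of_real t)) \<noteq> 0)"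
    define u where "u = (\<lambda>t. Re (fk k (of_real t)))"
    define v where "v = (\<lambda>t. Re (fk (Suc k) (of_real t)))"
    have du: "(u has_real_derivative v t) (at t)" if "t \<ge> \<gamma>" for t
      unfolding u_def v_def fk_Suc using that a \<open>T \<ge> T0\<close>
      by (intro deriv_real_on_reals(1)[OF hol_fk real_fk]) auto
    have "\<exists>t. \<gamma> < t \<and> t < \<gamma>' \<and> v t = 0"
    proof -
      have "\<exists>z. \<gamma> < z \<and> z < \<gamma>' \<and> (u has_real_derivative 0) (at z)"
      proof (rule Rolle)
        show "continuous_on {\<gamma>..\<gamma>'} u"
          using du by (intro continuous_at_imp_continuous_on ballI DERIV_isCont) auto
        show "u differentiable (at x)" if "\<gamma> < x" "x < \<gamma>'" for x
          using du[of x] that by (auto simp: real_differentiable_def)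
      qed (use a in \<open>auto simp: u_def\<close>)
      then show ?thesis
        using du DERIV_unique by (metis less_imp_le)
    qed
    moreover have "False" if t: "\<gamma> < s" "s < t" "t < \<gamma>'" "v s = 0" "v t = 0" for s t
    proof -
      have q0: "Re (Mk k (of_real t)) = 0" if "v t = 0" "t > \<gamma>" for t
      proof -
        have "fk (Suc k) (of_real t) \<in> \<real>"
          using that a \<open>T \<ge> T0\<close> by (intro real_fk) auto
        then have "fk (Suc k) (of_real t) = 0"
          using that by (simp add: v_def complex_is_Real_iff complex_eq_iff)
        then show ?thesis by (simp add: Mk_def)
      qed
      have "Re (Mk k (of_real s)) > Re (Mk k (of_real t))"
      proof (rule DERIV_neg_imp_decreasing[OF t(2)])
        fix x assume "s \<le> x" "x \<le> t"
        then have "Re (fk k (of_real x)) \<noteq> 0" "x > T"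
          using a t by auto
        then show "\<exists>d. ((\<lambda>t. Re (Mk k (of_real t))) has_real_derivative d) (at x) \<and> d < 0"
          using T[of x] by fastforce
      qed
      then show False
        using q0[of s] q0[of t] t by simp
    qed
    then have "\<And>s t. \<gamma> < s \<and> s < \<gamma>' \<and> v s = 0 \<Longrightarrow> \<gamma> < t \<and> t < \<gamma>' \<and> v t = 0 \<Longrightarrow> s = t"
      by (metis linorder_neqE_linordered_idom)
    ultimately show "\<exists>!t. \<gamma> < t \<and> t < \<gamma>' \<and> Re (fk (Suc k) (of_real t)) = 0"
      unfolding v_def by blast
  qed (use \<open>T \<ge> T0\<close> in auto)
qed

end

subsection \<open>The gamma factors\<close>

text \<open>A filter for Re z tending to infinity at bounded height, so that thresholds of several
  estimates merge by \<open>eventually_elim\<close>.\<close>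

definition strip_at_top :: "real \<Rightarrow> complex filter" where
  "strip_at_top b = inf (filtercomap Re at_top) (principal {z. \<bar>Im z\<bar> < b})"

lemma eventually_strip_at_top:
  "eventually P (strip_at_top b) \<longleftrightarrow> (\<exists>T. \<forall>z. Re z > T \<and> \<bar>Im z\<bar> < b \<longrightarrow> P z)"
  unfolding strip_at_top_def eventually_inf_principal
  by (auto simp: eventually_filtercomap eventually_at_top_dense)

text \<open>The series of 1/(w + k)^2 is compared with that of 1/(k + 1)^2. With v = Re w + k one
  has |w + k|^2 >= 1 + v^2, while k + 1 is at most a + 2 if |v| <= 1 and at most (a + 2)|v|
  otherwise. Re w may be negative, as it is in wide strips.\<close>

lemma norm_Polygamma_1_le:
  fixes w :: complex
  assumes "\<bar>Re w\<bar> \<le> a" "\<bar>Im w\<bar> \<ge> 1"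
  shows "norm (Polygamma 1 w) \<le> (a + 2)\<^sup>2 * (\<Sum>n. inverse (real (Suc n) ^ 2))"
proof -
  have w: "w \<noteq> 0" using assms by auto
  have sums: "(\<lambda>k. inverse ((w + of_nat k)^2)) sums Polygamma 1 w"
    using Polygamma_LIMSEQ[OF w, of 1] by (simp add: numeral_2_eq_2)
  have smb: "summable (\<lambda>n. inverse (real (Suc n) ^ 2))"
    using inverse_power_summable[of 2, where 'a = real] by (subst summable_Suc_iff) auto
  have le: "norm (inverse ((w + of_nat k)^2)) \<le> (a + 2)\<^sup>2 * inverse (real (Suc k) ^ 2)" for k
  proof -
    define v where "v = Re w + real k"
    have "(real (Suc k))\<^sup>2 \<le> (a + 2)\<^sup>2 * (1 + v\<^sup>2)"
    proof (cases "\<bar>v\<bar> \<le> 1")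
      case True
      then have "real (Suc k) \<le> a + 2"
        using assms(1) by (auto simp: v_def abs_le_iff)
      then have "(real (Suc k))\<^sup>2 \<le> (a + 2)\<^sup>2 * 1"
        using power_mono[of "real (Suc k)" "a + 2" 2] by simp
      also have "\<dots> \<le> (a + 2)\<^sup>2 * (1 + v\<^sup>2)"
        by (intro mult_left_mono) auto
      finally show ?thesis .
    next
      case False
      have "real (Suc k) \<le> \<bar>v\<bar> + (a + 1) * 1"
        using assms(1) by (auto simp: v_def abs_le_iff)
      also have "\<dots> \<le> \<bar>v\<bar> + (a + 1) * \<bar>v\<bar>"
        using False assms(1) by (intro add_left_mono mult_left_mono) auto
      finally have "real (Suc k) \<le> (a + 2) * \<bar>v\<bar>"
        by (simp add: algebra_simps)
      then have "(real (Suc k))\<^sup>2 \<le> ((a + 2) * \<bar>v\<bar>)\<^sup>2"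
        by (intro power_mono) auto
      also have "\<dots> \<le> (a + 2)\<^sup>2 * (1 + v\<^sup>2)"
        by (simp add: power_mult_distrib mult_left_mono)
      finally show ?thesis .
    qed
    also have "\<dots> \<le> (a + 2)\<^sup>2 * (norm (w + of_nat k))\<^sup>2"
    proof (rule mult_left_mono)
      have "1 \<le> (Im w)\<^sup>2"
        using assms(2) power_mono[of 1 "\<bar>Im w\<bar>" 2] by simp
      then show "1 + v\<^sup>2 \<le> (norm (w + of_nat k))\<^sup>2"
        unfolding cmod_power2 v_def by simp
    qed simp
    finally have *: "(real (Suc k))\<^sup>2 \<le> (a + 2)\<^sup>2 * (norm (w + of_nat k))\<^sup>2" .
    have "w + of_nat k \<noteq> 0"
      using assms(2) by (auto simp: complex_eq_iff)
    then have pos: "(norm (w + of_nat k))\<^sup>2 > 0" by simp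
    have pos': "(real (Suc k))\<^sup>2 > 0" by simp
    have "inverse ((norm (w + of_nat k))\<^sup>2) \<le> (a + 2)\<^sup>2 * inverse ((real (Suc k))\<^sup>2)"
      using * pos pos' by (simp add: divide_simps del: of_nat_Suc)
    then show ?thesis
      by (simp add: norm_inverse norm_power del: of_nat_Suc)
  qed
  have smb': "summable (\<lambda>k. (a + 2)\<^sup>2 * inverse (real (Suc k) ^ 2))"
    by (intro summable_mult smb)
  have "norm (Polygamma 1 w) = norm (\<Sum>k. inverse ((w + of_nat k)^2))"
    using sums by (simp add: sums_iff)
  also have "\<dots> \<le> (\<Sum>k. (a + 2)\<^sup>2 * inverse (real (Suc k) ^ 2))"
    by (rule norm_suminf_le[OF le smb'])
  also have "\<dots> = (a + 2)\<^sup>2 * (\<Sum>n. inverse (real (Suc n) ^ 2))"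
    by (rule suminf_mult[OF smb])
  finally show ?thesis .
qed

text \<open>Comparison with the value at the real point \<open>u\<close>: the difference of the real
  parts is a series of nonnegative terms \<open>t k\<close>, which for fixed k tend to 1/(u + k) as
  |v| grows. The sum of these limits diverges.\<close>

lemma Re_Digamma_ge:
  fixes u B :: real
  assumes "u > 0"
  shows "\<exists>V. \<forall>v. \<bar>v\<bar> \<ge> V \<longrightarrow> Re (Digamma (Complex u v)) \<ge> B"
proof -
  have "(\<lambda>n. ln (real n) - (\<Sum>k<n. inverse (u + real k))) \<longlonglongrightarrow> Digamma u"
    using Digamma_LIMSEQ[of u] assms by simp
  then have "\<forall>\<^sub>F n in sequentially. ln (real n) - (\<Sum>k<n. inverse (u + real k)) < Digamma u + 1"
    by (rule order_tendstoD) simp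
  moreover have "filterlim (\<lambda>n::nat. ln (real n)) at_top at_top"
    by real_asymp
  then have "\<forall>\<^sub>F n in sequentially. ln (real n) \<ge> B + 2"
    by (rule filterlim_at_top[THEN iffD1, rule_format])
  ultimately have "\<forall>\<^sub>F n in sequentially. (\<Sum>k<n. inverse (u + real k)) \<ge> B + 1 - Digamma u"
    by eventually_elim simp
  then obtain N where N: "(\<Sum>k<N. inverse (u + real k)) \<ge> B + 1 - Digamma u"
    by (auto simp: eventually_sequentially)
  show ?thesis
  \<comment> \<open>This threshold makes v^2 >= N (u + N), so the fractions subtracted in the first
    N terms of \<open>t\<close> add up to at most 1.\<close>
  proof (intro exI[of _ "real N * (u + real N) + 1"] allI impI)
    fix v :: real assume v: "real N * (u + real N) + 1 \<le> \<bar>v\<bar>"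
    define z where "z = Complex u v"
    have z: "z \<noteq> 0" using assms by (auto simp: z_def complex_eq_iff)
    have nn: "real N * (u + real N) \<ge> 0" using assms by simp
    have v2: "v\<^sup>2 \<ge> real N * (u + real N)" "v\<^sup>2 > 0"
    proof -
      have "\<bar>v\<bar> * 1 \<le> \<bar>v\<bar> * \<bar>v\<bar>" using v nn by (intro mult_left_mono) linarith+
      then have "\<bar>v\<bar> \<le> v\<^sup>2" by (simp add: power2_eq_square)
      then show "v\<^sup>2 \<ge> real N * (u + real N)" "v\<^sup>2 > 0" using v nn by linarith+
    qed
    define t where "t = (\<lambda>k. inverse (u + real k) - (u + real k) / ((u + real k)\<^sup>2 + v\<^sup>2))"
    have sum1: "(\<lambda>k. inverse (of_nat (Suc k)) - inverse (z + of_nat k)) sums (Digamma z + euler_mascheroni)"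
      using summable_Digamma[OF z] by (simp add: Digamma_def summable_sums)
    have sum2: "(\<lambda>k. inverse (of_nat (Suc k)) - inverse (u + of_nat k)) sums (Digamma u + euler_mascheroni)"
      using summable_Digamma[of u] assms by (simp add: Digamma_def summable_sums)
    have "(\<lambda>k. Re (inverse (of_nat (Suc k)) - inverse (z + of_nat k)) - (inverse (of_nat (Suc k)) - inverse (u + of_nat k)))
       sums (Re (Digamma z + euler_mascheroni) - (Digamma u + euler_mascheroni))"
      by (intro sums_diff sums_Re sum1 sum2)
    moreover have "Re (inverse (of_nat (Suc k)) - inverse (z + of_nat k)) - (inverse (of_nat (Suc k)) - inverse (u + of_nat k)) = t k" for k
    proof -
      have "inverse (of_nat (Suc k)) = complex_of_real (inverse (real (Suc k)))" by simp
      then have "Re (inverse (of_nat (Suc k))) = inverse (real (Suc k))" by (metis Re_complex_of_real)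
      moreover have "Re (inverse (z + of_nat k)) = (u + real k) / ((u + real k)\<^sup>2 + v\<^sup>2)"
        by (simp add: z_def)
      ultimately show ?thesis by (simp add: t_def)
    qed
    moreover have "Re (euler_mascheroni :: complex) = euler_mascheroni"
      by (metis Re_complex_of_real of_real_euler_mascheroni)
    ultimately have "t sums (Re (Digamma z) - Digamma u)"
      by (simp add: sums_iff)
    moreover have "t k \<ge> 0" for k
    proof -
      define a where "a = u + real k"
      have "a > 0" using assms by (simp add: a_def)
      then have "a / (a\<^sup>2 + v\<^sup>2) \<le> a / a\<^sup>2" by (intro divide_left_mono) (auto intro!: mult_pos_pos add_pos_nonneg)
      then show ?thesis
        using \<open>a > 0\<close> unfolding t_def a_def[symmetric] by (simp add: power2_eq_square inverse_eq_divide)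
    qed
    ultimately have "sum t {..<N} \<le> Re (Digamma z) - Digamma u"
      using sum_le_suminf[of t "{..<N}"] by (auto simp: sums_iff)
    moreover have "sum t {..<N} \<ge> (\<Sum>k<N. inverse (u + real k)) - 1"
    proof -
      have "(\<Sum>k<N. (u + real k) / ((u + real k)\<^sup>2 + v\<^sup>2)) \<le> (\<Sum>k<N. (u + real N) / v\<^sup>2)"
        using assms v2(2) by (intro sum_mono frac_le) auto
      also have "\<dots> = real N * (u + real N) / v\<^sup>2" by simp
      also have "\<dots> \<le> 1" using v2 by simp
      finally show ?thesis by (simp add: t_def sum_subtractf)
    qed
    ultimately show "B \<le> Re (Digamma (Complex u v))"
      using N unfolding z_def by linarith
  qed
qed

lemma filterlim_Re_Digamma:
  assumes "u > 0"
  shows "filterlim (\<lambda>v. Re (Digamma (Complex u v))) at_top at_infinity"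
  unfolding filterlim_at_top eventually_at_infinity using Re_Digamma_ge[OF assms] by simp

lemma filterlim_sum_at_top:
  fixes g :: "'a \<Rightarrow> 'b \<Rightarrow> real"
  assumes "finite A" "A \<noteq> {}" "\<And>j. j \<in> A \<Longrightarrow> filterlim (g j) at_top G"
  shows "filterlim (\<lambda>x. \<Sum>j\<in>A. g j x) at_top G"
  using assms by (induction rule: finite_ne_induct) (auto intro!: filterlim_at_top_add_at_top)

text \<open>
  With \<open>s = 1/2 + \<i> * z\<close>, the choices \<open>\<sigma> = 1\<close> and \<open>\<sigma> = -1\<close> give the arguments of the gamma
  factors at \<open>s\<close> and (with \<open>cnj m\<close>) at \<open>1 - s\<close>.
\<close>
lemma gamma_argument_nonreal:
  fixes \<sigma> l x :: real and m z :: complex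
  assumes "l > 0" "\<sigma> = 1 \<or> \<sigma> = -1" "Re z > \<bar>Im m\<bar> / l"
  shows "of_real l * (1/2 + of_real \<sigma> * \<i> * z) + m \<notin> \<real>\<^sub>\<le>\<^sub>0"
proof -
  have "\<bar>Im m\<bar> < l * Re z"
    using assms(1,3) by (simp add: pos_divide_less_eq mult.commute)
  then have "Im (of_real l * (1/2 + of_real \<sigma> * \<i> * z) + m) \<noteq> 0"
    using assms(2) by auto
  then show ?thesis
    by (simp add: complex_nonpos_Reals_iff)
qed

lemma Digamma_vertical:
  fixes \<sigma> l :: real and m :: complex
  assumes "l > 0" "Re m \<ge> 0" "\<sigma> = 1 \<or> \<sigma> = -1"
  shows "filterlim (\<lambda>x. Re (Digamma (of_real l * (1/2 + of_real \<sigma> * \<i> * of_real x) + m))) at_top at_top"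
proof -
  have eq: "of_real l * (1/2 + of_real \<sigma> * \<i> * of_real x) + m = Complex (l / 2 + Re m) (\<sigma> * l * x + Im m)" for x
    by (simp add: complex_eq_iff)
  have "filterlim (\<lambda>x. \<sigma> * l * x + Im m) at_infinity at_top"
    using assms(3)
  proof
    assume "\<sigma> = 1"
    then have "filterlim (\<lambda>x. \<sigma> * l * x + Im m) at_top at_top" using \<open>l > 0\<close> by simp real_asymp
    then show ?thesis by (rule filterlim_at_top_imp_at_infinity)
  next
    assume "\<sigma> = -1"
    then have "filterlim (\<lambda>x. \<sigma> * l * x + Im m) at_bot at_top" using \<open>l > 0\<close> by simp real_asymp
    then show ?thesis by (rule filterlim_mono) (auto simp: at_bot_le_at_infinity)
  qed
  from filterlim_compose[OF filterlim_Re_Digamma this] show ?thesis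
    unfolding eq using assms(1,2) by (simp add: add_pos_nonneg)
qed

lemma Polygamma_1_strip_bounded:
  fixes \<sigma> l :: real and m :: complex
  assumes "l > 0" "\<sigma> = 1 \<or> \<sigma> = -1"
  shows "\<exists>B. \<forall>\<^sub>F z in strip_at_top b. norm (Polygamma 1 (of_real l * (1/2 + of_real \<sigma> * \<i> * z) + m)) \<le> B"
proof -
  define a where "a = l * (1/2 + b) + norm m"
  have "norm (Polygamma 1 (of_real l * (1/2 + of_real \<sigma> * \<i> * z) + m)) \<le>
      (a + 2)\<^sup>2 * (\<Sum>n. inverse (real (Suc n) ^ 2))"
    if z: "Re z > (1 + \<bar>Im m\<bar>) / l" "\<bar>Im z\<bar> < b" for z
  proof (rule norm_Polygamma_1_le)
    have "\<bar>Re (of_real l * (1/2 + of_real \<sigma> * \<i> * z) + m)\<bar> = \<bar>l * (1/2 - \<sigma> * Im z) + Re m\<bar>"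
      by simp
    also have "\<dots> \<le> l * \<bar>1/2 - \<sigma> * Im z\<bar> + \<bar>Re m\<bar>"
      using abs_triangle_ineq[of "l * (1/2 - \<sigma> * Im z)" "Re m"] \<open>l > 0\<close> by (simp add: abs_mult)
    also have "\<dots> \<le> a"
      unfolding a_def using \<open>l > 0\<close> z(2) assms(2) abs_Re_le_cmod[of m]
      by (intro add_mono mult_left_mono) auto
    finally show "\<bar>Re (of_real l * (1/2 + of_real \<sigma> * \<i> * z) + m)\<bar> \<le> a" .
    have "1 + \<bar>Im m\<bar> < l * Re z"
      using \<open>l > 0\<close> z(1) by (simp add: pos_divide_less_eq mult.commute)
    then show "1 \<le> \<bar>Im (of_real l * (1/2 + of_real \<sigma> * \<i> * z) + m)\<bar>"
      using assms(2) by auto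
  qed
  then show ?thesis
    unfolding eventually_strip_at_top by blast
qed

lemma eventually_bounded_sum:
  assumes "finite A" "\<And>j. j \<in> A \<Longrightarrow> \<exists>B. \<forall>\<^sub>F z in G. norm (g j z) \<le> (B::real)"
  shows "\<exists>B. \<forall>\<^sub>F z in G. norm (\<Sum>j\<in>A. g j z) \<le> B"
proof -
  obtain B where B: "\<And>j. j \<in> A \<Longrightarrow> \<forall>\<^sub>F z in G. norm (g j z) \<le> B j"
    using assms(2) by metis
  have "\<forall>\<^sub>F z in G. \<forall>j\<in>A. norm (g j z) \<le> B j"
    using assms(1) B by (simp add: eventually_ball_finite)
  then have "\<forall>\<^sub>F z in G. norm (\<Sum>j\<in>A. g j z) \<le> (\<Sum>j\<in>A. B j)"
    by eventually_elim (auto intro!: sum_norm_le)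
  then show ?thesis by blast
qed

lemma linear_growth_of_bounded_deriv:
  assumes hol: "D holomorphic_on {z. Re z > T0}"
    and bd: "\<exists>B. \<forall>\<^sub>F z in strip_at_top b. norm (deriv D z) \<le> B"
  shows "\<exists>B X. X \<ge> T0 \<and> (\<forall>z w. Re z > X \<and> \<bar>Im z\<bar> < b \<and> Re w > X \<and> \<bar>Im w\<bar> < b \<longrightarrow>
           norm (D z - D w) \<le> B * norm (z - w))"
proof -
  obtain B X where BX: "\<And>z. Re z > X \<Longrightarrow> \<bar>Im z\<bar> < b \<Longrightarrow> norm (deriv D z) \<le> B"
    using bd unfolding eventually_strip_at_top by blast
  define S where "S = {z. Re z > max X T0 \<and> \<bar>Im z\<bar> < b}"
  have "S = {z. Re z > max X T0} \<inter> ({z. Im z < b} \<inter> {z. Im z > - b})"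
    by (auto simp: S_def)
  then have "convex S"
    by (simp only: convex_Int convex_halfspace_Re_gt convex_halfspace_Im_lt convex_halfspace_Im_gt)
  have "norm (D z - D w) \<le> B * norm (z - w)" if "z \<in> S" "w \<in> S" for z w
  proof (rule field_differentiable_bound[OF \<open>convex S\<close>, of D "deriv D"])
    show "(D has_field_derivative deriv D x) (at x within S)" if "x \<in> S" for x
      using that holomorphic_derivI[OF hol open_halfspace_Re_gt] by (auto simp: S_def)
    show "norm (deriv D x) \<le> B" if "x \<in> S" for x
      using that BX by (auto simp: S_def)
  qed (use that in auto)
  then show ?thesis
    by (intro exI[of _ B] exI[of _ "max X T0"]) (auto simp: S_def)
qed

text \<open>A vertical displacement changes \<open>D\<close> by a bounded amount only, so divergence
  of Re D on the axis spreads over the strip. The same bound makes \<open>D\<close> at most linear,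
  and a bounded derivative is small against a function tending to infinity.\<close>

lemma strip_bounds_of_bounded_deriv:
  assumes hol: "D holomorphic_on {z. Re z > T0}"
    and bd: "\<And>b. \<exists>B. \<forall>\<^sub>F z in strip_at_top b. norm (deriv D z) \<le> B"
    and lim: "filterlim (\<lambda>x. Re (D (of_real x))) at_top at_top"
  shows "\<exists>T. \<forall>z. Re z > T \<and> \<bar>Im z\<bar> < b \<longrightarrow> Re (D z) \<ge> A"
    and "\<exists>K T. \<forall>z. Re z > T \<and> \<bar>Im z\<bar> < b \<longrightarrow> norm (D z) \<le> K * Re z"
    and "e > 0 \<Longrightarrow> \<exists>T. \<forall>z. Re z > T \<and> \<bar>Im z\<bar> < b \<longrightarrow> norm (deriv D z) \<le> e * norm (D z)"
proof -
  obtain B X where "X \<ge> T0" and BX: "\<And>z w. Re z > X \<Longrightarrow> \<bar>Im z\<bar> < b \<Longrightarrow> Re w > X \<Longrightarrow> \<bar>Im w\<bar> < b \<Longrightarrow>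
           norm (D z - D w) \<le> B * norm (z - w)"
    using linear_growth_of_bounded_deriv[OF hol bd] by metis
  have large: "\<exists>T. \<forall>z. Re z > T \<and> \<bar>Im z\<bar> < b \<longrightarrow> Re (D z) \<ge> A" for A
  proof -
    have "\<forall>\<^sub>F x in at_top. Re (D (of_real x)) \<ge> A + \<bar>B\<bar> * \<bar>b\<bar>"
      using lim by (rule filterlim_at_top[THEN iffD1, rule_format])
    then obtain Y where Y: "\<And>x. x \<ge> Y \<Longrightarrow> Re (D (of_real x)) \<ge> A + \<bar>B\<bar> * \<bar>b\<bar>"
      by (auto simp: eventually_at_top_linorder)
    show ?thesis
    proof (intro exI[of _ "max X Y"] allI impI)
      fix z assume z: "max X Y < Re z \<and> \<bar>Im z\<bar> < b"
      have eq: "z - of_real (Re z) = \<i> * of_real (Im z)"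
        by (simp add: complex_eq_iff)
      have "norm (D z - D (of_real (Re z))) \<le> B * norm (z - of_real (Re z))"
        using z by (intro BX) auto
      also have "\<dots> = B * \<bar>Im z\<bar>"
        unfolding eq by (simp add: norm_mult)
      also have "\<dots> \<le> \<bar>B\<bar> * \<bar>b\<bar>"
        using z by (intro mult_mono) auto
      finally have "Re (D (of_real (Re z))) - Re (D z) \<le> \<bar>B\<bar> * \<bar>b\<bar>"
        using abs_Re_le_cmod[of "D z - D (of_real (Re z))"] by simp
      then show "Re (D z) \<ge> A"
        using Y[of "Re z"] z by simp
    qed
  qed
  then show "\<exists>T. \<forall>z. Re z > T \<and> \<bar>Im z\<bar> < b \<longrightarrow> Re (D z) \<ge> A" .
  show "\<exists>K T. \<forall>z. Re z > T \<and> \<bar>Im z\<bar> < b \<longrightarrow> norm (D z) \<le> K * Re z"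
  proof -
    define w :: complex where "w = of_real (X + 1)"
    show ?thesis
    proof (rule exI[of _ "norm (D w) + \<bar>B\<bar> * (1 + \<bar>b\<bar> + norm w)"], rule exI[of _ "max X 1"],
        intro allI impI)
      fix z assume z: "max X 1 < Re z \<and> \<bar>Im z\<bar> < b"
      have "norm z \<le> Re z + \<bar>b\<bar>"
        using cmod_le[of z] z by auto
      then have "norm (z - w) \<le> Re z + \<bar>b\<bar> * 1 + norm w * 1"
        using norm_triangle_ineq4[of z w] by simp
      also have "\<dots> \<le> Re z + \<bar>b\<bar> * Re z + norm w * Re z"
        using z by (intro add_mono mult_left_mono) auto
      finally have zw: "norm (z - w) \<le> (1 + \<bar>b\<bar> + norm w) * Re z"
        by (simp add: algebra_simps)
      have "norm (D z - D w) \<le> B * norm (z - w)"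
        using z by (intro BX) (auto simp: w_def)
      also have "\<dots> \<le> \<bar>B\<bar> * norm (z - w)"
        by (intro mult_right_mono) auto
      also have "\<dots> \<le> \<bar>B\<bar> * ((1 + \<bar>b\<bar> + norm w) * Re z)"
        by (intro mult_left_mono zw) auto
      finally have "norm (D z) \<le> norm (D w) * 1 + \<bar>B\<bar> * ((1 + \<bar>b\<bar> + norm w) * Re z)"
        using norm_triangle_ineq2[of "D z" "D w"] by simp
      also have "\<dots> \<le> norm (D w) * Re z + \<bar>B\<bar> * ((1 + \<bar>b\<bar> + norm w) * Re z)"
        using z by (intro add_right_mono mult_left_mono) auto
      finally show "norm (D z) \<le> (norm (D w) + \<bar>B\<bar> * (1 + \<bar>b\<bar> + norm w)) * Re z"
        by (simp add: algebra_simps)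
    qed
  qed
  show "\<exists>T. \<forall>z. Re z > T \<and> \<bar>Im z\<bar> < b \<longrightarrow> norm (deriv D z) \<le> e * norm (D z)" if "e > 0"
  proof -
    obtain B' X' where B': "\<And>z. Re z > X' \<Longrightarrow> \<bar>Im z\<bar> < b \<Longrightarrow> norm (deriv D z) \<le> B'"
      using bd[of b] unfolding eventually_strip_at_top by blast
    obtain Y where Y: "\<And>z. Re z > Y \<Longrightarrow> \<bar>Im z\<bar> < b \<Longrightarrow> Re (D z) \<ge> B' / e"
      using large[of "B' / e"] by blast
    show ?thesis
    proof (intro exI[of _ "max X' Y"] allI impI)
      fix z assume z: "max X' Y < Re z \<and> \<bar>Im z\<bar> < b"
      then have "B' / e \<le> norm (D z)"
        using Y[of z] complex_Re_le_cmod[of "D z"] by simp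
      then show "norm (deriv D z) \<le> e * norm (D z)"
        using B'[of z] z that by (simp add: pos_divide_le_eq mult.commute)
    qed
  qed
qed

text \<open>\<open>\<Theta>\<close> is (i/2) L + c for an explicit logarithm L of the functional
  equation factor at 1/2 + i z. The conjugated gamma factors are continued by the arguments
  \<open>q\<close>, which equal \<open>cnj\<close> of \<open>p\<close> at real points. On the real
  axis \<open>\<theta>\<close> - (i/2) L is a multiple of pi and continuous, hence a constant c; so
  every admissible \<open>\<theta>\<close> is covered.\<close>

lemma theta_extension:
  assumes Q: "Q > 0" and \<Lambda>: "\<And>j. j \<in> {1..r} \<Longrightarrow> \<Lambda> j > 0" and \<mu>: "\<And>j. j \<in> {1..r} \<Longrightarrow> Re (\<mu> j) \<ge> 0"
    and \<omega>: "norm \<omega> = 1" and \<theta>: "is_theta_function Q r \<Lambda> \<mu> \<omega> \<theta>"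
  obtains T0 D \<Theta> where "T0 \<ge> 0" "D holomorphic_on {z. Re z > T0}"
    and "\<And>z. Re z > T0 \<Longrightarrow> (\<Theta> has_field_derivative D z) (at z)"
    and "\<And>t. t > T0 \<Longrightarrow> \<Theta> (of_real t) = of_real (\<theta> t)"
    and "\<And>b. \<exists>B. \<forall>\<^sub>F z in strip_at_top b. norm (deriv D z) \<le> B"
    and "r > 0 \<Longrightarrow> filterlim (\<lambda>x. Re (D (of_real x))) at_top at_top"
    and "r = 0 \<Longrightarrow> D = (\<lambda>_. of_real (ln Q))"
    and "\<And>j z. j \<in> {1..r} \<Longrightarrow> Re z > T0 \<Longrightarrow> of_real (\<Lambda> j) * (1/2 + \<i> * z) + \<mu> j \<notin> \<real>\<^sub>\<le>\<^sub>0"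
proof -
  \<comment> \<open>Beyond this sum |Im (\<open>\<mu> j\<close>)| < \<open>\<Lambda> j\<close> Re z
    for every j, so that no argument of a gamma factor meets the cut of
    \<open>ln_Gamma\<close>.\<close>
  define T0 where "T0 = (\<Sum>j\<in>{1..r}. \<bar>Im (\<mu> j)\<bar> / \<Lambda> j)"
  have T0_ge: "\<bar>Im (\<mu> j)\<bar> / \<Lambda> j \<le> T0" if "j \<in> {1..r}" for j
    unfolding T0_def using that \<Lambda> by (intro member_le_sum) (auto simp: less_imp_le)
  have T0: "T0 \<ge> 0"
    unfolding T0_def using \<Lambda> by (intro sum_nonneg) (auto simp: less_imp_le)
  define p q where "p = (\<lambda>j z. of_real (\<Lambda> j) * (1/2 + \<i> * z) + \<mu> j)"
    and "q = (\<lambda>j z. of_real (\<Lambda> j) * (1/2 - \<i> * z) + cnj (\<mu> j))"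
  have p_nonreal: "p j z \<notin> \<real>\<^sub>\<le>\<^sub>0" and q_nonreal: "q j z \<notin> \<real>\<^sub>\<le>\<^sub>0" if "j \<in> {1..r}" "Re z > T0" for j z
    using gamma_argument_nonreal[of "\<Lambda> j" 1 "\<mu> j" z] gamma_argument_nonreal[of "\<Lambda> j" "-1" "cnj (\<mu> j)" z]
      \<Lambda>[OF that(1)] T0_ge[OF that(1)] that(2) by (auto simp: p_def q_def)
  have int: "w \<notin> \<int>\<^sub>\<le>\<^sub>0" if "w \<notin> \<real>\<^sub>\<le>\<^sub>0" for w :: complex
    using that nonpos_Ints_subset_nonpos_Reals by blast
  note p_int = int[OF p_nonreal] and q_int = int[OF q_nonreal]
  define L where "L = (\<lambda>z. Ln \<omega> - 2 * \<i> * of_real (ln Q) * z + (\<Sum>j\<in>{1..r}. ln_Gamma (q j z) - ln_Gamma (p j z)))"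
  \<comment> \<open>This is i/2 times the derivative of \<open>L\<close>.\<close>
  define D where "D = (\<lambda>z. of_real (ln Q) + (\<Sum>j\<in>{1..r}. of_real (\<Lambda> j) * (Digamma (q j z) + Digamma (p j z))) / 2)"
  define D' where "D' = (\<lambda>z. (\<Sum>j\<in>{1..r}. of_real (\<Lambda> j) * (- \<i> * of_real (\<Lambda> j) * Polygamma 1 (q j z) +
       \<i> * of_real (\<Lambda> j) * Polygamma 1 (p j z))) / 2)"
  have dp: "(p j has_field_derivative \<i> * of_real (\<Lambda> j)) (at z)"
    and dq: "(q j has_field_derivative - \<i> * of_real (\<Lambda> j)) (at z)" for j z
    unfolding p_def q_def by (auto intro!: derivative_eq_intros)
  have dL: "(L has_field_derivative - 2 * \<i> * D z) (at z)" if "Re z > T0" for z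
  proof -
    have "((\<lambda>z. ln_Gamma (q j z) - ln_Gamma (p j z)) has_field_derivative
        - \<i> * (of_real (\<Lambda> j) * (Digamma (q j z) + Digamma (p j z)))) (at z)" if j: "j \<in> {1..r}" for j
      by (rule DERIV_cong[OF DERIV_diff[OF
          DERIV_chain2[OF has_field_derivative_ln_Gamma_complex[OF q_nonreal[OF j \<open>Re z > T0\<close>]] dq]
          DERIV_chain2[OF has_field_derivative_ln_Gamma_complex[OF p_nonreal[OF j \<open>Re z > T0\<close>]] dp]]])
        (simp add: algebra_simps)
    then have "((\<lambda>z. \<Sum>j\<in>{1..r}. ln_Gamma (q j z) - ln_Gamma (p j z)) has_field_derivative
        (\<Sum>j\<in>{1..r}. - \<i> * (of_real (\<Lambda> j) * (Digamma (q j z) + Digamma (p j z))))) (at z)"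
      by (intro DERIV_sum)
    then have "(L has_field_derivative 0 - 2 * \<i> * of_real (ln Q) * 1 +
        (\<Sum>j\<in>{1..r}. - \<i> * (of_real (\<Lambda> j) * (Digamma (q j z) + Digamma (p j z))))) (at z)"
      unfolding L_def by (intro DERIV_add DERIV_diff DERIV_const DERIV_cmult DERIV_ident)
    moreover have "0 - 2 * \<i> * of_real (ln Q) * 1 + - \<i> * S = - 2 * \<i> * (of_real (ln Q) + S / 2)" for S :: complex
      by (simp add: algebra_simps)
    ultimately show ?thesis
      unfolding D_def sum_distrib_left[symmetric] by metis
  qed
  have dD: "(D has_field_derivative D' z) (at z)" if "Re z > T0" for z
  proof -
    have "((\<lambda>z. of_real (\<Lambda> j) * (Digamma (q j z) + Digamma (p j z))) has_field_derivative
        of_real (\<Lambda> j) * (- \<i> * of_real (\<Lambda> j) * Polygamma 1 (q j z) +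
       \<i> * of_real (\<Lambda> j) * Polygamma 1 (p j z))) (at z)" if j: "j \<in> {1..r}" for j
      by (rule DERIV_cong[OF DERIV_cmult[OF DERIV_add[OF
          DERIV_chain2[OF has_field_derivative_Polygamma[OF q_int[OF j \<open>Re z > T0\<close>], of 0] dq]
          DERIV_chain2[OF has_field_derivative_Polygamma[OF p_int[OF j \<open>Re z > T0\<close>], of 0] dp]]]])
        (simp add: algebra_simps)
    then have "((\<lambda>z. \<Sum>j\<in>{1..r}. of_real (\<Lambda> j) * (Digamma (q j z) + Digamma (p j z))) has_field_derivative
        (\<Sum>j\<in>{1..r}. of_real (\<Lambda> j) * (- \<i> * of_real (\<Lambda> j) * Polygamma 1 (q j z) +
       \<i> * of_real (\<Lambda> j) * Polygamma 1 (p j z)))) (at z)"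
      by (intro DERIV_sum)
    from DERIV_add[OF DERIV_const DERIV_cdivide[OF this]] show ?thesis
      unfolding D_def D'_def by simp
  qed
  have holD: "D holomorphic_on {z. Re z > T0}"
    using dD by (auto simp: holomorphic_on_open open_halfspace_Re_gt)
  have bdD: "\<exists>B. \<forall>\<^sub>F z in strip_at_top b. norm (deriv D z) \<le> B" for b
  proof -
    have bd_j: "\<exists>B. \<forall>\<^sub>F z in strip_at_top b. norm (of_real (\<Lambda> j) * (- \<i> * of_real (\<Lambda> j) * Polygamma 1 (q j z) +
       \<i> * of_real (\<Lambda> j) * Polygamma 1 (p j z))) \<le> B" if j: "j \<in> {1..r}" for j
    proof -
      obtain B1 where B1: "\<forall>\<^sub>F z in strip_at_top b. norm (Polygamma 1 (p j z)) \<le> B1"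
        using Polygamma_1_strip_bounded[OF \<Lambda>[OF j], of 1 "\<mu> j" b] by (auto simp: p_def)
      obtain B2 where B2: "\<forall>\<^sub>F z in strip_at_top b. norm (Polygamma 1 (q j z)) \<le> B2"
        using Polygamma_1_strip_bounded[OF \<Lambda>[OF j], of "-1" "cnj (\<mu> j)" b] by (auto simp: q_def)
      have "\<forall>\<^sub>F z in strip_at_top b. norm (of_real (\<Lambda> j) * (- \<i> * of_real (\<Lambda> j) * Polygamma 1 (q j z) +
         \<i> * of_real (\<Lambda> j) * Polygamma 1 (p j z))) \<le> \<Lambda> j * (\<Lambda> j * B2 + \<Lambda> j * B1)"
        using B1 B2
      proof eventually_elim
        case (elim z)
        have "norm (- \<i> * of_real (\<Lambda> j) * Polygamma 1 (q j z) + \<i> * of_real (\<Lambda> j) * Polygamma 1 (p j z))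
          \<le> norm (- \<i> * of_real (\<Lambda> j) * Polygamma 1 (q j z)) + norm (\<i> * of_real (\<Lambda> j) * Polygamma 1 (p j z))"
          by (rule norm_triangle_ineq)
        also have "\<dots> \<le> \<Lambda> j * B2 + \<Lambda> j * B1"
          using elim \<Lambda>[OF j] by (simp add: norm_mult add_mono)
        finally show ?case
          using \<Lambda>[OF j] by (simp add: norm_mult)
      qed
      then show ?thesis by blast
    qed
    have "\<exists>B. \<forall>\<^sub>F z in strip_at_top b. norm (\<Sum>j\<in>{1..r}. of_real (\<Lambda> j) * (- \<i> * of_real (\<Lambda> j) * Polygamma 1 (q j z) +
       \<i> * of_real (\<Lambda> j) * Polygamma 1 (p j z))) \<le> B"
      by (rule eventually_bounded_sum[OF _ bd_j]) auto
    then obtain B where "\<forall>\<^sub>F z in strip_at_top b. norm (\<Sum>j\<in>{1..r}. of_real (\<Lambda> j) *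
       (- \<i> * of_real (\<Lambda> j) * Polygamma 1 (q j z) + \<i> * of_real (\<Lambda> j) * Polygamma 1 (p j z))) \<le> B" ..
    moreover have "\<forall>\<^sub>F z in strip_at_top b. Re z > T0"
      unfolding eventually_strip_at_top by blast
    ultimately have "\<forall>\<^sub>F z in strip_at_top b. norm (deriv D z) \<le> B / 2"
    proof eventually_elim
      case (elim z)
      have "deriv D z = D' z"
        using dD[OF elim(2)] by (rule DERIV_imp_deriv)
      then have "norm (deriv D z) = norm (\<Sum>j\<in>{1..r}. of_real (\<Lambda> j) * (- \<i> * of_real (\<Lambda> j) * Polygamma 1 (q j z) +
          \<i> * of_real (\<Lambda> j) * Polygamma 1 (p j z))) / 2"
        unfolding D'_def by (simp only: norm_divide norm_numeral)
      then show ?case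
        using elim(1) by linarith
    qed
    then show ?thesis by blast
  qed
  have limD: "filterlim (\<lambda>x. Re (D (of_real x))) at_top at_top" if "r > 0"
  proof -
    have "filterlim (\<lambda>x. \<Lambda> j / 2 * (Re (Digamma (q j (of_real x))) + Re (Digamma (p j (of_real x))))) at_top at_top"
      if j: "j \<in> {1..r}" for j
    proof (rule filterlim_tendsto_pos_mult_at_top[OF tendsto_const], goal_cases)
      case 1
      then show ?case using \<Lambda>[OF j] by simp
    next
      case 2
      then show ?case
        using Digamma_vertical[of "\<Lambda> j" "\<mu> j" 1] Digamma_vertical[of "\<Lambda> j" "cnj (\<mu> j)" "-1"] \<Lambda>[OF j] \<mu>[OF j]
        by (intro filterlim_at_top_add_at_top) (simp_all add: p_def q_def)
    qed
    then have "filterlim (\<lambda>x. \<Sum>j\<in>{1..r}. \<Lambda> j / 2 * (Re (Digamma (q j (of_real x))) + Re (Digamma (p j (of_real x))))) at_top at_top"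
      using that by (intro filterlim_sum_at_top) auto
    from filterlim_tendsto_add_at_top[OF tendsto_const[of "ln Q"] this]
    show ?thesis
      unfolding D_def by (simp add: sum_divide_distrib)
  qed
  have expL: "exp (L (of_real t)) = exp (- 2 * \<i> * of_real (\<theta> t))" if t: "t > T0" for t
  proof -
    define s where "s = Complex (1/2) t"
    have s: "s = 1/2 + \<i> * of_real t" "1 - cnj s = s" "cnj s = 1/2 - \<i> * of_real t"
      by (simp_all add: s_def complex_eq_iff)
    have powr: "of_real Q powr s = exp (s * of_real (ln Q))"
      using Q by (simp add: powr_def Ln_of_real)
    have gp: "Gamma (p j (of_real t)) = exp (ln_Gamma (p j (of_real t)))"
      and gq: "Gamma (q j (of_real t)) = exp (ln_Gamma (q j (of_real t)))" if "j \<in> {1..r}" for j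
      using p_int[OF that] q_int[OF that] t by (simp_all add: Gamma_complex_altdef)
    have cg: "cnj (Gamma (p j (of_real t))) = Gamma (q j (of_real t))" for j
      by (simp add: cnj_Gamma p_def q_def)
    have g: "gamma_factor Q r \<Lambda> \<mu> s = exp (s * of_real (ln Q)) * (\<Prod>j=1..r. Gamma (p j (of_real t)))"
      unfolding gamma_factor_def powr p_def s(1)[symmetric] ..
    have "functional_equation_factor Q r \<Lambda> \<mu> \<omega> s =
       \<omega> * (exp (cnj s * of_real (ln Q)) * (\<Prod>j=1..r. Gamma (q j (of_real t)))) /
         (exp (s * of_real (ln Q)) * (\<Prod>j=1..r. Gamma (p j (of_real t))))"
      unfolding functional_equation_factor_def s(2) g by (simp add: exp_cnj cg)
    also have "\<dots> = exp (Ln \<omega>) * exp (cnj s * of_real (ln Q) - s * of_real (ln Q)) *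
        ((\<Prod>j=1..r. Gamma (q j (of_real t))) / (\<Prod>j=1..r. Gamma (p j (of_real t))))"
      using \<omega> by (subst exp_Ln) (auto simp: exp_diff)
    also have "cnj s * of_real (ln Q) - s * of_real (ln Q) = - 2 * \<i> * of_real (ln Q) * of_real t"
      unfolding s by (simp add: algebra_simps)
    also have "(\<Prod>j=1..r. Gamma (q j (of_real t))) / (\<Prod>j=1..r. Gamma (p j (of_real t))) =
        exp (\<Sum>j\<in>{1..r}. ln_Gamma (q j (of_real t)) - ln_Gamma (p j (of_real t)))"
      by (simp add: exp_sum exp_diff gp gq flip: prod_dividef)
    finally have "functional_equation_factor Q r \<Lambda> \<mu> \<omega> s = exp (L (of_real t))"
      unfolding L_def by (simp add: exp_add exp_diff exp_minus field_simps)
    then show ?thesis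
      using \<theta> unfolding is_theta_function_def s_def by metis
  qed
  define g where "g = (\<lambda>t. of_real (\<theta> t) - \<i> / 2 * L (of_real t))"
  have g_int: "\<exists>n::int. g t = of_real (of_int n * pi)" if "t > T0" for t
  proof -
    obtain n :: int where n: "L (of_real t) = - 2 * \<i> * of_real (\<theta> t) + of_int (2 * n) * of_real pi * \<i>"
      using expL[OF \<open>t > T0\<close>] unfolding exp_eq by (auto simp: algebra_simps)
    have "g t = of_real (of_int n * pi)"
      unfolding g_def n by (simp add: algebra_simps)
    then show ?thesis ..
  qed
  have "g constant_on {T0<..}"
  proof (rule continuous_discrete_range_constant)
    have "continuous_on {T0<..} \<theta>"
    proof -
      have "\<theta> differentiable_on UNIV"
        using \<theta> unfolding is_theta_function_def smooth_real_def by (metis funpow_0)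
      then show ?thesis
        using differentiable_imp_continuous_on continuous_on_subset by blast
    qed
    moreover have "L holomorphic_on {z. Re z > T0}"
      using dL by (auto simp: holomorphic_on_open open_halfspace_Re_gt)
    then have "continuous_on {T0<..} (\<lambda>t. L (of_real t))"
      by (intro continuous_on_compose2[OF holomorphic_on_imp_continuous_on, of L]) (auto intro!: continuous_intros)
    ultimately show "continuous_on {T0<..} g"
      unfolding g_def by (intro continuous_intros)
    fix x assume x: "x \<in> {T0<..}"
    show "\<exists>e>0. \<forall>y. y \<in> {T0<..} \<and> g y \<noteq> g x \<longrightarrow> e \<le> norm (g y - g x)"
    proof (intro exI[of _ pi] conjI allI impI)
      fix y assume y: "y \<in> {T0<..} \<and> g y \<noteq> g x"
      obtain m n :: int where mn: "g x = of_real (of_int m * pi)" "g y = of_real (of_int n * pi)"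
        using g_int[of x] g_int[of y] x y by auto
      then have "m \<noteq> n" using y by auto
      then have "1 \<le> \<bar>real_of_int (n - m)\<bar>"
        by linarith
      then have "pi * 1 \<le> pi * \<bar>real_of_int (n - m)\<bar>"
        by (intro mult_left_mono) auto
      also have "\<dots> = norm (of_real (of_int (n - m) * pi) :: complex)"
        unfolding norm_of_real by (simp add: abs_mult)
      also have "(of_real (of_int (n - m) * pi) :: complex) = g y - g x"
        unfolding mn by (simp add: algebra_simps)
      finally show "pi \<le> norm (g y - g x)" by simp
    qed simp
  qed (simp add: is_interval_connected)
  then obtain c where c: "\<And>t. t > T0 \<Longrightarrow> g t = c"
    unfolding constant_on_def by auto
  define \<Theta> where "\<Theta> = (\<lambda>z. \<i> / 2 * L z + c)"
  show ?thesis
  proof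
    show "(\<Theta> has_field_derivative D z) (at z)" if "Re z > T0" for z
      unfolding \<Theta>_def using DERIV_add[OF DERIV_cmult[OF dL[OF that], of "\<i> / 2"] DERIV_const[of c]]
      by simp
    show "\<Theta> (of_real t) = of_real (\<theta> t)" if "t > T0" for t
      using c[OF that] by (simp add: \<Theta>_def g_def diff_eq_eq add.commute)
    show "D = (\<lambda>_. of_real (ln Q))" if "r = 0"
      using that by (simp add: D_def)
    show "of_real (\<Lambda> j) * (1/2 + \<i> * z) + \<mu> j \<notin> \<real>\<^sub>\<le>\<^sub>0" if "j \<in> {1..r}" "Re z > T0" for j z
      using p_nonreal[OF that] by (simp add: p_def)
  qed (use T0 holD bdD limD in auto)
qed

subsection \<open>Dirichlet series\<close>

lemma holomorphic_of_extends_with_order: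
  assumes "extends_with_order m F"
  shows "F holomorphic_on - {1}"
proof -
  obtain G where G: "G holomorphic_on UNIV" and eq: "\<And>s. s \<noteq> 1 \<Longrightarrow> G s = (s - 1) ^ m * F s"
    using assms unfolding extends_with_order_def entire_of_finite_order_def by blast
  have "(\<lambda>z. G z / (z - 1) ^ m) holomorphic_on - {1}"
    using holomorphic_on_subset[OF G] by (intro holomorphic_intros) auto
  then show ?thesis
    by (rule holomorphic_transform) (simp add: eq)
qed

text \<open>For n >= 2 and Re s >= 2, n^(- Re s) <= n^(-2) 2^(2 - Re s). The series without its
  first term is therefore at most 2^(2 - Re s) times the sum of absolute values at s = 2.\<close>

lemma dirichlet_series_near_1:
  assumes "has_dirichlet_series F"
  shows "\<exists>K\<ge>0. \<forall>s. Re s \<ge> 2 \<longrightarrow> norm (F s - 1) \<le> K * 2 powr (- Re s)"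
proof -
  obtain a :: "nat \<Rightarrow> complex" where a: "a 1 = 1 \<and>
        (\<forall>s. Re s > 1 \<longrightarrow>
           summable (\<lambda>n. norm (a (Suc n) * of_nat (Suc n) powr (- s))) \<and>
           (\<lambda>n. a (Suc n) * of_nat (Suc n) powr (- s)) sums F s)"
    using assms unfolding has_dirichlet_series_def by (elim exE)
  then have a1: "a 1 = 1"
    and summ: "\<And>s. Re s > 1 \<Longrightarrow> summable (\<lambda>n. norm (a (Suc n) * of_nat (Suc n) powr (- s)))"
    and sums: "\<And>s. Re s > 1 \<Longrightarrow> (\<lambda>n. a (Suc n) * of_nat (Suc n) powr (- s)) sums F s"
    by auto
  have norm_term: "norm (a n * of_nat n powr (- s)) = norm (a n) * real n powr (- Re s)" if "n > 0" for n s
    using that by (simp add: norm_mult norm_powr_real_powr)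
  \<comment> \<open>The series is indexed by \<open>Suc n\<close>; splitting off the term of 1
    shifts the index once more.\<close>
  define b where "b = (\<lambda>n. norm (a (n + 2)) * real (n + 2) powr (- 2))"
  have "b = (\<lambda>n. norm (a (Suc (Suc n)) * of_nat (Suc (Suc n)) powr (- 2)))"
    unfolding b_def by (subst norm_term) auto
  then have b: "summable b"
    using summ[of 2] by (simp only: summable_Suc_iff[of "\<lambda>n. norm (a (Suc n) * of_nat (Suc n) powr (- 2))"]) simp
  have b0: "suminf b \<ge> 0"
    by (rule suminf_nonneg[OF b]) (simp add: b_def)
  show ?thesis
  proof (intro exI[of _ "4 * suminf b"] conjI allI impI)
    fix s assume s: "2 \<le> Re s"
    have "(\<lambda>n. a (Suc (Suc n)) * of_nat (Suc (Suc n)) powr (- s)) sums (F s - a (Suc 0) * of_nat (Suc 0) powr (- s))"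
      using sums[of s] s by (subst sums_Suc_iff) simp
    then have sm: "(\<lambda>n. a (n + 2) * of_nat (n + 2) powr (- s)) sums (F s - 1)"
      using a1 by simp
    have "norm (F s - 1) = norm (\<Sum>n. a (n + 2) * of_nat (n + 2) powr (- s))"
      using sm by (simp add: sums_iff)
    also have "\<dots> \<le> (\<Sum>n. 2 powr (2 - Re s) * b n)"
    proof (rule norm_suminf_le)
      show "summable (\<lambda>n. 2 powr (2 - Re s) * b n)"
        by (intro summable_mult b)
      fix n
      have "real (n + 2) powr (- Re s) = real (n + 2) powr (- 2) * real (n + 2) powr (2 - Re s)"
        by (simp flip: powr_add)
      moreover have "real (n + 2) powr (2 - Re s) \<le> 2 powr (2 - Re s)"
        using s by (intro powr_mono2') auto
      ultimately have "norm (a (n + 2)) * real (n + 2) powr (- Re s) \<le> norm (a (n + 2)) * (real (n + 2) powr (- 2) * 2 powr (2 - Re s))"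
        by (simp add: mult_left_mono)
      then show "norm (a (n + 2) * of_nat (n + 2) powr (- s)) \<le> 2 powr (2 - Re s) * b n"
        unfolding b_def by (subst norm_term) (simp_all add: mult_ac)
    qed
    also have "\<dots> = 2 powr (2 - Re s) * suminf b"
      by (rule suminf_mult[OF b])
    also have "\<dots> = 4 * suminf b * 2 powr (- Re s)"
      by (simp add: powr_diff powr_minus field_simps)
    finally show "norm (F s - 1) \<le> 4 * suminf b * 2 powr (- Re s)" .
  qed (use b0 in auto)
qed

text \<open>Far to the right |F - 1| < c on a unit disc, so Cauchy gives |F'| <= c at its centre; c
  <= 1/2 keeps |F| >= 1/2, and c <= e/2 finishes. The exponent 1 - x instead of - x allows for the
  radius of the disc.\<close>

lemma dirichlet_series_logderiv_small:
  assumes "has_dirichlet_series F" "F holomorphic_on - {1}" "e > 0"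
  shows "\<exists>\<sigma>. \<forall>s. Re s \<ge> \<sigma> \<longrightarrow> F s \<noteq> 0 \<and> norm (deriv F s / F s) \<le> e"
proof -
  obtain K where "K \<ge> 0" and K: "\<And>s. Re s \<ge> 2 \<Longrightarrow> norm (F s - 1) \<le> K * 2 powr (- Re s)"
    using dirichlet_series_near_1[OF assms(1)] by blast
  define c where "c = min (1/2) (e / 2)"
  have c: "c > 0" "c \<le> 1/2" "c \<le> e/2" using assms(3) by (auto simp: c_def)
  have "((\<lambda>x. K * 2 powr (1 - x)) \<longlongrightarrow> 0) at_top"
    by real_asymp
  then have "\<forall>\<^sub>F x in at_top. K * 2 powr (1 - x) < c"
    using c by (intro order_tendstoD) auto
  then obtain X where X: "\<And>x. x \<ge> X \<Longrightarrow> K * 2 powr (1 - x) < c"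
    by (auto simp: eventually_at_top_linorder)
  show ?thesis
  proof (intro exI[of _ "max X 3"] allI impI)
    fix s assume s: "max X 3 \<le> Re s"
    have near: "norm (F w - 1) < c" "w \<noteq> 1" if "norm (w - s) \<le> 1" for w
    proof -
      have Rew: "Re w \<ge> Re s - 1"
        using that abs_Re_le_cmod[of "w - s"] by simp
      then have "norm (F w - 1) \<le> K * 2 powr (- Re w)"
        using s by (intro K) auto
      also have "\<dots> \<le> K * 2 powr (1 - Re s)"
        using Rew \<open>K \<ge> 0\<close> by (intro mult_left_mono powr_mono) auto
      also have "\<dots> < c" using s by (intro X) auto
      finally show "norm (F w - 1) < c" .
      show "w \<noteq> 1" using Rew s by auto
    qed
    have "norm ((deriv ^^ 1) F s) \<le> fact 1 * c / 1 ^ 1"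
    proof (rule Cauchy_higher_deriv_bound[where y = 1])
      have sub: "cball s 1 \<subseteq> - {1}"
        using near(2) by (auto simp: dist_norm norm_minus_commute)
      show "F holomorphic_on ball s 1"
        using holomorphic_on_subset[OF assms(2)] sub ball_subset_cball by blast
      show "continuous_on (cball s 1) F"
        using holomorphic_on_imp_continuous_on holomorphic_on_subset[OF assms(2)] sub by blast
      fix w assume "w \<in> ball s 1"
      then show "F w \<in> ball 1 c"
        using near(1)[of w] by (simp add: dist_norm norm_minus_commute)
    qed auto
    then have dF: "norm (deriv F s) \<le> c" by simp
    have F: "norm (F s) \<ge> 1/2"
      using near(1)[of s] c norm_triangle_ineq2[of 1 "1 - F s"] by (simp add: norm_minus_commute)
    then show "F s \<noteq> 0 \<and> norm (deriv F s / F s) \<le> e"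
    proof (intro conjI)
      have "norm (deriv F s) / norm (F s) \<le> (e / 2) / (1/2)"
        using dF F c assms(3) by (intro frac_le) auto
      then show "norm (deriv F s / F s) \<le> e"
        by (simp add: norm_divide)
    qed auto
  qed
qed

lemma entire_of_finite_order_growth:
  assumes "entire_of_finite_order G"
  shows "\<exists>R\<ge>1. \<exists>N. \<forall>s. norm s \<ge> R \<longrightarrow> norm (G s) \<le> exp (norm s ^ N)"
proof -
  obtain \<rho> where "\<forall>\<^sub>F s in at_infinity. norm (G s) \<le> exp (norm s powr \<rho>)"
    using assms unfolding entire_of_finite_order_def by (elim conjE exE)
  then obtain R where R: "\<And>s. norm s \<ge> R \<Longrightarrow> norm (G s) \<le> exp (norm s powr \<rho>)"
    by (auto simp: eventually_at_infinity)
  show ?thesis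
  proof (intro exI[of _ "max R 1"] exI[of _ "nat \<lceil>\<rho>\<rceil>"] conjI allI impI)
    fix s :: complex assume s: "norm s \<ge> max R 1"
    have "norm s powr \<rho> \<le> norm s powr real (nat \<lceil>\<rho>\<rceil>)"
      using s by (intro powr_mono) (auto, linarith)
    also have "\<dots> = norm s ^ nat \<lceil>\<rho>\<rceil>"
      using s by (intro powr_realpow) auto
    finally show "norm (G s) \<le> exp (norm s ^ nat \<lceil>\<rho>\<rceil>)"
      using R[of s] s by (meson exp_le_cancel_iff max.boundedE order_trans)
  qed simp
qed

text \<open>Dividing by (s - 1)^m costs nothing because |s - 1| >= Re z >= 1, and |s| <= 2 Re z once
  Re z exceeds b + 1.\<close>

lemma vertical_growth:
  assumes "extends_with_order m F"
  shows "\<exists>N T. \<forall>z. Re z > T \<and> \<bar>Im z\<bar> < b \<longrightarrow> norm (F (1/2 + \<i> * z)) \<le> exp ((2 * Re z) ^ N)"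
proof -
  obtain G where G: "entire_of_finite_order G" and eq: "\<And>s. s \<noteq> 1 \<Longrightarrow> G s = (s - 1) ^ m * F s"
    using assms unfolding extends_with_order_def by blast
  obtain N R where R: "R \<ge> 1" "\<And>s. norm s \<ge> R \<Longrightarrow> norm (G s) \<le> exp (norm s ^ N)"
    using entire_of_finite_order_growth[OF G] by blast
  show ?thesis
  proof (intro exI[of _ N] exI[of _ "max R (b + 1)"] allI impI)
    fix z assume z: "max R (b + 1) < Re z \<and> \<bar>Im z\<bar> < b"
    define s where "s = 1/2 + \<i> * z"
    have s: "Im s = Re z" "Re s = 1/2 - Im z" by (auto simp: s_def)
    have large: "norm s \<ge> Re z" "norm (s - 1) \<ge> Re z"
      using abs_Im_le_cmod[of s] abs_Im_le_cmod[of "s - 1"] s by auto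
    have "norm s \<le> 2 * Re z"
      using cmod_le[of s] s z by auto
    have "s \<noteq> 1" using s z R by auto
    have "1 \<le> norm (s - 1) ^ m"
      using large z R by (intro one_le_power) auto
    then have "1 * norm (F s) \<le> norm (s - 1) ^ m * norm (F s)"
      by (intro mult_right_mono) auto
    also have "\<dots> = norm (G s)"
      using eq[OF \<open>s \<noteq> 1\<close>] by (simp add: norm_mult norm_power)
    also have "\<dots> \<le> exp (norm s ^ N)"
      using large z by (intro R) auto
    also have "norm s ^ N \<le> (2 * Re z) ^ N"
      using \<open>norm s \<le> 2 * Re z\<close> by (intro power_mono) auto
    finally show "norm (F (1/2 + \<i> * z)) \<le> exp ((2 * Re z) ^ N)"
      by (simp add: s_def)
  qed
qed

lemma quadratic_growth_of_antiderivative: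
  assumes d: "\<And>z. Re z > T0 \<Longrightarrow> (\<Theta> has_field_derivative D z) (at z)"
    and D: "\<exists>K T. \<forall>z. Re z > T \<and> \<bar>Im z\<bar> < b \<longrightarrow> norm (D z) \<le> K * Re z"
  shows "\<exists>K T. \<forall>z. Re z > T \<and> \<bar>Im z\<bar> < b \<longrightarrow> norm (\<Theta> z) \<le> K * (Re z)\<^sup>2"
proof -
  obtain K T where KT: "\<And>z. Re z > T \<Longrightarrow> \<bar>Im z\<bar> < b \<Longrightarrow> norm (D z) \<le> K * Re z"
    using D by blast
  define X where "X = max (max T T0) 0 + 1"
  have X: "X \<ge> 1" "X > T" "X > T0" by (auto simp: X_def)
  define w :: complex where "w = of_real X"
  define c where "c = 1 + \<bar>b\<bar> + norm w"
  show ?thesis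
  proof (rule exI[of _ "norm (\<Theta> w) + \<bar>K\<bar> * c"], rule exI[of _ X], intro allI impI)
    fix z assume z: "Re z > X \<and> \<bar>Im z\<bar> < b"
    define S where "S = {u. Re u \<ge> X} \<inter> {u. Re u \<le> Re z} \<inter> {u. Im u < b} \<inter> {u. Im u > - b}"
    have "convex S"
      unfolding S_def
      by (intro convex_Int convex_halfspace_Re_ge convex_halfspace_Re_le convex_halfspace_Im_lt convex_halfspace_Im_gt)
    have "norm (\<Theta> z - \<Theta> w) \<le> \<bar>K\<bar> * Re z * norm (z - w)"
    proof (rule field_differentiable_bound[OF \<open>convex S\<close>, of \<Theta> D])
      show "(\<Theta> has_field_derivative D u) (at u within S)" if "u \<in> S" for u
        by (rule has_field_derivative_at_within, rule d) (use that X in \<open>auto simp: S_def\<close>)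
      show "norm (D u) \<le> \<bar>K\<bar> * Re z" if "u \<in> S" for u
      proof -
        have u: "X \<le> Re u" "Re u \<le> Re z" "\<bar>Im u\<bar> < b" using that by (auto simp: S_def)
        have "norm (D u) \<le> K * Re u" using u X by (intro KT) auto
        also have "\<dots> \<le> \<bar>K\<bar> * Re z" using u X by (intro mult_mono) auto
        finally show ?thesis .
      qed
    qed (use z X in \<open>auto simp: S_def w_def\<close>)
    also have "norm (z - w) \<le> c * Re z"
    proof -
      have "norm z \<le> Re z + \<bar>b\<bar>"
        using cmod_le[of z] z X by auto
      then have "norm (z - w) \<le> Re z + \<bar>b\<bar> * 1 + norm w * 1"
        using norm_triangle_ineq4[of z w] by simp
      also have "\<dots> \<le> Re z + \<bar>b\<bar> * Re z + norm w * Re z"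
        using z X by (intro add_mono mult_left_mono) auto
      finally show ?thesis
        by (simp add: c_def algebra_simps)
    qed
    then have "\<bar>K\<bar> * Re z * norm (z - w) \<le> \<bar>K\<bar> * Re z * (c * Re z)"
      using z X by (intro mult_left_mono) auto
    finally have "norm (\<Theta> z) \<le> norm (\<Theta> w) * 1 + \<bar>K\<bar> * c * (Re z)\<^sup>2"
      using norm_triangle_ineq2[of "\<Theta> z" "\<Theta> w"] by (simp add: power2_eq_square mult_ac)
    also have "\<dots> \<le> norm (\<Theta> w) * (Re z)\<^sup>2 + \<bar>K\<bar> * c * (Re z)\<^sup>2"
      using z X by (intro add_right_mono mult_left_mono) (auto intro!: one_le_power)
    finally show "norm (\<Theta> z) \<le> (norm (\<Theta> w) + \<bar>K\<bar> * c) * (Re z)\<^sup>2"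
      by (simp add: algebra_simps)
  qed
qed

lemma product_growth:
  assumes \<Theta>: "\<exists>K T. \<forall>z. Re z > T \<and> \<bar>Im z\<bar> < b \<longrightarrow> norm (\<Theta> z) \<le> K * (Re z)\<^sup>2"
    and F: "\<exists>N T. \<forall>z. Re z > T \<and> \<bar>Im z\<bar> < b \<longrightarrow> norm (g z) \<le> exp ((2 * Re z) ^ N)"
  shows "\<exists>n T. \<forall>z. Re z > T \<and> \<bar>Im z\<bar> < b \<longrightarrow> norm (exp (\<i> * \<Theta> z) * g z) \<le> exp (Re z ^ n)"
proof -
  obtain K T1 where K: "\<And>z. Re z > T1 \<Longrightarrow> \<bar>Im z\<bar> < b \<Longrightarrow> norm (\<Theta> z) \<le> K * (Re z)\<^sup>2"
    using \<Theta> by blast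
  obtain N T2 where N: "\<And>z. Re z > T2 \<Longrightarrow> \<bar>Im z\<bar> < b \<Longrightarrow> norm (g z) \<le> exp ((2 * Re z) ^ N)"
    using F by blast
  define X where "X = max (max T1 T2) (max 1 (\<bar>K\<bar> + 2 ^ N))"
  have X: "X \<ge> T1" "X \<ge> T2" "X \<ge> 1" "X \<ge> \<bar>K\<bar> + 2 ^ N" by (auto simp: X_def)
  show ?thesis
  proof (intro exI[of _ "N + 3"] exI[of _ X] allI impI)
    fix z assume z: "Re z > X \<and> \<bar>Im z\<bar> < b"
    define x where "x = Re z"
    have x: "x \<ge> 1" "x \<ge> \<bar>K\<bar> + 2 ^ N" using z X by (auto simp: x_def)
    have "norm (exp (\<i> * \<Theta> z)) \<le> exp (norm (\<Theta> z))"
      using norm_exp[of "\<i> * \<Theta> z"] by (simp add: norm_mult)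
    also have "\<dots> \<le> exp (K * x\<^sup>2)"
      using K[of z] z X by (simp add: x_def)
    finally have "norm (exp (\<i> * \<Theta> z) * g z) \<le> exp (K * x\<^sup>2) * exp ((2 * x) ^ N)"
      unfolding norm_mult using N[of z] z X by (intro mult_mono) (auto simp: x_def)
    also have "\<dots> = exp (K * x\<^sup>2 + (2 * x) ^ N)" by (simp add: exp_add)
    also have "K * x\<^sup>2 + (2 * x) ^ N \<le> x ^ (N + 3)"
    proof -
      have "K * x\<^sup>2 \<le> \<bar>K\<bar> * x ^ (N + 2)"
        using x by (intro mult_mono power_increasing) auto
      moreover have "(2 * x) ^ N \<le> 2 ^ N * x ^ (N + 2)"
        unfolding power_mult_distrib using x by (intro mult_left_mono power_increasing) auto
      ultimately have "K * x\<^sup>2 + (2 * x) ^ N \<le> (\<bar>K\<bar> + 2 ^ N) * x ^ (N + 2)"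
        by (simp add: algebra_simps)
      also have "\<dots> \<le> x * x ^ (N + 2)"
        using x by (intro mult_right_mono) auto
      also have "\<dots> = x ^ (N + 3)"
        by (simp add: eval_nat_numeral)
      finally show ?thesis .
    qed
    finally show "norm (exp (\<i> * \<Theta> z) * g z) \<le> exp (Re z ^ (N + 3))"
      by (simp add: x_def)
  qed
qed

text \<open>\<open>remove_sings\<close> changes nothing at a point of analyticity. Unlike
  \<open>completed_critical_line\<close>, this is applied off the critical line: to zeros that RH
  excludes and to the functional equation far to the left.\<close>

lemma completed_eq:
  assumes "has_functional_equation F Q r \<Lambda> \<mu> \<omega>" "F holomorphic_on - {1}" "s \<noteq> 1"
    and np: "\<And>j. j \<in> {1..r} \<Longrightarrow> of_real (\<Lambda> j) * s + \<mu> j \<notin> \<int>\<^sub>\<le>\<^sub>0"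
  shows "completed F Q r \<Lambda> \<mu> s =
     s ^ polar_order F * (s - 1) ^ polar_order F * gamma_factor Q r \<Lambda> \<mu> s * F s"
proof -
  have [analytic_intros]: "F analytic_on {s}"
    using assms(2,3) by (meson ComplI analytic_at open_Compl closed_singleton singletonD)
  have [analytic_intros]: "gamma_factor Q r \<Lambda> \<mu> analytic_on {s}"
    unfolding gamma_factor_def using assms(1) np
    by (auto intro!: analytic_intros simp: has_functional_equation_def complex_nonpos_Reals_iff)
  have "(\<lambda>s. s ^ polar_order F * (s - 1) ^ polar_order F * gamma_factor Q r \<Lambda> \<mu> s * F s)
          analytic_on {s}"
    by (intro analytic_intros)
  then show ?thesis
    unfolding completed_def by simp
qed

section \<open>Application to F and Z\<close>

lemma one_zero_between_consecutive_zeros: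
  assumes F: "F \<in> extended_selberg_class" and fe: "has_functional_equation F Q r \<Lambda> \<mu> \<omega>"
    and \<theta>: "is_theta_function Q r \<Lambda> \<mu> \<omega> \<theta>" and RH: "riemann_hypothesis F Q r \<Lambda> \<mu>"
    and "r > 0 \<or> Q > 1"
  shows "\<exists>T>0. \<forall>\<gamma> \<gamma>'.
           T \<le> \<gamma> \<and> consecutive_zeros ((deriv ^^ k) (hardy_Z F \<theta>)) \<gamma> \<gamma>' \<longrightarrow>
           (\<exists>!t. \<gamma> < t \<and> t < \<gamma>' \<and> (deriv ^^ (k + 1)) (hardy_Z F \<theta>) t = 0)"
proof -
  have ds: "has_dirichlet_series F" and ext: "\<exists>m. extends_with_order m F"
    using F by (auto simp: extended_selberg_class_def)
  have Q: "Q > 0" and \<Lambda>: "\<And>j. j \<in> {1..r} \<Longrightarrow> \<Lambda> j > 0" and \<mu>: "\<And>j. j \<in> {1..r} \<Longrightarrow> Re (\<mu> j) \<ge> 0"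
    and \<omega>: "norm \<omega> = 1"
    using fe by (auto simp: has_functional_equation_def)
  have holF: "F holomorphic_on - {1}"
    using ext holomorphic_of_extends_with_order by blast
  show ?thesis
  proof (rule theta_extension[OF Q \<Lambda> \<mu> \<omega> \<theta>])
    fix T0 \<Theta> D
    assume T0: "T0 \<ge> 0" and holD: "D holomorphic_on {z. Re z > T0}"
      and d\<Theta>: "\<And>z. Re z > T0 \<Longrightarrow> (\<Theta> has_field_derivative D z) (at z)"
      and \<Theta>_real: "\<And>t. t > T0 \<Longrightarrow> \<Theta> (of_real t) = of_real (\<theta> t)"
      and bdD: "\<And>b. \<exists>B. \<forall>\<^sub>F z in strip_at_top b. norm (deriv D z) \<le> B"
      and limD: "r > 0 \<Longrightarrow> filterlim (\<lambda>x. Re (D (of_real x))) at_top at_top"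
      and D0: "r = 0 \<Longrightarrow> D = (\<lambda>_. of_real (ln Q))"
      and np: "\<And>j z. j \<in> {1..r} \<Longrightarrow> Re z > T0 \<Longrightarrow> of_real (\<Lambda> j) * (1/2 + \<i> * z) + \<mu> j \<notin> \<real>\<^sub>\<le>\<^sub>0"
    \<comment> \<open>With gamma factors Re D tends to infinity and any positive constant would do;
      without them \<open>D\<close> is the constant ln Q, which is positive because Q > 1.\<close>
    define m where "m = (if r > 0 then 1 else ln Q)"
    define s :: "complex \<Rightarrow> complex" where "s = (\<lambda>z. 1/2 + \<i> * z)"
    define f where "f = (\<lambda>z. exp (\<i> * \<Theta> z) * F (s z))"
    have s1: "s z \<noteq> 1" if "Re z > T0" for z
      using that T0 by (auto simp: s_def complex_eq_iff)
    have df: "(f has_field_derivative exp (\<i> * \<Theta> z) * (\<i> * D z * F (s z) + \<i> * deriv F (s z))) (at z)"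
      if z: "Re z > T0" for z
    proof -
      have 1: "((\<lambda>z. exp (\<i> * \<Theta> z)) has_field_derivative exp (\<i> * \<Theta> z) * (\<i> * D z)) (at z)"
        by (rule DERIV_chain2[OF DERIV_exp DERIV_cmult[OF d\<Theta>[OF z]]])
      have "(F has_field_derivative deriv F (s z)) (at (s z))"
        using holF s1[OF z] by (intro holomorphic_derivI[of F "- {1}"]) auto
      moreover have "(s has_field_derivative \<i>) (at z)"
        unfolding s_def by (auto intro!: derivative_eq_intros)
      ultimately have 2: "((\<lambda>z. F (s z)) has_field_derivative deriv F (s z) * \<i>) (at z)"
        by (rule DERIV_chain2)
      show ?thesis
        unfolding f_def by (rule DERIV_cong[OF DERIV_mult[OF 1 2]]) (simp add: algebra_simps)
    qed
    have M: "deriv f z / f z - \<i> * D z = \<i> * (deriv F (s z) / F (s z))"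
      if "Re z > T0" "F (s z) \<noteq> 0" for z
      unfolding DERIV_imp_deriv[OF df[OF that(1)]] using that(2) by (simp add: f_def field_simps)
    have D_facts: "(\<exists>T. \<forall>z. Re z > T \<and> \<bar>Im z\<bar> < b \<longrightarrow> Re (D z) \<ge> m) \<and>
        (\<exists>K T. \<forall>z. Re z > T \<and> \<bar>Im z\<bar> < b \<longrightarrow> norm (D z) \<le> K * Re z) \<and>
        (e > 0 \<longrightarrow> (\<exists>T. \<forall>z. Re z > T \<and> \<bar>Im z\<bar> < b \<longrightarrow> norm (deriv D z) \<le> e * norm (D z)))" for b e
    proof (cases "r > 0")
      case True
      show ?thesis
        using strip_bounds_of_bounded_deriv[OF holD bdD limD[OF True]] by blast
    next
      case False
      then have D: "D = (\<lambda>_. of_real (ln Q))" and "m = ln Q" using D0 by (auto simp: m_def)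
      have "norm (complex_of_real (ln Q)) \<le> \<bar>ln Q\<bar> * Re z" if "Re z > 1" for z
        using that mult_left_mono[of 1 "Re z" "\<bar>ln Q\<bar>"] by simp
      then have "\<exists>K T. \<forall>z. Re z > T \<and> \<bar>Im z\<bar> < b \<longrightarrow> norm (complex_of_real (ln Q)) \<le> K * Re z"
        by blast
      then show ?thesis
        unfolding D \<open>m = ln Q\<close> by simp
    qed
    have f_real: "f (of_real t) = of_real (hardy_Z F \<theta> t)" if "t > T0" for t
    proof -
      have "s (of_real t) = Complex (1/2) t" by (simp add: s_def complex_eq_iff)
      then show ?thesis
        unfolding f_def \<Theta>_real[OF that] of_real_hardy_Z[OF F fe \<theta>] by simp
    qed
    interpret S: strip_asymptotics f D T0 m
    proof
      show "m > 0" using \<open>r > 0 \<or> Q > 1\<close> by (auto simp: m_def)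
      show "f holomorphic_on {z. Re z > T0}"
        using df by (auto simp: holomorphic_on_open open_halfspace_Re_gt)
      show "f (of_real x) \<in> \<real>" if "x > T0" for x
        using f_real[OF that] by simp
      show "\<exists>n T. \<forall>z. Re z > T \<and> \<bar>Im z\<bar> < b \<longrightarrow> norm (f z) \<le> exp (Re z ^ n)" for b
      proof -
        have "\<exists>K T. \<forall>z. Re z > T \<and> \<bar>Im z\<bar> < b \<longrightarrow> norm (D z) \<le> K * Re z"
          using D_facts by blast
        note quadratic_growth_of_antiderivative[of T0 \<Theta> D, OF d\<Theta> this]
        moreover obtain m where "extends_with_order m F"
          using ext by blast
        note vertical_growth[OF this, of b]
        ultimately show ?thesis
          unfolding f_def s_def by (rule product_growth)
      qed
      \<comment> \<open>RH enters here: beyond \<open>T0\<close> the gamma factors have no poles, so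
        a zero of \<open>F\<close> is a zero of \<open>completed\<close>, whereas Re
        (\<open>s z\<close>) = 1/2 - Im z.\<close>
      show "f z \<noteq> 0" if z: "Re z > T0" "Im z \<noteq> 0" for z
      proof
        assume "f z = 0"
        then have "F (s z) = 0" by (simp add: f_def)
        have "of_real (\<Lambda> j) * s z + \<mu> j \<notin> \<int>\<^sub>\<le>\<^sub>0" if "j \<in> {1..r}" for j
          using np[OF that z(1)] nonpos_Ints_subset_nonpos_Reals by (auto simp: s_def)
        then have "completed F Q r \<Lambda> \<mu> (s z) = 0"
          using completed_eq[OF fe holF s1[OF z(1)]] \<open>F (s z) = 0\<close> by simp
        then have "Re (s z) = 1/2" using RH by (auto simp: riemann_hypothesis_def)
        then show False using z by (simp add: s_def)
      qed
      show "\<exists>c. \<forall>b. \<exists>T\<ge>T0. \<forall>z. Re z > T \<and> - b < Im z \<and> Im z < - c \<longrightarrow>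
                    f z \<noteq> 0 \<and> norm (deriv f z / f z - \<i> * D z) \<le> e" if "e > 0" for e
      proof -
        obtain \<sigma> where \<sigma>: "\<And>s. Re s \<ge> \<sigma> \<Longrightarrow> F s \<noteq> 0 \<and> norm (deriv F s / F s) \<le> e"
          using dirichlet_series_logderiv_small[OF ds holF \<open>e > 0\<close>] by blast
        show ?thesis
        \<comment> \<open>Im z < - \<open>\<sigma>\<close> puts \<open>s z\<close> to the right of
          \<open>\<sigma>\<close>, where the estimate for \<open>F\<close> is uniform; hence
          \<open>T0\<close> serves for every depth \<open>b\<close>.\<close>
        proof (rule exI[of _ \<sigma>], rule allI, rule exI[of _ T0], intro conjI allI impI)
          fix b z assume z: "Re z > T0 \<and> - b < Im z \<and> Im z < - \<sigma>"
          then have "Re (s z) \<ge> \<sigma>" by (simp add: s_def)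
          note * = \<sigma>[OF this]
          show "f z \<noteq> 0" using * by (simp add: f_def)
          show "norm (deriv f z / f z - \<i> * D z) \<le> e"
            using z * by (subst M) (simp_all add: norm_mult norm_divide)
        qed simp
      qed
    qed (use T0 holD D_facts in auto)
    have deriv_Z: "(deriv ^^ j) (hardy_Z F \<theta>) t = Re (S.fk j (of_real t))" if "t > T0" for j t
      using that
    proof (induction j arbitrary: t)
      case 0
      then show ?case using f_real by (simp add: S.fk_def)
    next
      case (Suc j)
      have "((deriv ^^ j) (hardy_Z F \<theta>) has_real_derivative Re (S.fk (Suc j) (of_real t))) (at t)"
      proof (rule has_field_derivative_transform_within_open)
        show "((\<lambda>t. Re (S.fk j (of_real t))) has_real_derivative Re (S.fk (Suc j) (of_real t))) (at t)"
          unfolding S.fk_Suc by (rule deriv_real_on_reals(1)[OF S.hol_fk S.real_fk Suc.prems])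
        show "t \<in> {T0<..}" using Suc.prems by simp
      qed (use Suc.IH in auto)
      then show ?case by (simp add: DERIV_imp_deriv)
    qed
    obtain T where "T > T0" and T: "\<And>\<gamma> \<gamma>'. T \<le> \<gamma> \<and> \<gamma> < \<gamma>' \<and> Re (S.fk k (of_real \<gamma>)) = 0 \<and> Re (S.fk k (of_real \<gamma>')) = 0 \<and>
        (\<forall>t. \<gamma> < t \<and> t < \<gamma>' \<longrightarrow> Re (S.fk k (of_real t)) \<noteq> 0) \<Longrightarrow>
        (\<exists>!t. \<gamma> < t \<and> t < \<gamma>' \<and> Re (S.fk (Suc k) (of_real t)) = 0)"
      using S.unique_zero_of_derivative[of k] by (elim exE conjE) blast
    show ?thesis
    proof (intro exI[of _ T] conjI allI impI)
      fix \<gamma> \<gamma>' assume a: "T \<le> \<gamma> \<and> consecutive_zeros ((deriv ^^ k) (hardy_Z F \<theta>)) \<gamma> \<gamma>'"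
      have Z: "(deriv ^^ j) (hardy_Z F \<theta>) t = Re (S.fk j (of_real t))" if "t \<ge> \<gamma>" for j t
        using that a \<open>T > T0\<close> by (intro deriv_Z) auto
      have "\<exists>!t. \<gamma> < t \<and> t < \<gamma>' \<and> Re (S.fk (Suc k) (of_real t)) = 0"
        using a Z[of _ k] by (intro T) (auto simp: consecutive_zeros_def)
      moreover have "\<gamma> < t \<and> t < \<gamma>' \<and> Re (S.fk (Suc k) (of_real t)) = 0 \<longleftrightarrow>
          \<gamma> < t \<and> t < \<gamma>' \<and> (deriv ^^ (k + 1)) (hardy_Z F \<theta>) t = 0" for t
        using Z[of t "Suc k"] by auto
      ultimately show "\<exists>!t. \<gamma> < t \<and> t < \<gamma>' \<and> (deriv ^^ (k + 1)) (hardy_Z F \<theta>) t = 0"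
        by simp
    qed (use \<open>T > T0\<close> T0 in auto)
  qed
qed

subsection \<open>Degree zero\<close>

text \<open>By Liouville \<open>E\<close> is a polynomial. A nonconstant one has modulus at least 1
  near infinity, in particular far out on the negative axis, contrary to the limit.\<close>

lemma entire_polynomial_growth_eq_0:
  fixes E :: "complex \<Rightarrow> complex"
  assumes hol: "E holomorphic_on UNIV" and growth: "\<And>z. A \<le> norm z \<Longrightarrow> norm (E z) \<le> B * norm z ^ n"
    and lim: "((\<lambda>x::real. E (of_real (- x))) \<longlongrightarrow> 0) at_top"
  shows "E z = 0"
proof -
  define c where "c = (\<lambda>k. (deriv ^^ k) E 0 / fact k)"
  have E: "E w = (\<Sum>k\<le>n. c k * w ^ k)" for w
    unfolding c_def by (rule Liouville_polynomial[OF hol growth])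
  have c0: "c k = 0" if "k \<noteq> 0" "k \<le> n" for k
  proof (rule ccontr)
    assume "c k \<noteq> 0"
    then have "\<forall>\<^sub>F w in at_infinity. norm (E w) \<ge> 1"
      unfolding E using that by (intro Poly_Roots.polyfun_extremal) auto
    moreover have "filterlim (\<lambda>x::real. complex_of_real (- x)) at_infinity at_top"
      unfolding filterlim_at_infinity_conv_norm_at_top by (simp add: filterlim_abs_real)
    ultimately have "\<forall>\<^sub>F x in at_top. norm (E (of_real (- x))) \<ge> 1"
      by (auto simp: filterlim_iff)
    moreover have "\<forall>\<^sub>F x in at_top. norm (E (of_real (- x))) < 1"
      using tendstoD[OF lim, of 1] by simp
    ultimately have "\<forall>\<^sub>F x::real in at_top. False"
      by eventually_elim simp
    then show False by simp
  qed
  have E0: "E w = c 0" for w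
  proof -
    have "E w = (\<Sum>k\<in>{0}. c k * w ^ k)"
      unfolding E using c0 by (intro sum.mono_neutral_right) auto
    then show ?thesis by simp
  qed
  with lim have "((\<lambda>x::real. c 0) \<longlongrightarrow> 0) at_top" by simp
  then have "c 0 = 0"
    by (simp add: tendsto_const_iff)
  then show ?thesis by (simp add: E0)
qed

text \<open>Phragmen-Lindeloef for E / (s + 2)^m in the upper and the lower half strip separately,
  with a compact rectangle in between. The point -2 has distance at least 1 from the strip, so the
  division only decreases the modulus.\<close>

lemma polynomial_bound_in_strip:
  fixes E :: "complex \<Rightarrow> complex"
  assumes hol: "E holomorphic_on UNIV" and R: "R \<ge> 0"
    and growth: "\<And>s. norm s \<ge> R \<Longrightarrow> norm (E s) \<le> exp (norm s ^ N)"
    and sides: "\<And>s. Re s = 2 \<or> Re s = -1 \<Longrightarrow> norm (E s) \<le> B * norm (s + 2) ^ m"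
  shows "\<exists>B'. \<forall>s. -1 \<le> Re s \<and> Re s \<le> 2 \<longrightarrow> norm (E s) \<le> B' * norm (s + 2) ^ m"
proof -
  define V where "V = (\<lambda>s. E s / (s + 2) ^ m)"
  have nz: "s + 2 \<noteq> 0" if "Re s > - 2" for s
    using that by (auto simp: complex_eq_iff)
  have holV: "V holomorphic_on {s. Re s > - 2}"
    unfolding V_def using nz by (intro holomorphic_intros holomorphic_on_subset[OF hol]) auto
  define K where "K = cbox (Complex (-1) (- R)) (Complex 2 R)"
  have "compact (V ` K)"
    using holomorphic_on_imp_continuous_on[OF holV]
    by (intro compact_continuous_image) (auto simp: K_def in_cbox_complex_iff elim!: continuous_on_subset)
  then obtain B1 where B1: "\<And>s. s \<in> K \<Longrightarrow> norm (V s) \<le> B1"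
    by (meson compact_imp_bounded bounded_iff imageI)
  define B' where "B' = max (max B B1) 1"
  have B': "B' \<ge> B" "B' \<ge> B1" "B' > 0" by (auto simp: B'_def)
  have V_sides: "norm (V s) \<le> B'" if "Re s = 2 \<or> Re s = -1" for s
  proof -
    have "norm (s + 2) ^ m > 0"
      using nz[of s] that by auto
    then have "norm (V s) \<le> B"
      using sides[OF that] by (simp add: V_def norm_divide norm_power pos_divide_le_eq)
    then show ?thesis using B' by simp
  qed
  have half: "norm (V (Complex x y)) \<le> B'"
    if "\<epsilon> = 1 \<or> \<epsilon> = (-1::real)" "-1 \<le> x" "x \<le> 2" "\<epsilon> * y \<ge> R" for \<epsilon> x y
  proof -
    \<comment> \<open>\<open>p\<close> rotates the half strip of height 3 onto the upper
      (\<open>\<epsilon>\<close> = 1) or lower (\<open>\<epsilon>\<close> = -1) half of -1 <= Re s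
      <= 2; \<open>a\<close> is the side to which its bottom edge is sent, 2 or -1.\<close>
    define a where "a = (1 + 3 * \<epsilon>) / 2"
    define p :: "complex \<Rightarrow> complex" where "p = (\<lambda>z. of_real a + of_real \<epsilon> * \<i> * z)"
    have Rep: "Re (p z) = a - \<epsilon> * Im z" and Imp: "Im (p z) = \<epsilon> * Re z" for z
      by (auto simp: p_def)
    have range: "- 1 \<le> Re (p z) \<and> Re (p z) \<le> 2" if "0 \<le> Im z" "Im z \<le> 3" for z
      using that \<open>\<epsilon> = 1 \<or> \<epsilon> = -1\<close> unfolding Rep a_def by auto
    define w where "w = Complex (\<epsilon> * y) (\<epsilon> * (a - x))"
    have w: "p w = Complex x y"
      using that(1) by (auto simp: complex_eq_iff Rep Imp w_def)
    have "norm (V (p w)) \<le> B'"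
    proof (rule phragmen_lindelof_half_strip[where h = "\<lambda>z. V (p z)" and T = R and C = 3
          and U = "{z. Re (p z) > - 2}" and g = "\<lambda>x. 2 ^ N * (x + 1) ^ N"])
      show "(\<lambda>z. V (p z)) holomorphic_on {z. - 2 < Re (p z)}"
        by (rule holomorphic_on_compose_gen[OF _ holV, unfolded o_def])
          (auto simp: p_def intro!: holomorphic_intros)
      show "{z. R \<le> Re z \<and> 0 \<le> Im z \<and> Im z \<le> 3} \<subseteq> {z. - 2 < Re (p z)}"
        using range by fastforce
      show "norm (V (p (Complex x 0))) \<le> B'" "norm (V (p (Complex x 3))) \<le> B'" for x
        using that(1) by (auto intro!: V_sides simp: Rep a_def)
      show "norm (V (p (Complex R y))) \<le> B'" if "0 \<le> y" "y \<le> 3" for y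
      proof -
        have "p (Complex R y) \<in> K"
          using range[of "Complex R y"] that \<open>\<epsilon> = 1 \<or> \<epsilon> = -1\<close> R
          by (auto simp: K_def in_cbox_complex_iff Imp)
        then show ?thesis using B1 B' by (meson order_trans)
      qed
      show "norm (V (p z)) \<le> exp (2 ^ N * (Re z + 1) ^ N)" if "R \<le> Re z" "0 \<le> Im z" "Im z \<le> 3" for z
      proof -
        have re: "- 1 \<le> Re (p z)" "Re (p z) \<le> 2" using range[OF that(2,3)] by auto
        have im: "\<bar>Im (p z)\<bar> = Re z" using \<open>\<epsilon> = 1 \<or> \<epsilon> = -1\<close> that R by (auto simp: Imp)
        have "1 \<le> norm (p z + 2)"
          using abs_Re_le_cmod[of "p z + 2"] re by simp
        then have n1: "1 \<le> norm (p z + 2) ^ m"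
          by (rule one_le_power)
        then have "norm (E (p z)) * 1 \<le> norm (E (p z)) * norm (p z + 2) ^ m"
          by (intro mult_left_mono) auto
        then have "norm (V (p z)) \<le> norm (E (p z))"
          using n1 by (simp add: V_def norm_divide norm_power pos_divide_le_eq)
        also have "\<dots> \<le> exp (norm (p z) ^ N)"
          using abs_Im_le_cmod[of "p z"] im that by (intro growth) simp
        also have "norm (p z) ^ N \<le> (2 * (Re z + 1)) ^ N"
          using cmod_le[of "p z"] re im that R by (intro power_mono) auto
        finally show ?thesis
          unfolding power_mult_distrib by simp
      qed
      show "((\<lambda>x. 2 ^ N * (x + 1) ^ N / exp (x / 3)) \<longlongrightarrow> (0::real)) at_top"
        by (rule power_over_exp_tendsto_0) simp
    qed (use B' that in \<open>auto simp: w_def a_def\<close>)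
    then show ?thesis by (simp add: w)
  qed
  show ?thesis
  proof (intro exI[of _ B'] allI impI)
    fix s assume s: "-1 \<le> Re s \<and> Re s \<le> 2"
    have "norm (V s) \<le> B'"
    proof -
      consider "\<bar>Im s\<bar> \<le> R" | "Im s \<ge> R" | "- Im s \<ge> R" by linarith
      then show ?thesis
      proof cases
        case 1
        then have "s \<in> K" using s by (auto simp: K_def in_cbox_complex_iff)
        then show ?thesis using B1 B' by (meson order_trans)
      next
        case 2
        then show ?thesis using half[of 1 "Re s" "Im s"] s by simp
      next
        case 3
        then show ?thesis using half[of "-1" "Re s" "Im s"] s by simp
      qed
    qed
    moreover have "norm (s + 2) ^ m > 0"
      using nz[of s] s by auto
    ultimately show "norm (E s) \<le> B' * norm (s + 2) ^ m"
      by (simp add: V_def norm_divide norm_power pos_divide_le_eq)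
  qed
qed

text \<open>The entire function \<open>(s - 1) ^ m * (F s - 1) * 2 powr s\<close> has polynomial growth in both half
  planes, hence (Phragmen-Lindeloef) everywhere, and it tends to 0 along the negative real axis.\<close>
lemma dirichlet_series_bounded_left_imp_eq_1:
  assumes ds: "has_dirichlet_series F" and ext: "extends_with_order m F"
    and left: "\<And>s. Re s \<le> -1 \<Longrightarrow> norm (F s) \<le> M" and "s \<noteq> 1"
  shows "F s = 1"
proof -
  obtain G where G: "entire_of_finite_order G" and eq: "\<And>s. s \<noteq> 1 \<Longrightarrow> G s = (s - 1) ^ m * F s"
    using ext unfolding extends_with_order_def by blast
  have holG: "G holomorphic_on UNIV"
    using G by (simp add: entire_of_finite_order_def)
  obtain N R where R: "R \<ge> 1" and GR: "\<And>s. norm s \<ge> R \<Longrightarrow> norm (G s) \<le> exp (norm s ^ N)"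
    using entire_of_finite_order_growth[OF G] by blast
  obtain K where "K \<ge> 0" and K: "\<And>s. Re s \<ge> 2 \<Longrightarrow> norm (F s - 1) \<le> K * 2 powr (- Re s)"
    using dirichlet_series_near_1[OF ds] by blast
  have M: "M \<ge> 0"
    using left[of "-1"] norm_ge_zero[of "F (-1)"] by (simp del: norm_ge_zero)
  define E where "E = (\<lambda>s. (G s - (s - 1) ^ m) * exp (s * of_real (ln 2)))"
  have hE: "E holomorphic_on UNIV"
    unfolding E_def by (intro holomorphic_intros holG)
  have normE: "norm (E s) = norm (s - 1) ^ m * norm (F s - 1) * 2 powr Re s" if "s \<noteq> 1" for s
  proof -
    have "G s - (s - 1) ^ m = (s - 1) ^ m * (F s - 1)"
      using eq[OF that] by (simp add: algebra_simps)
    then show ?thesis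
      by (simp add: E_def norm_mult norm_power powr_def mult.commute)
  qed
  have E_right: "norm (E s) \<le> K * norm (s - 1) ^ m" if "Re s \<ge> 2" for s
  proof -
    have "norm (E s) \<le> norm (s - 1) ^ m * (K * 2 powr (- Re s)) * 2 powr Re s"
      using that K[OF that] by (subst normE) (auto intro!: mult_right_mono mult_left_mono)
    then show ?thesis by (simp add: powr_minus field_simps)
  qed
  have E_left: "norm (E s) \<le> (M + 1) * norm (s - 1) ^ m * 2 powr Re s" if "Re s \<le> -1" for s
  proof -
    have "norm (F s - 1) \<le> M + 1"
      using left[OF that] norm_triangle_ineq4[of "F s" 1] by simp
    then have "norm (E s) \<le> norm (s - 1) ^ m * (M + 1) * 2 powr Re s"
      using that by (subst normE) (auto intro!: mult_right_mono mult_left_mono)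
    then show ?thesis by (simp add: mult_ac)
  qed
  have E_left': "norm (E s) \<le> (M + 1) * norm (s - 1) ^ m" if "Re s \<le> -1" for s
  proof -
    have "2 powr Re s \<le> 2 powr 0" using that by (intro powr_mono) auto
    then have "(M + 1) * norm (s - 1) ^ m * 2 powr Re s \<le> (M + 1) * norm (s - 1) ^ m * 1"
      using M by (intro mult_left_mono) auto
    then show ?thesis using E_left[OF that] by simp
  qed
  \<comment> \<open>A crude bound that suffices for Phragmen-Lindeloef: the exponent is at most (3 +
    2^m) r^(N + m + 1), and the threshold on |s| turns the factor 3 + 2^m into one more power of
    r.\<close>
  have growth: "norm (E s) \<le> exp (norm s ^ (N + m + 2))" if "norm s \<ge> max R (3 + 2 ^ m)" for s
  proof -
    define r where "r = norm s"
    have r: "r \<ge> R" "r \<ge> 3 + 2 ^ m" "r \<ge> 1" using that R by (auto simp: r_def)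
    have "norm (s - 1) ^ m \<le> (2 * r) ^ m"
      using norm_triangle_ineq4[of s 1] r by (intro power_mono) (auto simp: r_def)
    also have "\<dots> \<le> exp ((2 * r) ^ m)"
      using exp_ge_add_one_self[of "(2 * r) ^ m"] by linarith
    finally have 1: "norm (s - 1) ^ m \<le> exp ((2 * r) ^ m)" .
    have 2: "norm (G s) \<le> exp (r ^ N)"
      using GR r by (simp add: r_def)
    have "norm (G s - (s - 1) ^ m) \<le> exp (r ^ N) + exp ((2 * r) ^ m)"
      using norm_triangle_ineq4[of "G s" "(s - 1) ^ m"] 1 2 by (simp add: norm_power)
    also have "\<dots> \<le> 2 * exp (r ^ N + (2 * r) ^ m)"
      using r by (smt (verit) exp_le_cancel_iff zero_le_power)
    also have "\<dots> \<le> exp 1 * exp (r ^ N + (2 * r) ^ m)"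
      using exp_ge_add_one_self[of 1] by (intro mult_right_mono) auto
    finally have 3: "norm (G s - (s - 1) ^ m) \<le> exp (1 + (r ^ N + (2 * r) ^ m))"
      by (simp add: exp_add)
    have "Re s * ln 2 \<le> r * 1"
    proof (rule order_trans[OF mult_right_mono mult_left_mono])
      show "Re s \<le> r" by (simp add: r_def complex_Re_le_cmod)
    qed (use r ln_2_less_1 in auto)
    then have 4: "norm (exp (s * of_real (ln 2))) \<le> exp r"
      by simp
    have "norm (E s) \<le> exp (1 + (r ^ N + (2 * r) ^ m)) * exp r"
      unfolding E_def norm_mult using 3 4 by (intro mult_mono) auto
    also have "\<dots> = exp (1 + r ^ N + 2 ^ m * r ^ m + r)"
      by (simp add: exp_add power_mult_distrib)
    also have "1 + r ^ N + 2 ^ m * r ^ m + r \<le> r ^ (N + m + 2)"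
    proof -
      define q where "q = r ^ (N + m + 1)"
      have "1 \<le> q" unfolding q_def using r by (intro one_le_power) auto
      moreover have "r ^ N \<le> q" unfolding q_def using r by (intro power_increasing) auto
      moreover have "2 ^ m * r ^ m \<le> 2 ^ m * q" unfolding q_def using r by (intro mult_left_mono power_increasing) auto
      moreover have "r ^ 1 \<le> q" unfolding q_def using r by (intro power_increasing) auto
      ultimately have "1 + r ^ N + 2 ^ m * r ^ m + r \<le> q + q + 2 ^ m * q + q"
        unfolding power_one_right by linarith
      also have "\<dots> = (3 + 2 ^ m) * q"
        by (simp add: algebra_simps)
      also have "\<dots> \<le> r * q" using r \<open>1 \<le> q\<close> by (intro mult_right_mono) auto
      finally show ?thesis by (simp add: q_def)
    qed
    finally show ?thesis by (simp add: r_def)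
  qed
  define B where "B = (K + M + 1) * 4 ^ m"
  have "norm (E s) \<le> B * norm (s + 2) ^ m" if "Re s = 2 \<or> Re s = -1" for s
  proof -
    have "norm (s - 1) \<le> norm (s + 2) + 3 * 1"
      using norm_triangle_ineq4[of "s + 2" 3] by simp
    also have "1 \<le> norm (s + 2)"
      using abs_Re_le_cmod[of "s + 2"] that by auto
    finally have "norm (s - 1) \<le> 4 * norm (s + 2)" by simp
    then have *: "norm (s - 1) ^ m \<le> 4 ^ m * norm (s + 2) ^ m"
      using power_mono[of "norm (s - 1)" "4 * norm (s + 2)" m] by (simp add: power_mult_distrib)
    have "norm (E s) \<le> (K + M + 1) * norm (s - 1) ^ m"
      using that
    proof
      assume "Re s = 2"
      then have "norm (E s) \<le> K * norm (s - 1) ^ m" by (intro E_right) simp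
      also have "\<dots> \<le> (K + M + 1) * norm (s - 1) ^ m" using M by (intro mult_right_mono) auto
      finally show ?thesis .
    next
      assume "Re s = -1"
      then have "norm (E s) \<le> (M + 1) * norm (s - 1) ^ m" by (intro E_left') simp
      also have "\<dots> \<le> (K + M + 1) * norm (s - 1) ^ m" using \<open>K \<ge> 0\<close> by (intro mult_right_mono) auto
      finally show ?thesis .
    qed
    also have "\<dots> \<le> (K + M + 1) * (4 ^ m * norm (s + 2) ^ m)"
      using M \<open>K \<ge> 0\<close> * by (intro mult_left_mono) auto
    finally show ?thesis by (simp add: B_def)
  qed
  moreover have "max R (3 + 2 ^ m) \<ge> 0" using R by simp
  ultimately obtain B' where B': "\<And>s. -1 \<le> Re s \<Longrightarrow> Re s \<le> 2 \<Longrightarrow> norm (E s) \<le> B' * norm (s + 2) ^ m"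
    using polynomial_bound_in_strip[OF hE _ growth] by meson
  define B2 where "B2 = \<bar>B'\<bar> + K + M + 1"
  have "norm (E s) \<le> B2 * 3 ^ m * norm s ^ m" if "1 \<le> norm s" for s
  proof -
    have "norm (s - 1) \<le> 3 * norm s" "norm (s + 2) \<le> 3 * norm s"
      using norm_triangle_ineq4[of s 1] norm_triangle_ineq[of s 2] that by auto
    then have *: "norm (s - 1) ^ m \<le> (3 * norm s) ^ m" "norm (s + 2) ^ m \<le> (3 * norm s) ^ m"
      by (simp_all only: power_mono norm_ge_zero)
    consider "Re s \<ge> 2" | "Re s \<le> -1" | "-1 \<le> Re s \<and> Re s \<le> 2" by linarith
    then have "norm (E s) \<le> B2 * (3 * norm s) ^ m"
    proof cases
      case 1
      have "K * norm (s - 1) ^ m \<le> B2 * (3 * norm s) ^ m"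
        using * M \<open>K \<ge> 0\<close> by (intro mult_mono) (auto simp: B2_def)
      then show ?thesis using E_right[OF 1] by linarith
    next
      case 2
      have "(M + 1) * norm (s - 1) ^ m \<le> B2 * (3 * norm s) ^ m"
        using * M \<open>K \<ge> 0\<close> by (intro mult_mono) (auto simp: B2_def)
      then show ?thesis using E_left'[OF 2] by linarith
    next
      case 3
      have "B' * norm (s + 2) ^ m \<le> B2 * (3 * norm s) ^ m"
        using * M \<open>K \<ge> 0\<close> by (intro mult_mono) (auto simp: B2_def)
      then show ?thesis using B'[of s] 3 by linarith
    qed
    then show ?thesis by (simp add: power_mult_distrib)
  qed
  note poly = this
  have "((\<lambda>x::real. E (of_real (- x))) \<longlongrightarrow> 0) at_top"
  proof (rule Lim_null_comparison)
    show "\<forall>\<^sub>F x in at_top. norm (E (of_real (- x))) \<le> (M + 1) * (x + 1) ^ m / exp (x / (1 / ln 2))"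
      using eventually_ge_at_top[of 1]
    proof eventually_elim
      case (elim x)
      have "complex_of_real (- x) - 1 = - complex_of_real (x + 1)" by simp
      then have "norm (complex_of_real (- x) - 1) = x + 1"
        unfolding norm_minus_cancel norm_of_real using elim by (simp only: norm_minus_cancel norm_of_real)
      then have "norm (E (of_real (- x))) \<le> (M + 1) * (x + 1) ^ m * 2 powr (- x)"
        using E_left[of "of_real (- x)"] elim by simp
      then show ?case
        by (simp add: powr_def exp_minus field_simps)
    qed
    show "((\<lambda>x. (M + 1) * (x + 1) ^ m / exp (x / (1 / ln 2))) \<longlongrightarrow> 0) at_top"
      by (rule power_over_exp_tendsto_0) simp
  qed
  then have "E s = 0"
    using entire_polynomial_growth_eq_0[of E 1 "B2 * 3 ^ m" m] hE poly by blast
  then have "(s - 1) ^ m * F s = (s - 1) ^ m"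
    using eq[OF \<open>s \<noteq> 1\<close>] by (simp add: E_def)
  then show ?thesis using \<open>s \<noteq> 1\<close> by simp
qed

text \<open>The polynomial factors of \<open>completed\<close> at s and 1 - \<open>cnj\<close> s
  have equal modulus and cancel in the functional equation, leaving Q^(Re s) |F(s)| = Q^(1 - Re s)
  |F(1 - cnj s)|. For Q <= 1 on the left this gives |F(s)| <= |F(1 - cnj s)|, and the Dirichlet
  series bounds the right-hand side.\<close>

lemma degree_zero_bounded_left:
  assumes ds: "has_dirichlet_series F" and holF: "F holomorphic_on - {1}"
    and fe: "has_functional_equation F Q 0 \<Lambda> \<mu> \<omega>" and "Q \<le> 1"
  shows "\<exists>M. \<forall>s. Re s \<le> -1 \<longrightarrow> norm (F s) \<le> M"
proof -
  have Q: "Q > 0" and \<omega>: "norm \<omega> = 1"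
    using fe by (auto simp: has_functional_equation_def)
  obtain K where "K \<ge> 0" and K: "\<And>s. Re s \<ge> 2 \<Longrightarrow> norm (F s - 1) \<le> K * 2 powr (- Re s)"
    using dirichlet_series_near_1[OF ds] by blast
  show ?thesis
  proof (intro exI[of _ "K + 1"] allI impI)
    fix s assume s: "Re s \<le> -1"
    define s' where "s' = 1 - cnj s"
    have s': "Re s' = 1 - Re s" "s \<noteq> 1" "s' \<noteq> 1" "s \<noteq> 0"
      using s by (auto simp: s'_def)
    define c where "c = norm s ^ polar_order F * norm (s - 1) ^ polar_order F"
    have "c > 0" using s' by (simp add: c_def)
    have n1: "norm s' = norm (s - 1)"
      unfolding s'_def by (metis complex_cnj_diff complex_cnj_one complex_mod_cnj norm_minus_commute)
    have n2: "norm (s' - 1) = norm s"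
      unfolding s'_def by simp
    have gam: "norm (gamma_factor Q 0 \<Lambda> \<mu> w) = Q powr Re w" for w
      using Q by (simp add: gamma_factor_def norm_powr_real_powr)
    have "norm (completed F Q 0 \<Lambda> \<mu> s) = norm (completed F Q 0 \<Lambda> \<mu> s')"
      using fe \<omega> unfolding has_functional_equation_def s'_def by (metis complex_mod_cnj mult_1 norm_mult)
    then have "c * (Q powr Re s * norm (F s)) = c * (Q powr Re s' * norm (F s'))"
      using completed_eq[OF fe holF s'(2)] completed_eq[OF fe holF s'(3)]
      by (simp add: c_def norm_mult norm_power gam n1 n2 mult_ac)
    then have "Q powr Re s * norm (F s) = Q powr Re s' * norm (F s')"
      using \<open>c > 0\<close> by simp
    moreover have "Q powr Re s' \<le> Q powr Re s"
      using Q \<open>Q \<le> 1\<close> s s' by (intro powr_mono') auto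
    ultimately have "Q powr Re s * norm (F s) \<le> Q powr Re s * norm (F s')"
      by (simp add: mult_right_mono)
    then have "norm (F s) \<le> norm (F s')"
      using Q by simp
    also have "\<dots> \<le> norm (F s' - 1) + 1"
      using norm_triangle_ineq[of "F s' - 1" 1] by simp
    also have "norm (F s' - 1) \<le> K * 2 powr (- Re s')"
      using s s' by (intro K) auto
    also have "\<dots> \<le> K * 2 powr 0"
      using s s' \<open>K \<ge> 0\<close> by (intro mult_left_mono powr_mono) auto
    finally show "norm (F s) \<le> K + 1" by simp
  qed
qed

section \<open>Constant Z, and the conclusion\<close>

lemma higher_deriv_const: "(deriv ^^ Suc k) (\<lambda>_. c) = (\<lambda>_. 0 :: 'a :: real_normed_field)"
  by (induction k) auto

text \<open>For k = 0 there are no zeros at all; for k > 0 every point is a zero, so no two zeros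
  are consecutive.\<close>

lemma no_consecutive_zeros_of_const:
  assumes "c \<noteq> (0::real)"
  shows "\<not> consecutive_zeros ((deriv ^^ k) (\<lambda>_. c)) x y"
proof (cases k)
  case 0
  then show ?thesis using assms by (simp add: consecutive_zeros_def)
next
  case (Suc j)
  show ?thesis
    unfolding Suc higher_deriv_const consecutive_zeros_def using dense[of x y] by auto
qed

text \<open>exp(i \<open>\<theta>\<close>) F is real and, as F = 1, has modulus 1; so Z is
  continuous with values 1 and -1 only.\<close>

lemma hardy_Z_const:
  assumes F: "F \<in> extended_selberg_class" and fe: "has_functional_equation F Q r \<Lambda> \<mu> \<omega>"
    and \<theta>: "is_theta_function Q r \<Lambda> \<mu> \<omega> \<theta>" and F1: "\<And>s. s \<noteq> 1 \<Longrightarrow> F s = 1"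
  shows "\<exists>c. c \<noteq> 0 \<and> hardy_Z F \<theta> = (\<lambda>_. c)"
proof -
  have F1': "F (Complex (1/2) t) = 1" for t
    by (rule F1) (simp add: complex_eq_iff)
  have Z: "hardy_Z F \<theta> = (\<lambda>t. cos (\<theta> t))"
    by (rule ext) (simp add: hardy_Z_def F1' Re_exp)
  have abs1: "\<bar>hardy_Z F \<theta> t\<bar> = 1" for t
  proof -
    have "\<bar>hardy_Z F \<theta> t\<bar> = norm (complex_of_real (hardy_Z F \<theta> t))"
      by (simp only: norm_of_real)
    also have "\<dots> = 1"
      unfolding of_real_hardy_Z[OF F fe \<theta>] F1' by simp
    finally show ?thesis .
  qed
  have "\<theta> differentiable_on UNIV"
    using \<theta> unfolding is_theta_function_def smooth_real_def by (metis funpow_0)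
  then have "continuous_on UNIV (hardy_Z F \<theta>)"
    unfolding Z by (intro continuous_intros differentiable_imp_continuous_on)
  moreover have "finite (range (hardy_Z F \<theta>))"
  proof (rule finite_subset)
    show "range (hardy_Z F \<theta>) \<subseteq> {1, -1}"
      using abs1 by (auto simp: abs_if split: if_splits) (metis add.inverse_inverse)
  qed simp
  ultimately have "hardy_Z F \<theta> constant_on UNIV"
    by (intro continuous_finite_range_constant) auto
  then obtain c where "hardy_Z F \<theta> = (\<lambda>_. c)"
    unfolding constant_on_def by auto
  with abs1 show ?thesis by (intro exI[of _ c]) auto
qed

theorem theorem1p1:
  fixes F :: "complex \<Rightarrow> complex"
    and Q :: real and r :: nat and \<Lambda> :: "nat \<Rightarrow> real" and \<mu> :: "nat \<Rightarrow> complex" and \<omega> :: complex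
    and \<theta> :: "real \<Rightarrow> real"
  assumes "F \<in> extended_selberg_class"
    and "has_functional_equation F Q r \<Lambda> \<mu> \<omega>"
    and "is_theta_function Q r \<Lambda> \<mu> \<omega> \<theta>"
    and "riemann_hypothesis F Q r \<Lambda> \<mu>"
  shows "\<forall>k::nat. \<exists>T>0. \<forall>\<gamma> \<gamma>'.
           T \<le> \<gamma> \<and> consecutive_zeros ((deriv ^^ k) (hardy_Z F \<theta>)) \<gamma> \<gamma>' \<longrightarrow>
           (\<exists>!t. \<gamma> < t \<and> t < \<gamma>' \<and> (deriv ^^ (k + 1)) (hardy_Z F \<theta>) t = 0)"
proof (cases "r > 0 \<or> Q > 1")
  case True
  then show ?thesis
    using one_zero_between_consecutive_zeros[OF assms] by blast
next
  case False
  have ds: "has_dirichlet_series F" and "\<exists>m. extends_with_order m F"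
    using assms(1) by (auto simp: extended_selberg_class_def)
  then obtain m where m: "extends_with_order m F" by blast
  have "r = 0" "Q \<le> 1" using False by auto
  obtain M where "\<And>s. Re s \<le> -1 \<Longrightarrow> norm (F s) \<le> M"
    using degree_zero_bounded_left[OF ds holomorphic_of_extends_with_order[OF m] _ \<open>Q \<le> 1\<close>]
      assms(2) unfolding \<open>r = 0\<close> by blast
  then have "F s = 1" if "s \<noteq> 1" for s
    using dirichlet_series_bounded_left_imp_eq_1[OF ds m _ that] by blast
  from hardy_Z_const[OF assms(1-3) this]
  obtain c where "c \<noteq> 0" "hardy_Z F \<theta> = (\<lambda>_. c)" by blast
  \<comment> \<open>The claim is vacuous here, so the witness 1 for \<open>T\<close> is
    arbitrary.\<close>
  then show ?thesis
    using no_consecutive_zeros_of_const[of c] by (auto intro: exI[of _ 1])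
qed

end
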